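(* Let $p\equiv 3\pmod 8$ be a prime, $q=p^s$, $m\ge 4$, and assume $2^m\mid q-1$ (equivalently $2^{m-2}\mid s$). Then the reduced period polynomial $P_{2^m}^*(X)$ of degree $2^m$ for $\mathbb F_q$ factors into irreducible polynomials over $\mathbb Q$ as follows. (a) If $2^{m-1}\mid s$, then \begin{align*} P_{2^m}^*(X)=\,& (X-q^{\frac 12}+4B_3 q^{\frac 14})^{2^{m-2}} (X-q^{\frac 12}-4B_3 q^{\frac 14})^{2^{m-2}}\\ &\times (X-q^{\frac 12}+8B_4 q^{\frac 38})^{2^{m-3}} (X-q^{\frac 12}-8B_4 q^{\frac 38})^{2^{m-3}}\\ &\times \Bigl(X+3q^{\frac 12}-\sum_{r=3}^{m-2} 2^{r-1}A_r q^{\frac{2^{r-2}-1}{2^{r-1}}}+2^{m-2}A_{m-1} q^{\frac{2^{m-3}-1}{2^{m-2}}}\Bigr)^2\\ &\times \Bigl(X+3q^{\frac 12}-\sum_{r=3}^{m-1} 2^{r-1}A_r q^{\frac{2^{r-2}-1}{2^{r-1}}}+2^{m-1}A_m q^{\frac{2^{m-2}-1}{2^{m-1}}}\Bigr)\\ &\times \Bigl(X+3q^{\frac 12}-\sum_{r=3}^m 2^{r-1}A_r q^{\frac{2^{r-2}-1}{2^{r-1}}}\Bigr)\prod_{t=2}^{m-3}Q_t(X)^{2^{m-t-2}}. \end{align*} (b) If $2^{m-2}\parallel s$ and $m\ge 5$, then \begin{align*} P_{2^m}^*(X)=\,& (X-q^{\frac 12}+4B_3 q^{\frac 14})^{2^{m-2}}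 (X-q^{\frac 12}-4B_3 q^{\frac 14})^{2^{m-2}}\\ &\times (X-q^{\frac 12}+8B_4 q^{\frac 38})^{2^{m-3}} (X-q^{\frac 12}-8B_4 q^{\frac 38})^{2^{m-3}}\\ &\times \Bigl(X+3q^{\frac 12}-\sum_{r=3}^{m-2} 2^{r-1}A_r q^{\frac{2^{r-2}-1}{2^{r-1}}}+2^{m-2}A_{m-1} q^{\frac{2^{m-3}-1}{2^{m-2}}}\Bigr)^2\\ &\times \left(\Bigl(X+3q^{\frac 12}-\sum_{r=3}^{m-1} 2^{r-1}A_r q^{\frac{2^{r-2}-1}{2^{r-1}}}\Bigr)^2+2^{2(m-1)}A_m^2 q^{\frac{2^{m-2}-1}{2^{m-2}}}\right)\\ &\times \left(\Bigl(X+3q^{\frac 12}-\sum_{r=3}^{m-3} 2^{r-1}A_r q^{\frac{2^{r-2}-1}{2^{r-1}}}+2^{m-3}A_{m-2} q^{\frac{2^{m-4}-1}{2^{m-3}}}\Bigr)^2+2^{2(m-1)}B_m^2 q^{\frac{2^{m-2}-1}{2^{m-2}}}\right)^2\\ &\times \prod_{t=2}^{m-4}Q_t(X)^{2^{m-t-2}}. \end{align*} (c) If $4\parallel s$ (and $m=4$), then \begin{align*} P_{16}^*(X)=\,&(X+3q^{\frac 12}+4A_3 q^{\frac 14})^2 (X-q^{\frac 12}+4B_3 q^{\frac 14})^4 (X-q^{\frac 12}-4B_3 q^{\frac 14})^4\\ &\times\left((X+3q^{\frac 12}-4A_3 q^{\frac 14})^2+64A_4^2 q^{\frac 34}\right)\left((X-q^{\frac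 12})^2+64B_4^2 q^{\frac 34}\right)^2. \end{align*} Here \begin{align*} Q_t(X)=\,&\Bigl(X+3q^{\frac 12}-\sum_{r=3}^t 2^{r-1}A_r q^{\frac{2^{r-2}-1}{2^{r-1}}}+2^t A_{t+1} q^{\frac{2^{t-1}-1}{2^t}}+2^{t+2}B_{t+3}q^{\frac{2^{t+1}-1}{2^{t+2}}}\Bigr)\\ &\times\Bigl(X+3q^{\frac 12}-\sum_{r=3}^t 2^{r-1}A_r q^{\frac{2^{r-2}-1}{2^{r-1}}}+2^t A_{t+1} q^{\frac{2^{t-1}-1}{2^t}}-2^{t+2}B_{t+3}q^{\frac{2^{t+1}-1}{2^{t+2}}}\Bigr). \end{align*}
   Context: $\mathbb F_q$ is a finite field with $q=p^s$ elements, $p$ an odd prime; $\mathrm{Tr}:\mathbb F_q\to\mathbb F_p$ is the trace, $\zeta_n=\exp(2\pi i/n)$, and $\gamma$ is a fixed generator of $\mathbb F_q^*$. For $e\mid q-1$, the reduced cyclotomic periods of order $e$ are $\eta_k^*=\sum_{x\in\mathbb F_q}\zeta_p^{\mathrm{Tr}(\gamma^k x^e)}$, $k=0,\dots,e-1$, and the reduced period polynomial of degree $e$ is $P_e^*(X)=\prod_{k=0}^{e-1}(X-\eta_k^* )$ (it has integer coefficients and does not depend on $\gamma$). All fractional powers $q^{a}$ denote positive real numbers. Empty sums are $0$ and empty products are $1$. For $3\le r\le m$ the integers $A_r,B_r$ are the unique integers satisfying $p^{s/2^{r-2}}=A_r^2+2B_r^2$, $A_r\equiv -1\pmod 4$,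 $p\nmid A_r$, and $2B_r\equiv A_r(\gamma^{(q-1)/8}+\gamma^{3(q-1)/8})\pmod p$ (the last congruence meaning equality in $\mathbb F_q$ of the images); in particular $A_r$ and $|B_r|$ are determined by the first three conditions. *)

theory Defs
  imports
    Complex_Main
    "HOL-Library.Cardinality"
    "HOL-Computational_Algebra.Computational_Algebra"
    "HOL-Number_Theory.Cong"
begin

definition generates_units :: "'a::field \<Rightarrow> bool" where
  "generates_units \<gamma> \<longleftrightarrow> range (\<lambda>k::nat. \<gamma> ^ k) = UNIV - {0}"

definition zeta :: "nat \<Rightarrow> complex" where
  "zeta n = exp (2 * of_real pi * \<i> / of_nat n)"

text \<open>The trace of the field with \<open>p ^ s\<close> elements over its prime field, as an element of the
  big field.\<close>

definition abs_trace :: "nat \<Rightarrow> nat \<Rightarrow> 'a::field \<Rightarrow> 'a" where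
  "abs_trace p s x = (\<Sum>i<s. x ^ (p ^ i))"

text \<open>The canonical representative in \<open>{0..<p}\<close> of an element of the prime field of
  characteristic \<open>p\<close>.\<close>

definition prime_field_rep :: "nat \<Rightarrow> 'a::field \<Rightarrow> nat" where
  "prime_field_rep p u = (THE n. n < p \<and> of_nat n = u)"

definition reduced_period :: "nat \<Rightarrow> nat \<Rightarrow> 'a::finite_field \<Rightarrow> nat \<Rightarrow> nat \<Rightarrow> complex" where
  "reduced_period p s \<gamma> e k =
     (\<Sum>x\<in>(UNIV :: 'a set). zeta p ^ prime_field_rep p (abs_trace p s (\<gamma> ^ k * x ^ e)))"

definition reduced_period_poly :: "nat \<Rightarrow> nat \<Rightarrow> 'a::finite_field \<Rightarrow> nat \<Rightarrow> complex poly" where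
  "reduced_period_poly p s \<gamma> e = (\<Prod>k<e. [:- reduced_period p s \<gamma> e k, 1:])"

text \<open>The pair of integers representing \<open>p ^ (s / 2 ^ (r - 2))\<close> by the form \<open>A\<^sup>2 + 2 B\<^sup>2\<close>. It is used
  only for \<open>r \<ge> 3\<close> with \<open>2 ^ (r - 2)\<close> dividing \<open>s\<close>, and for fields whose number of elements is
  congruent to 1 modulo 8, so that all divisions are exact. The last conjunct is the congruence
  modulo \<open>p\<close>, read as an equation in the field.\<close>

definition quad_rep :: "nat \<Rightarrow> nat \<Rightarrow> 'a::finite_field \<Rightarrow> nat \<Rightarrow> int \<times> int" where
  "quad_rep p s \<gamma> r = (THE (A, B).
     int p ^ (s div 2 ^ (r - 2)) = A\<^sup>2 + 2 * B\<^sup>2 \<and>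
     [A = -1] (mod 4) \<and>
     \<not> int p dvd A \<and>
     (of_int (2 * B) :: 'a) =
       of_int A * (\<gamma> ^ ((CARD('a) - 1) div 8) + \<gamma> ^ (3 * ((CARD('a) - 1) div 8))))"

definition coeff_A :: "nat \<Rightarrow> nat \<Rightarrow> 'a::finite_field \<Rightarrow> nat \<Rightarrow> int" where
  "coeff_A p s \<gamma> r = fst (quad_rep p s \<gamma> r)"

definition coeff_B :: "nat \<Rightarrow> nat \<Rightarrow> 'a::finite_field \<Rightarrow> nat \<Rightarrow> int" where
  "coeff_B p s \<gamma> r = snd (quad_rep p s \<gamma> r)"

definition partial_const :: "real \<Rightarrow> (nat \<Rightarrow> int) \<Rightarrow> nat \<Rightarrow> real" where
  "partial_const q A t = 3 * q powr (1/2)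
     - (\<Sum>r=3..t. 2 ^ (r - 1) * of_int (A r) * q powr ((2 ^ (r - 2) - 1) / 2 ^ (r - 1)))"

text \<open>The polynomial \<open>Q\<^sub>t\<close> is the product of the two linear factors given by the signs
  \<open>\<epsilon> = 1\<close> and \<open>\<epsilon> = -1\<close>.\<close>

definition Q_factor :: "real \<Rightarrow> (nat \<Rightarrow> int) \<Rightarrow> (nat \<Rightarrow> int) \<Rightarrow> real \<Rightarrow> nat \<Rightarrow> real poly" where
  "Q_factor q A B \<epsilon> t =
     [: partial_const q A t
        + 2 ^ t * of_int (A (t + 1)) * q powr ((2 ^ (t - 1) - 1) / 2 ^ t)
        + \<epsilon> * (2 ^ (t + 2) * of_int (B (t + 3)) * q powr ((2 ^ (t + 1) - 1) / 2 ^ (t + 2))), 1 :]"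

definition irreducible_over_rat :: "real poly \<Rightarrow> bool" where
  "irreducible_over_rat f \<longleftrightarrow> (\<exists>g :: rat poly. irreducible g \<and> map_poly of_rat g = f)"

text \<open>\<open>F\<close> is the product of the powers \<open>f ^ n\<close>, for \<open>(f, n)\<close> in the list \<open>fs\<close>, and every \<open>f\<close> has
  rational coefficients and is irreducible over the rationals.\<close>

definition factors_into_irreducibles :: "complex poly \<Rightarrow> (real poly \<times> nat) list \<Rightarrow> bool" where
  "factors_into_irreducibles F fs \<longleftrightarrow>
     F = (\<Prod>(f, n)\<leftarrow>fs. map_poly complex_of_real f ^ n) \<and>
     (\<forall>(f, n)\<in>set fs. irreducible_over_rat f)"

end

theory Submission
  imports Defs "HOL-Number_Theory.Number_Theory"
begin

text \<open>
  The periods are finite Fourier transforms of the Gauss sums \<open>G(\<chi>)\<close> of the characters of order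
  \<open>2 ^ r\<close>, \<open>r \<le> m\<close>. Since \<open>G(\<chi> ^ p) = G(\<chi>)\<close> and \<open>p\<close> generates the classes 1 and 3 modulo 8, for every
  \<open>r \<ge> 3\<close> there are only the two values \<open>G\<^sub>r = G(\<chi>)\<close> and \<open>G(\<chi>\<inverse>)\<close>; they enter the period with
  index \<open>k\<close> through a factor that depends only on the 2-adic valuation of \<open>k\<close> and one sign.

  The duplication formula gives \<open>G\<^sub>2 = G\<^sub>1 = -\<surd>q\<close>, \<open>G\<^sub>3\<^sup>2 = -\<surd>q K\<close> with a Jacobi sum
  \<open>K = u + v\<surd>-2\<close> of norm \<open>q\<close>, and \<open>G\<^sub>r\<^sub>+\<^sub>1\<^sup>2 = -\<surd>q G\<^sub>r\<close>. At one of the two primes over \<open>p\<close>,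
  \<open>K\<close> reduces to a binomial coefficient that \<open>p\<close> does not divide, so that \<open>u = \<plusminus>A\<^sub>2\<close> by the uniqueness of the representation by
  \<open>A\<^sup>2 + 2B\<^sup>2\<close>. The same uniqueness relates \<open>A\<^sub>r\<close> to \<open>A\<^sub>r\<^sub>+\<^sub>1\<^sup>2\<close>. Hence the recursion determines
  the real parts of all \<open>G\<^sub>r\<close> up to sign, and the wrong sign of the real part of \<open>G\<^sub>r\<close> would make
  the next real part (or, at the last step, imaginary part) irrational by a factor \<open>\<surd>2\<close>.
\<close>

section \<open>Binomial coefficients modulo a prime\<close>

text \<open>Relations between squares of Gauss sums never show a sign, so the sign must come from
  arithmetic. Let \<open>D r\<close> be the sum of the two values at level \<open>r\<close>, and
  suppose that it is \<open>2 * e * hh r * A r\<close> with \<open>e\<close> equal to 1 or -1. For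
  even \<open>n = n (Suc r)\<close> the recursion makes the square of \<open>D (Suc r)\<close> equal
  to \<open>hs (Suc r)\<close> times \<open>2 * p ^ n - 2 * e * A r\<close>. As
  \<open>A r = p ^ n - 2 * (A (Suc r))^2\<close>, this is a half-angle formula: the second factor is
  \<open>4 * (A (Suc r))^2\<close> for \<open>e = 1\<close> and \<open>8 * (B (Suc r))^2\<close> for
  \<open>e = -1\<close>. That \<open>D (Suc r)\<close> is rational is seen by sorting the Gauss sum
  by the values of the trace, which leaves character sums over Frobenius-stable sets. So a sign is
  known only one level later. This suffices: above every level with real \<open>D\<close> the field
  has a further one, and the top level is purely imaginary, enters through the square of
  \<open>D\<close>, and produces the quadratic factors. No ring of algebraic integers is needed to
  reduce \<open>K\<close> modulo a prime: its integer coefficients can be read both in the complex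
  numbers and in the finite field.\<close>

lemma fact_prime_shift:
  fixes p :: nat
  assumes "prime p" "b < p"
  shows "\<exists>t. \<not> p dvd t \<and> fact (p * a + b) = p ^ a * fact a * t"
proof -
  have p1: "p > 1" using assms(1) prime_gt_1_nat by blast
  \<comment> \<open>Induction over all \<open>n\<close>: a new factor prime to \<open>p\<close> goes
    into \<open>t\<close>, while a multiple of \<open>p\<close> is \<open>p * Suc (n div p)\<close>
    and extends \<open>p ^ a * fact a\<close>.\<close>
  have "\<exists>t. \<not> p dvd t \<and> fact (p * (n div p) + n mod p) = p ^ (n div p) * fact (n div p) * t" for n
  proof (induction n)
    case 0
    show ?case using p1 by (intro exI[of _ 1]) auto
  next
    case (Suc n)
    then obtain t where t: "\<not> p dvd t" "fact n = p ^ (n div p) * fact (n div p) * t"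
      by auto
    show ?case
    proof (cases "p dvd Suc n")
      case True
      then have 1: "Suc n div p = Suc (n div p)" "Suc n mod p = 0"
        by (auto simp: div_Suc mod_Suc dvd_eq_mod_eq_0 split: if_splits)
      have 2: "Suc n = p * Suc (n div p)"
        using 1 by (metis add.right_neutral div_mult_mod_eq mult.commute)
      have "fact (Suc n) = Suc n * fact n" by simp
      also have "\<dots> = p ^ Suc (n div p) * fact (Suc (n div p)) * t"
        by (subst 2, subst t(2)) (simp add: algebra_simps)
      finally show ?thesis using 1 t(1) 2 by (intro exI[of _ t]) auto
    next
      case False
      then have 1: "Suc n div p = n div p"
        by (auto simp: div_Suc dvd_eq_mod_eq_0)
      have "fact (Suc n) = Suc n * fact n" by simp
      also have "\<dots> = p ^ (n div p) * fact (n div p) * (Suc n * t)"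
        by (subst t(2)) (simp add: algebra_simps)
      finally have "fact (p * (Suc n div p) + Suc n mod p)
          = p ^ (Suc n div p) * fact (Suc n div p) * (Suc n * t)"
        unfolding 1 by (metis 1 mult_div_mod_eq)
      moreover have "\<not> p dvd Suc n * t"
        using t(1) False assms(1) prime_dvd_mult_iff by blast
      ultimately show ?thesis by blast
    qed
  qed
  from this[of "p * a + b"] show ?thesis using assms(2) by simp
qed

text \<open>One digit of Lucas' theorem. Because \<open>d \<le> b\<close> there is no borrow in the
  lowest digit, so the powers of \<open>p\<close> in the three factorials cancel and only factors
  prime to \<open>p\<close> separate the two binomial coefficients.\<close>

lemma prime_not_dvd_binomial_step:
  fixes p :: nat
  assumes "prime p" "b < p" "d \<le> b" "c \<le> a" "\<not> p dvd (a choose c)"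
  shows "\<not> p dvd ((p * a + b) choose (p * c + d))"
proof -
  have p1: "p > 1" using assms(1) prime_gt_1_nat by blast
  obtain t where t: "\<not> p dvd t" "fact (p * a + b) = p ^ a * fact a * t"
    using fact_prime_shift[OF assms(1,2)] by blast
  obtain t1 where t1: "\<not> p dvd t1" "fact (p * c + d) = p ^ c * fact c * t1"
    using fact_prime_shift[OF assms(1), of d c] assms by auto
  obtain t2 where t2: "\<not> p dvd t2" "fact (p * (a - c) + (b - d)) = p ^ (a - c) * fact (a - c) * t2"
    using fact_prime_shift[OF assms(1), of "b - d" "a - c"] assms(2,3) less_imp_diff_less by blast
  have le: "p * c + d \<le> p * a + b" using assms by (simp add: add_mono)
  have sub: "p * a + b - (p * c + d) = p * (a - c) + (b - d)"
    using assms(3,4) mult_le_mono2[OF assms(4), of p] by (simp add: diff_mult_distrib2)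
  define C where "C = (p * a + b) choose (p * c + d)"
  have "fact (p * c + d) * fact (p * (a - c) + (b - d)) * C = fact (p * a + b)"
    using binomial_fact_lemma[OF le] sub C_def by simp
  then have "(p ^ c * p ^ (a - c)) * (fact c * fact (a - c) * (C * t1 * t2)) = p ^ a * (fact a * t)"
    using t t1 t2 by (simp add: algebra_simps)
  then have "fact c * fact (a - c) * (C * t1 * t2) = fact a * t"
    using assms(4) p1 by (simp flip: power_add)
  also have "fact a = fact c * fact (a - c) * (a choose c)"
    using binomial_fact_lemma[OF assms(4)] by simp
  finally have "C * t1 * t2 = (a choose c) * t" by simp
  then show ?thesis
    using assms(1,5) t(1) C_def prime_dvd_mult_iff by (metis dvd_triv_left mult.assoc)
qed

text \<open>For \<open>p = 8 * k + 3\<close> the base-\<open>p\<close> digits of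
  \<open>(p ^ s - 1) div 8\<close> alternate between \<open>3 * k + 1\<close> and \<open>k\<close>,
  while all digits of four times this number are \<open>4 * k + 1\<close>, so no borrow occurs. The
  induction handles two digits at a time.\<close>

lemma prime_not_dvd_binomial_half:
  fixes p :: nat
  assumes "prime p" "p mod 8 = 3" "even s"
  shows "\<not> p dvd ((4 * ((p ^ s - 1) div 8)) choose ((p ^ s - 1) div 8))"
proof -
  obtain k where k: "p = 8 * k + 3" using assms(2) by (metis mult_div_mod_eq)
  have "\<not> p dvd ((4 * ((p ^ (2 * n) - 1) div 8)) choose ((p ^ (2 * n) - 1) div 8)) \<and>
    8 dvd p ^ (2 * n) - 1" for n
  proof (induction n)
    case 0
    show ?case using assms(1) prime_gt_1_nat by auto
  next
    case (Suc n)
    then obtain N where N: "p ^ (2 * n) - 1 = 8 * N" by blast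
    have "p ^ (2 * n) > 0" using k by simp
    with N have N': "p ^ (2 * n) = 8 * N + 1" by linarith
    have sq: "p ^ 2 - 1 = 8 * (p * k + (3 * k + 1))"
      by (simp add: k power2_eq_square algebra_simps)
    have "p ^ (2 * Suc n) = (8 * N + 1) * (8 * (p * k + (3 * k + 1)) + 1)"
      using N' sq k by (simp add: power_add power2_eq_square algebra_simps)
    then have e: "p ^ (2 * Suc n) - 1 = 8 * (p * (p * N + k) + (3 * k + 1))"
      using sq k by (simp add: algebra_simps power2_eq_square)
    then have d: "(p ^ (2 * Suc n) - 1) div 8 = p * (p * N + k) + (3 * k + 1)" by simp
    have f: "4 * (p * (p * N + k) + (3 * k + 1)) = p * (p * (4 * N) + (4 * k + 1)) + (4 * k + 1)"
      by (simp add: k algebra_simps)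
    have le: "p * N + k \<le> p * (4 * N) + (4 * k + 1)"
      by (intro add_mono mult_le_mono) auto
    have "\<not> p dvd (4 * N choose N)" using Suc N by simp
    then have "\<not> p dvd ((p * (4 * N) + (4 * k + 1)) choose (p * N + k))"
      using assms(1) k by (intro prime_not_dvd_binomial_step[of p]) auto
    then have "\<not> p dvd ((p * (p * (4 * N) + (4 * k + 1)) + (4 * k + 1)) choose (p * (p * N + k) + (3 * k + 1)))"
      by (intro prime_not_dvd_binomial_step[OF assms(1) _ _ le]) (use k in auto)
    then show ?case using d e f by (metis dvd_triv_left)
  qed
  then show ?thesis using assms(3) by (metis evenE)
qed

section \<open>The form $A^2 + 2 B^2$ and powers of 2\<close>

text \<open>A replacement for unique factorization: \<open>p ^ n\<close> divides the product of
  \<open>A * B' - A' * B\<close> and \<open>A * B' + A' * B\<close>, and \<open>p\<close> cannot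
  divide both, so \<open>p ^ n\<close> divides one of them, which is then too small to be
  nonzero.\<close>

lemma norm_form_unique:
  fixes A B A' B' :: int and p n :: nat
  assumes p: "prime p" "odd p"
    and 1: "A\<^sup>2 + 2 * B\<^sup>2 = int p ^ n" "A'\<^sup>2 + 2 * B'\<^sup>2 = int p ^ n"
    and nd: "\<not> int p dvd A" "\<not> int p dvd A'"
  shows "A\<^sup>2 = A'\<^sup>2 \<and> B\<^sup>2 = B'\<^sup>2"
proof (cases "n = 0")
  case True
  have "\<bar>x\<bar> = 1" if "x\<^sup>2 + 2 * y\<^sup>2 = 1" for x y :: int
  proof -
    have "y\<^sup>2 \<ge> 0" "x\<^sup>2 \<ge> 0" by auto
    then have "\<not> y\<^sup>2 \<ge> 1" using that by linarith
    then have "y\<^sup>2 = 0" using \<open>y\<^sup>2 \<ge> 0\<close> by linarith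
    then have "x\<^sup>2 = 1" using that by simp
    then show ?thesis by (simp add: abs_square_eq_1)
  qed
  then have "A\<^sup>2 = 1" "A'\<^sup>2 = 1" using 1 True by (metis abs_power2 power2_abs power_one power_0)+
  then show ?thesis using 1 True by auto
next
  case False
  have pp: "prime (int p)" using p by simp
  have p1: "int p > 1" using p(1) prime_gt_1_nat by auto
  have pd: "int p dvd int p ^ n" using False by simp
  have ndB: "\<not> int p dvd B" "\<not> int p dvd B'"
    using 1 nd pd pp by (metis dvd_add_left_iff dvd_mult dvd_mult2 power2_eq_square prime_dvd_mult_iff)+
  have id: "(A * B' - A' * B) * (A * B' + A' * B) = int p ^ n * (B'\<^sup>2 - B\<^sup>2)"
  proof -
    have "(A * B' - A' * B) * (A * B' + A' * B) = A\<^sup>2 * B'\<^sup>2 - A'\<^sup>2 * B\<^sup>2"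
      by (simp add: power2_eq_square algebra_simps)
    also have "\<dots> = (A\<^sup>2 + 2 * B\<^sup>2) * B'\<^sup>2 - (A'\<^sup>2 + 2 * B'\<^sup>2) * B\<^sup>2"
      by (simp add: algebra_simps)
    finally show ?thesis by (simp add: 1 algebra_simps)
  qed
  \<comment> \<open>Multiplicativity of the norm bounds twice the square of this difference by the
    square of \<open>p ^ n\<close>. The second variables are kept general so that \<open>- B\<close>
    can be inserted for the other sign.\<close>
  have main: "A * C' - A' * C = 0"
    if dv: "int p ^ n dvd A * C' - A' * C" and 2: "A\<^sup>2 + 2 * C\<^sup>2 = int p ^ n" "A'\<^sup>2 + 2 * C'\<^sup>2 = int p ^ n"
    for C C' :: int
  proof -
    obtain k where k: "A * C' - A' * C = int p ^ n * k" using dv by blast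
    have "(A * A' + 2 * C * C')\<^sup>2 + 2 * (A * C' - A' * C)\<^sup>2 = (A\<^sup>2 + 2 * C\<^sup>2) * (A'\<^sup>2 + 2 * C'\<^sup>2)"
      by (simp add: power2_eq_square algebra_simps)
    then have "2 * (A * C' - A' * C)\<^sup>2 \<le> (int p ^ n)\<^sup>2"
      using 2 by (simp add: power2_eq_square) (metis add.commute le_add_same_cancel1 zero_le_square)
    then have "(int p ^ n)\<^sup>2 * (2 * k\<^sup>2) \<le> (int p ^ n)\<^sup>2 * 1"
      using k by (simp add: power_mult_distrib algebra_simps)
    then have "2 * k\<^sup>2 \<le> 1" using p1 by (subst (asm) mult_le_cancel_left_pos) auto
    moreover have "k\<^sup>2 \<ge> 1" if "k \<noteq> 0" using that by (simp add: int_one_le_iff_zero_less)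
    ultimately have "k = 0" by fastforce
    then show ?thesis using k by simp
  qed
  have AB: "A * B' - A' * B = 0 \<or> A * B' + A' * B = 0"
  proof (cases "int p dvd A * B' - A' * B")
    case True
    have "\<not> int p dvd A * B' + A' * B"
    proof
      assume "int p dvd A * B' + A' * B"
      then have "int p dvd (A * B' + A' * B) + (A * B' - A' * B)" using True dvd_add by blast
      then have "int p dvd 2 * (A * B')" by (simp add: algebra_simps)
      then have "int p dvd 2" using pp nd ndB by (metis prime_dvd_mult_iff)
      then have "p dvd 2" by (metis int_dvd_int_iff of_nat_numeral)
      then have "p = 2" using p(1) primes_dvd_imp_eq two_is_prime_nat by blast
      then show False using p(2) by simp
    qed
    then have "coprime (int p ^ n) (A * B' + A' * B)"
      using pp by (simp add: prime_imp_coprime)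
    then have "int p ^ n dvd A * B' - A' * B"
      using id by (metis coprime_dvd_mult_left_iff dvd_triv_left)
    then show ?thesis using main 1 by blast
  next
    case False
    then have "coprime (int p ^ n) (A * B' - A' * B)"
      using pp by (simp add: prime_imp_coprime)
    then have "int p ^ n dvd A * B' + A' * B"
      using id by (metis coprime_dvd_mult_right_iff dvd_triv_left)
    then have "int p ^ n dvd A * B' - A' * (- B)" by simp
    then show ?thesis using main[of B' "- B"] 1 by simp
  qed
  then have "(A * B')\<^sup>2 = (A' * B)\<^sup>2"
    by (metis add_eq_0_iff eq_iff_diff_eq_0 power2_minus)
  then have "A\<^sup>2 * (2 * B'\<^sup>2) = A'\<^sup>2 * (2 * B\<^sup>2)" by (simp add: power_mult_distrib)
  moreover have "2 * B'\<^sup>2 = int p ^ n - A'\<^sup>2" "2 * B\<^sup>2 = int p ^ n - A\<^sup>2" using 1 by auto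
  ultimately have "A\<^sup>2 * (int p ^ n - A'\<^sup>2) = A'\<^sup>2 * (int p ^ n - A\<^sup>2)" by simp
  then have "int p ^ n * A\<^sup>2 = int p ^ n * A'\<^sup>2" by (simp add: algebra_simps)
  then have "A\<^sup>2 = A'\<^sup>2" using p1 by simp
  then show ?thesis using 1 by auto
qed

text \<open>The numbers \<open>(P - A) / 2\<close> and \<open>(P + A) / 2\<close> are coprime and
  twice their product is the square of \<open>B\<close>. Hence the even one is twice a square and
  the other one a square, and their sum is \<open>P\<close>.\<close>

lemma norm_form_descent:
  fixes A B :: int and P :: nat
  assumes 1: "A\<^sup>2 + 2 * B\<^sup>2 = int P ^ 2" and "coprime A (int P)" "odd P"
  shows "\<exists>c d. int P = c\<^sup>2 + 2 * d\<^sup>2 \<and> coprime c (int P)"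
proof -
  have "odd A" using 1 assms(3) by (metis dvd_add_left_iff dvd_triv_left even_of_nat even_power
        zero_less_numeral)
  have AP: "\<bar>A\<bar> \<le> int P"
  proof -
    have "A\<^sup>2 \<le> (int P)\<^sup>2" using 1 zero_le_power2[of B] by linarith
    then show ?thesis by (metis abs_le_square_iff abs_of_nat)
  qed
  define a where "a = nat ((int P - A) div 2)"
  define b where "b = nat ((int P + A) div 2)"
  have a: "2 * int a = int P - A" and b: "2 * int b = int P + A"
    using AP \<open>odd A\<close> assms(3) unfolding a_def b_def by auto
  have P: "int P = int a + int b" and A: "A = int b - int a" using a b by auto
  have cop: "coprime a b"
  proof (rule coprimeI)
    fix x assume "x dvd a" "x dvd b"
    then have "int x dvd int P" "int x dvd A" unfolding P A by (auto intro: dvd_diff)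
    then have "is_unit (int x)" using assms(2) by (meson coprime_common_divisor)
    then show "is_unit x" by simp
  qed
  have "B\<^sup>2 = 2 * int a * int b"
    using 1 unfolding P A by (simp add: power2_eq_square algebra_simps)
  then have B: "(nat \<bar>B\<bar>)\<^sup>2 = 2 * a * b"
    by (metis nat_abs_mult_distrib nat_int of_nat_mult of_nat_numeral power2_abs power2_eq_square abs_ge_zero nat_power_eq)
  have key: "\<exists>c d. x = 2 * d\<^sup>2 \<and> y = c\<^sup>2" if x: "even x" and c: "coprime x y" and xy: "is_nth_power 2 (2 * x * y)" for x y :: nat
  proof -
    obtain x' where x': "x = 2 * x'" using x by blast
    have "odd y" using x c by (metis coprime_common_divisor odd_one)
    have c': "coprime (2 * x) y" using c \<open>odd y\<close> by simp
    have "is_nth_power 2 (2 * x)" "is_nth_power 2 y"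
      using xy is_nth_power_mult_coprime_nat_iff[OF c'] by auto
    then obtain e c where e: "2 * x = e\<^sup>2" "y = c\<^sup>2" by (auto elim!: is_nth_powerE)
    have "even e" using e(1) by (metis dvd_triv_left even_power)
    then obtain d where "e = 2 * d" by blast
    then have "x = 2 * d\<^sup>2" using e by (simp add: power2_eq_square)
    then show ?thesis using e by blast
  qed
  have sq: "is_nth_power 2 (2 * a * b)" using B by (metis is_nth_power_nth_power)
  have "even a \<or> even b"
  proof (rule ccontr)
    assume "\<not> ?thesis"
    then have "even P" using P by presburger
    then show False using assms by blast
  qed
  then have "\<exists>c d. a + b = c\<^sup>2 + 2 * d\<^sup>2 \<and> coprime (c\<^sup>2) (2 * d\<^sup>2)"
  proof
    assume "even a" then show ?thesis using key[of a b] cop sq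
      by (metis add.commute coprime_commute)
  next
    assume "even b" then show ?thesis using key[of b a] cop sq
      by (metis coprime_commute mult.assoc mult.commute)
  qed
  then obtain c d where cd: "a + b = c\<^sup>2 + 2 * d\<^sup>2" "coprime (c\<^sup>2) (2 * d\<^sup>2)" by blast
  have Pcd: "P = c\<^sup>2 + 2 * d\<^sup>2" using P cd by linarith
  have "coprime (c\<^sup>2) P" unfolding Pcd using cd(2)
    by (metis coprime_iff_gcd_eq_1 gcd_add2)
  then have "coprime c P" by (simp add: power2_eq_square)
  moreover have "int P = (int c)\<^sup>2 + 2 * (int d)\<^sup>2" using Pcd by simp
  ultimately show ?thesis by (metis coprime_int_iff)
qed

section \<open>Powers of \<open>p\<close> modulo powers of 2\<close>

lemma cong_power_two_power:
  fixes p :: nat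
  assumes "p mod 8 = 3" "k \<ge> 1"
  shows "[p ^ (2 ^ k) = 1 + 2 ^ (k + 2)] (mod 2 ^ (k + 3))"
  using assms(2)
proof (induction k rule: dec_induct)
  case base
  obtain a where a: "p = 8 * a + 3" using assms(1) by (metis mult_div_mod_eq)
  have "p ^ 2 = 9 + 16 * (4 * a\<^sup>2 + 3 * a)" by (simp add: a power2_eq_square algebra_simps)
  then have "p ^ 2 mod 16 = 9 mod 16" using mod_mult_self2[of 9 16 "4 * a\<^sup>2 + 3 * a"] by (simp only:)
  then have "[p ^ 2 = 9] (mod 16)" unfolding cong_def .
  then show ?case by (simp add: eval_nat_numeral)
next
  case (step k)
  define N where "N = p ^ (2 ^ k)"
  have "[int N = 1 + 2 ^ (k + 2)] (mod 2 ^ (k + 3))"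
  proof -
    have "[int N = int (1 + 2 ^ (k + 2))] (mod int (2 ^ (k + 3)))"
      using step.IH cong_int_iff unfolding N_def by blast
    then show ?thesis by simp
  qed
  from cong_sym[OF this] obtain c where "int N = 1 + 2 ^ (k + 2) + 2 ^ (k + 3) * c"
    unfolding cong_iff_lin by blast
  then have c: "int N = 1 + 2 ^ (k + 2) * (1 + 2 * c)" by (simp add: power_add algebra_simps)
  define d where "d = 1 + 2 * c"
  \<comment> \<open>Squaring gives the middle term one more factor 2, with \<open>d\<close> odd, and
    the last term vanishes modulo \<open>2 ^ (k + 4)\<close>.\<close>
  have "int N ^ 2 = 1 + 2 ^ (k + 3) * d + 2 ^ (2 * k + 4) * d ^ 2"
    unfolding c d_def by (simp add: power2_eq_square power_add power_mult mult.commute[of 2 k] algebra_simps)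
  also have "\<dots> = (1 + 2 ^ (Suc k + 2)) + 2 ^ (Suc k + 3) * (c + 2 ^ k * d ^ 2)"
    unfolding d_def by (simp add: power2_eq_square power_add power_mult mult.commute[of 2 k] algebra_simps)
  finally have "[int N ^ 2 = 1 + 2 ^ (Suc k + 2)] (mod 2 ^ (Suc k + 3))"
    using cong_iff_lin cong_sym by blast
  then have "[int (N ^ 2) = int (1 + 2 ^ (Suc k + 2))] (mod int (2 ^ (Suc k + 3)))" by simp
  then have "[N ^ 2 = 1 + 2 ^ (Suc k + 2)] (mod 2 ^ (Suc k + 3))"
    using cong_int_iff by blast
  then show ?case unfolding N_def by (simp add: power_mult[symmetric] mult.commute)
qed

lemma cong_one_power_two_power:
  fixes p :: nat
  assumes "p mod 8 = 3" "k \<ge> 1"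
  shows "[p ^ (2 ^ k) = 1] (mod 2 ^ (k + 2))"
proof -
  have "[p ^ (2 ^ k) = 1 + 2 ^ (k + 2)] (mod 2 ^ (k + 2))"
    by (rule cong_dvd_modulus_nat[OF cong_power_two_power[OF assms]]) (rule le_imp_power_dvd, simp)
  then show ?thesis unfolding cong_def by (metis mod_add_self2)
qed

text \<open>The source of the shift by 2 between the conditions on \<open>q - 1\<close> and those on
  \<open>s\<close>. For the converse, the exact congruence at the 2-adic valuation of
  \<open>s\<close> excludes any higher power of 2.\<close>

lemma two_power_dvd_iff:
  fixes p s :: nat
  assumes "p mod 8 = 3" "k \<ge> 1"
  shows "2 ^ (k + 2) dvd p ^ s - 1 \<longleftrightarrow> 2 ^ k dvd s"
proof -
  have p0: "p > 0" using assms by (cases p) auto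
  then have ps: "p ^ s \<ge> 1" by simp
  have iff: "d dvd p ^ s - 1 \<longleftrightarrow> [p ^ s = 1] (mod d)" for d
    using ps cong_altdef_nat by blast
  show ?thesis
  proof
    assume "2 ^ k dvd s"
    then obtain b where "s = 2 ^ k * b" by blast
    then have "p ^ s = (p ^ (2 ^ k)) ^ b" by (simp add: power_mult)
    then have "[p ^ s = 1 ^ b] (mod 2 ^ (k + 2))"
      using cong_one_power_two_power[OF assms] cong_pow by metis
    then show "2 ^ (k + 2) dvd p ^ s - 1" using iff by simp
  next
    assume L: "2 ^ (k + 2) dvd p ^ s - 1"
    show "2 ^ k dvd s"
    proof (rule ccontr)
      assume nd: "\<not> 2 ^ k dvd s"
      then have "s \<noteq> 0" by (metis dvd_0_right)
      then obtain a b where ab: "s = 2 ^ a * b" "odd b"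
        by (rule multiplicity_decompose'[of s "2::nat"]) (use \<open>s \<noteq> 0\<close> in auto)
      have ak: "a < k" using nd ab by (metis dvd_mult2 le_imp_power_dvd not_le)
      obtain c where c: "b = 2 * c + 1" using ab oddE by blast
      show False
      \<comment> \<open>The exact congruence for \<open>p ^ (2 ^ a)\<close> starts at
        \<open>a = 1\<close>; for odd \<open>s\<close> the power \<open>p ^ s\<close> is 3 modulo
        8.\<close>
      proof (cases "a = 0")
        case True
        have "[p ^ 2 = 1] (mod 8)" using cong_one_power_two_power[of p 1] assms by simp
        then have "[(p ^ 2) ^ c * p = 1 ^ c * 3] (mod 8)"
          using assms by (intro cong_mult cong_pow) (simp_all add: cong_def)
        then have "[p ^ s = 3] (mod 8)" using True ab c by (simp add: power_add power_mult[symmetric] mult.commute)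
        moreover have "(2::nat) ^ 3 dvd 2 ^ (k + 2)" using assms by (intro le_imp_power_dvd) simp
        then have "[p ^ s = 1] (mod 8)" using L iff[of 8] dvd_trans by fastforce
        ultimately show False by (simp add: cong_def)
      next
        case False
        define N where "N = p ^ (2 ^ a)"
        have 1: "[N = 1 + 2 ^ (a + 2)] (mod 2 ^ (a + 3))"
          using cong_power_two_power[of p a] False assms N_def by simp
        have 2: "[N ^ 2 = 1] (mod 2 ^ (a + 3))"
          using cong_one_power_two_power[of p "Suc a"] assms N_def
          by (simp add: power_mult[symmetric] mult.commute power_add)
        have "[(N ^ 2) ^ c * N = 1 ^ c * (1 + 2 ^ (a + 2))] (mod 2 ^ (a + 3))"
          using 1 2 by (intro cong_mult cong_pow)
        then have "[p ^ s = 1 + 2 ^ (a + 2)] (mod 2 ^ (a + 3))"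
          using ab c N_def by (simp add: power_add power_mult[symmetric] mult_ac)
        moreover have "(2::nat) ^ (a + 3) dvd 2 ^ (k + 2)" using ak by (intro le_imp_power_dvd) simp
        then have "[p ^ s = 1] (mod 2 ^ (a + 3))" using L iff dvd_trans by blast
        ultimately have "[1 + 2 ^ (a + 2) = (1::nat)] (mod 2 ^ (a + 3))"
          using cong_sym cong_trans by blast
        then have "(2::nat) ^ (a + 3) dvd 2 ^ (a + 2)" using cong_altdef_nat by fastforce
        then have "a + 3 \<le> a + 2" by (rule power_dvd_imp_le) simp
        then show False by simp
      qed
    qed
  qed
qed

text \<open>Lifting from \<open>2 ^ r\<close> to \<open>2 ^ Suc r\<close>: if the exponent
  \<open>a\<close> fails at the next level, it is off by an odd multiple of \<open>2 ^ r\<close>,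
  and the extra factor \<open>p ^ (2 ^ (r - 2))\<close>, congruent to \<open>1 + 2 ^ r\<close>,
  repairs this.\<close>

lemma power_cong_surj:
  fixes p :: nat and j :: nat
  assumes "p mod 8 = 3" "r \<ge> 3" "j mod 8 = 1 \<or> j mod 8 = 3"
  shows "\<exists>a. [p ^ a = j] (mod 2 ^ r)"
  using assms(2)
proof (induction r rule: dec_induct)
  case base
  show ?case using assms by (auto simp: cong_def intro: exI[of _ 0] exI[of _ 1])
next
  case (step r)
  then obtain a where a: "[p ^ a = j] (mod 2 ^ r)" by blast
  show ?case
  proof (cases "[p ^ a = j] (mod 2 ^ Suc r)")
    case True then show ?thesis by blast
  next
    case False
    have "[int (p ^ a) = int j] (mod int (2 ^ r))" using a cong_int_iff by blast
    then obtain c where c: "int j = int (p ^ a) + 2 ^ r * c" by (auto simp: cong_iff_lin)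
    have "odd c"
    proof
      assume "even c"
      then obtain d where "c = 2 * d" by blast
      then have "int j = int (p ^ a) + 2 ^ Suc r * d" using c by simp
      then have "[int (p ^ a) = int j] (mod int (2 ^ Suc r))" by (auto simp: cong_iff_lin)
      then show False using False cong_int_iff by blast
    qed
    have "odd p" using assms(1) by presburger

    have "[p ^ (2 ^ (r - 2)) = 1 + 2 ^ r] (mod 2 ^ Suc r)"
    proof -
      have "r - 2 + 2 = r" "r - 2 + 3 = Suc r" "r - 2 \<ge> 1" using step by auto
      then show ?thesis using cong_power_two_power[of p "r - 2"] assms by metis
    qed
    then have "[p ^ a * p ^ (2 ^ (r - 2)) = p ^ a * (1 + 2 ^ r)] (mod 2 ^ Suc r)"
      by (rule cong_scalar_left)
    moreover have "[p ^ a * (1 + 2 ^ r) = j] (mod 2 ^ Suc r)"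
    proof -
      have "even (c - int (p ^ a))" using \<open>odd c\<close> \<open>odd p\<close> by simp
      then obtain e where "c = int (p ^ a) + 2 * e" by (metis add.commute diff_eq_eq dvdE)
      then have "int j = int (p ^ a * (1 + 2 ^ r)) + int (2 ^ Suc r) * e"
        using c by (simp add: algebra_simps)
      then have "[int (p ^ a * (1 + 2 ^ r)) = int j] (mod int (2 ^ Suc r))"
        by (auto simp: cong_iff_lin)
      then show ?thesis using cong_int_iff by blast
    qed
    ultimately show ?thesis by (metis cong_trans power_add)
  qed
qed

text \<open>The conditions of \<open>quad_rep\<close> that do not mention the generator of the
  field. They determine \<open>A\<close>, and \<open>B\<close> up to sign.\<close>

definition is_rep :: "nat \<Rightarrow> nat \<Rightarrow> int \<Rightarrow> int \<Rightarrow> bool" where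
  "is_rep p n A B \<longleftrightarrow> int p ^ n = A\<^sup>2 + 2 * B\<^sup>2 \<and> [A = -1] (mod 4) \<and> \<not> int p dvd A"

lemma is_rep_unique:
  assumes "prime p" "odd p" "is_rep p n A B" "is_rep p n A' B'"
  shows "A = A' \<and> (B' = B \<or> B' = - B)"
proof -
  have "A\<^sup>2 = A'\<^sup>2 \<and> B\<^sup>2 = B'\<^sup>2"
    using norm_form_unique[OF assms(1,2)] assms(3,4) unfolding is_rep_def by metis
  then have 1: "A = A' \<or> A = - A'" "B' = B \<or> B' = - B" by (auto simp: power2_eq_iff)
  have "[A = -1] (mod 4)" "[A' = -1] (mod 4)" using assms unfolding is_rep_def by auto
  then have "A \<noteq> - A'" by (auto simp: cong_def) presburger
  then show ?thesis using 1 by blast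
qed

lemma is_rep_minus: "is_rep p n A (- B) = is_rep p n A B"
  by (simp add: is_rep_def)

lemma is_rep_exists:
  fixes p n :: nat and u v :: int
  assumes "prime p" "odd p" "u\<^sup>2 + 2 * v\<^sup>2 = int p ^ n" "\<not> int p dvd u"
  shows "\<exists>A B. is_rep p n A B \<and> (u = A \<or> u = - A)"
proof -
  have "odd (int p ^ n)" using assms by simp
  then have "odd u" using assms(3) by (metis dvd_add_left_iff dvd_triv_left even_power zero_less_numeral)
  then have "[u = -1] (mod 4) \<or> [- u = -1] (mod 4)" by (auto simp: cong_def) presburger
  then show ?thesis
  proof
    assume "[u = -1] (mod 4)"
    then show ?thesis using assms unfolding is_rep_def by metis
  next
    assume "[- u = -1] (mod 4)"
    then have "is_rep p n (- u) v" using assms unfolding is_rep_def by simp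
    then show ?thesis by (metis minus_minus)
  qed
qed

text \<open>The descent with \<open>P = p ^ n\<close>. It produces the representations for all
  levels from the one that the Jacobi sum provides.\<close>

lemma is_rep_halve:
  assumes "prime p" "odd p" "is_rep p (2 * n) A B" "n > 0"
  shows "\<exists>A B. is_rep p n A B"
proof -
  have pp: "prime (int p)" using assms by simp
  have "coprime (int p) A" using assms(3) pp unfolding is_rep_def by (simp add: prime_imp_coprime)
  then have c: "coprime A (int (p ^ n))" by (simp add: coprime_commute)
  have "A\<^sup>2 + 2 * B\<^sup>2 = int (p ^ n) ^ 2"
    using assms(3) unfolding is_rep_def by (simp add: power_mult[symmetric] mult.commute)
  moreover have "odd (p ^ n)" using assms(2) by simp
  ultimately obtain e where e: "\<exists>d. int (p ^ n) = e\<^sup>2 + 2 * d\<^sup>2 \<and> coprime e (int (p ^ n))"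
    using norm_form_descent[OF _ c] by blast
  then obtain c d
    where cd: "int p ^ n = c\<^sup>2 + 2 * d\<^sup>2" "coprime c (int p ^ n)"
    unfolding of_nat_power by blast
  have "coprime c (int p)"
    using cd(2) assms(4) by (simp only: coprime_power_right_iff) simp
  then have "\<not> int p dvd c"
  proof -
    assume "coprime c (int p)"
    then have "int p dvd c \<Longrightarrow> is_unit (int p)" by (rule coprime_common_divisor) simp_all
    then show ?thesis using pp not_prime_unit by blast
  qed
  then show ?thesis using is_rep_exists[OF assms(1,2) cd(1)[symmetric]] by blast
qed

lemma not_prime_dvd_two_int:
  assumes "prime p" "odd p"
  shows "\<not> int p dvd 2"
proof
  assume "int p dvd 2"
  then have "p dvd 2" by (metis int_dvd_int_iff of_nat_numeral)
  then show False using assms primes_dvd_imp_eq two_is_prime_nat by blast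
qed

text \<open>The square of \<open>A + B * sqrt (-2)\<close> has real part
  \<open>2 * A^2 - p ^ n\<close>, and by uniqueness \<open>A'\<close> agrees with it up to sign. As
  \<open>A\<close> is odd, that real part is \<open>2 - (-1) ^ n\<close> modulo 4, so the
  normalization of \<open>A'\<close> makes the sign depend on the parity of
  \<open>n\<close>.\<close>

lemma is_rep_double:
  assumes p: "prime p" "p mod 8 = 3" and n: "n > 0"
    and 1: "is_rep p n A B" and 2: "is_rep p (2 * n) A' B'"
  shows "A' = (if even n then int p ^ n - 2 * A\<^sup>2 else 2 * A\<^sup>2 - int p ^ n)"
proof -
  have "odd p" using p by presburger
  define u where "u = 2 * A\<^sup>2 - int p ^ n"
  have A: "int p ^ n = A\<^sup>2 + 2 * B\<^sup>2" "[A = -1] (mod 4)" "\<not> int p dvd A"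
    using 1 unfolding is_rep_def by auto
  have A': "A'\<^sup>2 + 2 * B'\<^sup>2 = int p ^ (2 * n)" "[A' = -1] (mod 4)" "\<not> int p dvd A'"
    using 2 unfolding is_rep_def by auto
  have "u\<^sup>2 + 2 * (2 * A * B)\<^sup>2 = (int p ^ n)\<^sup>2"
    unfolding u_def A(1) by (simp add: power2_eq_square algebra_simps)
  then have u1: "u\<^sup>2 + 2 * (2 * A * B)\<^sup>2 = int p ^ (2 * n)"
    by (simp add: power_mult[symmetric] mult.commute)
  have "\<not> int p dvd u"
  proof
    assume "int p dvd u"
    moreover have "int p dvd int p ^ n" using n by simp
    ultimately have "int p dvd u + int p ^ n" by (rule dvd_add)
    then have "int p dvd 2 * A\<^sup>2" unfolding u_def by simp
    moreover have "prime (int p)" using p by simp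
    ultimately show False using A(3) not_prime_dvd_two_int[OF p(1) \<open>odd p\<close>]
      by (metis prime_dvd_mult_iff power2_eq_square)
  qed
  then have "A'\<^sup>2 = u\<^sup>2" using norm_form_unique[OF p(1) \<open>odd p\<close> A'(1) u1 A'(3)] by blast
  then have or: "A' = u \<or> A' = - u" by (simp add: power2_eq_iff)
  have "odd A" using A(2) unfolding cong_def by presburger
  then obtain a where a: "A = 2 * a + 1" by (rule oddE)
  have u4: "u = 4 * (2 * a\<^sup>2 + 2 * a) + 2 - int p ^ n"
    unfolding u_def a by (simp add: power2_eq_square algebra_simps)
  have p4: "[int p = -1] (mod 4)" using p(2) by (simp add: cong_def) presburger
  then have pn: "[int p ^ n = (-1) ^ n] (mod 4)" by (rule cong_pow)
  have u5: "[u = 2 - (-1) ^ n] (mod 4)"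
  proof -
    have "[4 * (2 * a\<^sup>2 + 2 * a) + 2 - int p ^ n = 0 + 2 - (-1) ^ n] (mod 4)"
      by (intro cong_diff cong_add pn) (simp_all add: cong_def)
    then show ?thesis unfolding u4 by simp
  qed
  show ?thesis
  proof (cases "even n")
    case True
    then have "[u = 1] (mod 4)" using u5 by simp
    then have "A' \<noteq> u" using A'(2) by (auto simp: cong_def)
    then show ?thesis using or True u_def by simp
  next
    case False
    then have "[u = 3] (mod 4)" using u5 by simp
    then have "A' \<noteq> - u" using A'(2) unfolding cong_def by presburger
    then show ?thesis using or False u_def by simp
  qed
qed

section \<open>Characters of the finite field\<close>

text \<open>The condition \<open>16 dvd p ^ s - 1\<close> is what \<open>m \<ge> 4\<close>
  guarantees. It gives \<open>4 dvd s\<close>, so that the square root of \<open>q\<close> is an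
  integer congruent to 1 modulo 4, and it makes characters of order 8 take the value 1 at
  -1.\<close>

locale cyclotomic_field =
  fixes \<gamma> :: "'a::finite_field" and p s :: nat
  assumes prime_p: "prime p" and p_mod: "p mod 8 = 3"
    and card_field: "CARD('a) = p ^ s"
    and generator: "generates_units \<gamma>"
    and dvd16: "16 dvd p ^ s - 1"
begin

definition Q :: nat where "Q = p ^ s"

lemma odd_p: "odd p" using p_mod by presburger

lemma p_ge3: "p \<ge> 3" using p_mod by presburger

lemma s_pos: "s > 0"
proof (rule ccontr)
  assume "\<not> ?thesis"
  then have "CARD('a) = 1" using card_field by simp
  moreover have "card {0, 1::'a} \<le> CARD('a)" by (rule card_mono) auto
  ultimately show False by simp
qed

lemma four_dvd_s: "4 dvd s"
  using two_power_dvd_iff[OF p_mod, of 2 s] dvd16 by simp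

lemma Q_ge: "Q \<ge> 81"
proof -
  have "3 ^ 4 \<le> p ^ 4" using p_ge3 by (rule power_mono) simp
  also have "p ^ 4 \<le> p ^ s"
    using p_ge3 four_dvd_s s_pos by (intro power_increasing) (auto dest: dvd_imp_le)
  finally show ?thesis unfolding Q_def by simp
qed

definition L :: nat where "L = p ^ s - 1"

lemma Q_L: "Q = Suc L" using p_ge3 by (simp add: Q_def L_def)

lemma L_ge: "L \<ge> 80" using Q_ge Q_L by simp

lemma sixteen_dvd_L: "16 dvd L" using dvd16 L_def by simp

lemma power_Q: "x ^ Q = x" for x :: 'a
  using finite_field_power_card_eq_same[of x] card_field Q_def by simp

lemma frob_inverse: "(x ^ (p ^ (s - 1))) ^ p = x" "(x ^ p) ^ (p ^ (s - 1)) = x" for x :: 'a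
proof -
  have "p ^ (s - 1) * p = Q" "p * p ^ (s - 1) = Q"
    using s_pos by (simp_all add: Q_def power_eq_if)
  then show "(x ^ (p ^ (s - 1))) ^ p = x" "(x ^ p) ^ (p ^ (s - 1)) = x"
    by (simp_all add: power_mult[symmetric] power_Q)
qed

lemma frob_surj: "\<exists>y. x = y ^ p" for x :: 'a
  using frob_inverse(1)[of x] by metis

lemma gamma_nz: "\<gamma> \<noteq> 0"
proof
  assume "\<gamma> = 0"
  moreover have "\<gamma> ^ 1 \<in> UNIV - {0}" using generator unfolding generates_units_def by blast
  ultimately show False by simp
qed

lemma unit_power_Q: "x \<noteq> 0 \<Longrightarrow> x ^ L = 1" for x :: 'a
  using power_Q[of x] by (simp add: Q_L)

lemma gamma_power_mod: "\<gamma> ^ (k mod L) = \<gamma> ^ k"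
proof -
  have "\<gamma> ^ k = \<gamma> ^ (L * (k div L) + k mod L)" by simp
  also have "\<dots> = \<gamma> ^ (k mod L)"
    unfolding power_add power_mult by (simp add: unit_power_Q gamma_nz)
  finally show ?thesis by simp
qed

lemma gamma_image: "(\<lambda>k. \<gamma> ^ k) ` {..<L} = UNIV - {0}"
proof -
  have "range (\<lambda>k. \<gamma> ^ k) = (\<lambda>k. \<gamma> ^ k) ` {..<L}"
  proof (intro equalityI subsetI)
    fix x assume "x \<in> range (\<lambda>k. \<gamma> ^ k)"
    then obtain k where "x = \<gamma> ^ (k mod L)" using gamma_power_mod by auto
    moreover have "k mod L < L" using L_ge by simp
    ultimately show "x \<in> (\<lambda>k. \<gamma> ^ k) ` {..<L}" by blast
  qed auto
  then show ?thesis using generator unfolding generates_units_def by simp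
qed

lemma gamma_bij: "bij_betw (\<lambda>k. \<gamma> ^ k) {..<L} (UNIV - {0})"
proof -
  have "card (UNIV - {0::'a}) = L" using card_field L_def by (simp add: card_Diff_singleton)
  then have "inj_on (\<lambda>k. \<gamma> ^ k) {..<L}"
    by (intro eq_card_imp_inj_on) (simp_all only: gamma_image, simp_all)
  then show ?thesis using gamma_image by (simp add: bij_betw_def)
qed

lemma sum_units: "(\<Sum>x\<in>UNIV - {0}. f x) = (\<Sum>k<L. f (\<gamma> ^ k))"
  by (rule sum.reindex_bij_betw[OF gamma_bij, symmetric])

definition dlog :: "'a \<Rightarrow> nat" where
  "dlog = inv_into {..<L} (\<lambda>k. \<gamma> ^ k)"

lemma gamma_dlog: "x \<noteq> 0 \<Longrightarrow> \<gamma> ^ dlog x = x"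
  unfolding dlog_def by (rule f_inv_into_f) (use gamma_image in auto)

lemma gamma_eq_iff: "\<gamma> ^ j = \<gamma> ^ k \<longleftrightarrow> [j = k] (mod L)"
proof
  assume "\<gamma> ^ j = \<gamma> ^ k"
  then have "\<gamma> ^ (j mod L) = \<gamma> ^ (k mod L)" by (simp add: gamma_power_mod)
  moreover have "j mod L < L" "k mod L < L" using L_ge by simp_all
  ultimately show "[j = k] (mod L)"
    using gamma_bij unfolding bij_betw_def inj_on_def cong_def by blast
next
  assume "[j = k] (mod L)"
  then show "\<gamma> ^ j = \<gamma> ^ k" using gamma_power_mod unfolding cong_def by metis
qed

text \<open>A character of the unit group is labelled by its value \<open>w\<close> at the
  generator. Products, powers and inverses of characters become those of complex numbers.\<close>

definition root :: "complex \<Rightarrow> bool" where "root w \<longleftrightarrow> w ^ L = 1"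

lemma root_nz: "root w \<Longrightarrow> w \<noteq> 0" using L_ge by (auto simp: root_def power_0_left)
lemma root_mult: "root w \<Longrightarrow> root v \<Longrightarrow> root (w * v)" by (simp add: root_def power_mult_distrib)
lemma root_power: "root w \<Longrightarrow> root (w ^ n)"
  unfolding root_def by (metis mult.commute power_mult power_one)
lemma root_inverse: "root w \<Longrightarrow> root (inverse w)" by (simp add: root_def power_inverse)
lemma root_minus1: "root (- 1)"
  using sixteen_dvd_L by (auto simp: root_def power_mult elim!: dvdE)
lemma root_norm: "root w \<Longrightarrow> norm w = 1"
proof -
  assume "root w"
  then have "norm w ^ L = 1" unfolding root_def by (metis norm_one norm_power)
  then show ?thesis using L_ge power_eq_imp_eq_base[of "norm w" L 1] by auto
qed
lemma root_cnj: "root w \<Longrightarrow> cnj w = inverse w"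
  using root_norm[of w] complex_norm_square[of w] by (simp add: inverse_unique)

lemma root_power_cong: "root w \<Longrightarrow> [j = k] (mod L) \<Longrightarrow> w ^ j = w ^ k"
proof -
  assume w: "root w" and jk: "[j = k] (mod L)"
  have "w ^ j = w ^ (j mod L)" for j
  proof -
    have "w ^ j = w ^ (L * (j div L) + j mod L)" by simp
    also have "\<dots> = w ^ (j mod L)"
      unfolding power_add power_mult using w by (simp add: root_def)
    finally show ?thesis .
  qed
  then show ?thesis using jk unfolding cong_def by metis
qed

text \<open>The trivial character \<open>chi 1\<close> vanishes at 0 as well, so its Gauss sum is -1
  and not 0.\<close>

definition chi :: "complex \<Rightarrow> 'a \<Rightarrow> complex" where
  "chi w x = (if x = 0 then 0 else w ^ dlog x)"

lemma chi_0 [simp]: "chi w 0 = 0" by (simp add: chi_def)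

lemma chi_gamma: "root w \<Longrightarrow> chi w (\<gamma> ^ k) = w ^ k"
  unfolding chi_def using gamma_nz gamma_dlog[of "\<gamma> ^ k"] gamma_eq_iff root_power_cong by auto

lemma chi_1 [simp]: "root w \<Longrightarrow> chi w 1 = 1" using chi_gamma[of w 0] by simp

lemma chi_mult: "root w \<Longrightarrow> chi w (x * y) = chi w x * chi w y"
proof (cases "x = 0 \<or> y = 0")
  case False
  assume w: "root w"
  have "chi w (x * y) = chi w (\<gamma> ^ (dlog x + dlog y))"
    using False by (simp add: power_add gamma_dlog)
  also have "\<dots> = w ^ (dlog x + dlog y)" by (rule chi_gamma[OF w])
  finally show ?thesis using False by (simp add: chi_def power_add)
qed auto

lemma chi_power: "root w \<Longrightarrow> chi w (x ^ n) = chi w x ^ n"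
  by (induction n) (auto simp: chi_mult)

lemma chi_mult_char: "chi (w * v) x = chi w x * chi v x"
  by (simp add: chi_def power_mult_distrib)

lemma chi_power_char: "n > 0 \<Longrightarrow> chi (w ^ n) x = chi w x ^ n"
  by (simp add: chi_def power_mult[symmetric] mult.commute)

lemma chi_nz: "root w \<Longrightarrow> x \<noteq> 0 \<Longrightarrow> chi w x \<noteq> 0"
  using root_nz by (simp add: chi_def)

lemma chi_inverse_char: "chi (inverse w) x = inverse (chi w x)"
  by (simp add: chi_def power_inverse)

lemma chi_cnj: "cnj (chi w x) = chi (cnj w) x"
  by (simp add: chi_def)

lemma chi_frobenius: "root w \<Longrightarrow> chi (w ^ p) x = chi w (x ^ p)"
  using p_ge3 by (simp add: chi_power chi_power_char)

lemma sum_chi: assumes "root w" "w \<noteq> 1" shows "(\<Sum>x\<in>UNIV. chi w x) = 0"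
proof -
  have "(\<Sum>x\<in>UNIV. chi w x) = (\<Sum>x\<in>UNIV - {0}. chi w x)"
    by (rule sum.mono_neutral_right) auto
  also have "\<dots> = (\<Sum>k<L. w ^ k)" using assms chi_gamma by (simp add: sum_units)
  also have "\<dots> = 0" using assms by (simp add: sum_gp_strict root_def)
  finally show ?thesis .
qed

lemma gamma_half: "\<gamma> ^ (L div 2) = - 1"
proof -
  define x where "x = \<gamma> ^ (L div 2)"
  have e: "even L" using sixteen_dvd_L by auto
  then have "x ^ 2 = 1" unfolding x_def power_mult[symmetric] using unit_power_Q[OF gamma_nz] by simp
  then have "x = 1 \<or> x = - 1" by (simp add: power2_eq_1_iff)
  moreover have "x \<noteq> 1"
  proof
    assume "x = 1"
    then have "\<gamma> ^ (L div 2) = \<gamma> ^ 0" unfolding x_def by simp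
    then have "[L div 2 = 0] (mod L)" using gamma_eq_iff by blast
    then have "L dvd L div 2" by (simp add: cong_0_iff)
    then show False using e L_ge by (auto dest: dvd_imp_le)
  qed
  ultimately show ?thesis using x_def by simp
qed

lemma chi_m1: "root w \<Longrightarrow> chi w (- 1) = w ^ (L div 2)"
  using chi_gamma gamma_half by metis

lemma char_field: "CHAR('a) = p"
proof -
  have "prime CHAR('a)" by (rule prime_CHAR_semidom) simp
  moreover have "CHAR('a) dvd p ^ s" using CHAR_dvd_CARD[where 'a='a] card_field by simp
  ultimately show ?thesis using prime_p by (metis prime_dvd_power primes_dvd_imp_eq)
qed

lemma of_nat_p: "of_nat p = (0 :: 'a)" using char_field of_nat_CHAR by metis

lemma frob_add: "(x + y) ^ (p ^ i) = x ^ (p ^ i) + y ^ (p ^ i)" for x y :: 'a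
  by (rule freshmans_dream') (simp_all add: char_field prime_p)

section \<open>The prime field, the trace and the additive character\<close>

definition FP :: "'a set" where "FP = of_nat ` {..<p}"

lemma inj_of_nat: "inj_on (of_nat :: nat \<Rightarrow> 'a) {..<p}"
  by (auto simp: inj_on_def of_nat_eq_iff_cong_CHAR char_field cong_def)

lemma card_FP: "card FP = p" unfolding FP_def by (simp add: card_image inj_of_nat)

lemma of_nat_mod: "of_nat (n mod p) = (of_nat n :: 'a)"
  by (simp add: of_nat_eq_iff_cong_CHAR char_field)

lemma of_nat_FP: "(of_nat n :: 'a) \<in> FP"
  unfolding FP_def using of_nat_mod[of n] prime_p
  by (metis imageI lessThan_iff mod_less_divisor prime_gt_0_nat)

lemma FP_E: assumes "c \<in> FP" obtains n where "c = of_nat n" using assms FP_def by auto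

text \<open>The \<open>p\<close> elements of \<open>FP\<close> are roots of \<open>X^p - X\<close>,
  which has no more than \<open>p\<close> roots.\<close>

lemma FP_iff: "c \<in> FP \<longleftrightarrow> c ^ p = c"
proof -
  have sub: "FP \<subseteq> {c. c ^ p = c}"
  proof
    fix c assume "c \<in> FP"
    then obtain n where n: "c = of_nat n" by (rule FP_E)
    have "(of_nat n :: 'a) ^ p = of_nat n"
    proof (induction n)
      case 0
      show ?case using p_ge3 by (simp add: power_0_left)
    next
      case (Suc n)
      then show ?case using frob_add[of 1 "of_nat n" 1] by simp
    qed
    then show "c \<in> {c. c ^ p = c}" using n by simp
  qed
  define P :: "'a poly" where "P = Polynomial.monom 1 p - Polynomial.monom 1 1"
  have d: "degree P = p" unfolding P_def using p_ge3
    using degree_add_eq_left[of "- Polynomial.monom (1::'a) 1" "Polynomial.monom 1 p"]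
    by (simp add: degree_monom_eq)
  then have "P \<noteq> 0" using p_ge3 by auto
  then have "card {c. poly P c = 0} \<le> p" using card_poly_roots_bound d by metis
  moreover have "{c. poly P c = 0} = {c. c ^ p = c}" unfolding P_def by (auto simp: poly_monom)
  ultimately have "FP = {c. c ^ p = c}" using sub card_FP by (intro card_seteq) auto
  then show ?thesis by auto
qed

lemma FP_add: "a \<in> FP \<Longrightarrow> b \<in> FP \<Longrightarrow> a + b \<in> FP"
  using frob_add[of a b 1] by (simp add: FP_iff)
lemma FP_mult: "a \<in> FP \<Longrightarrow> b \<in> FP \<Longrightarrow> a * b \<in> FP"
  by (simp add: FP_iff power_mult_distrib)
lemma FP_divide: "a \<in> FP \<Longrightarrow> b \<in> FP \<Longrightarrow> a / b \<in> FP"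
  by (simp add: FP_iff power_divide)
lemma FP_uminus: "a \<in> FP \<Longrightarrow> - a \<in> FP"
  using odd_p by (simp add: FP_iff)
lemma FP_0: "0 \<in> FP" and FP_1: "1 \<in> FP" using of_nat_FP[of 0] of_nat_FP[of 1] by simp_all

abbreviation tr :: "'a \<Rightarrow> 'a" where "tr \<equiv> abs_trace p s"

lemma tr_add: "tr (x + y) = tr x + tr y"
  by (simp add: abs_trace_def frob_add sum.distrib)

lemma tr_frob: "tr (x ^ p) = tr x"
proof -
  have "tr (x ^ p) = (\<Sum>i<s. x ^ (p ^ Suc i))"
    by (simp add: abs_trace_def power_mult[symmetric])
  also have "\<dots> + x ^ (p ^ 0) = (\<Sum>i<Suc s. x ^ (p ^ i))" by (subst sum.lessThan_Suc_shift) simp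
  also have "\<dots> = tr x + x" using power_Q[of x] by (simp add: abs_trace_def Q_def)
  finally show ?thesis by simp
qed

lemma tr_power: "tr x ^ p = tr (x ^ p)"
proof -
  have "(x ^ (p ^ i)) ^ p = (x ^ p) ^ (p ^ i)" for i
    by (simp only: power_mult[symmetric] mult.commute)
  moreover have "tr x ^ p = (\<Sum>i<s. (x ^ (p ^ i)) ^ p)"
    unfolding abs_trace_def by (rule freshmans_dream_sum) (simp_all add: char_field prime_p)
  ultimately show ?thesis by (simp add: abs_trace_def)
qed

lemma tr_FP: "tr x \<in> FP" by (simp add: FP_iff tr_power tr_frob)

lemma FP_power: "c \<in> FP \<Longrightarrow> c ^ (p ^ i) = c"
  by (induction i) (simp_all add: FP_iff power_mult)

lemma tr_scale: "c \<in> FP \<Longrightarrow> tr (c * x) = c * tr x"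
  by (simp add: abs_trace_def power_mult_distrib FP_power sum_distrib_left)

text \<open>The trace is a nonzero polynomial of degree at most \<open>p ^ (s - 1)\<close>, too
  small to vanish on the whole field; scaling within the prime field makes a nonzero value equal to
  1.\<close>

lemma tr_nontrivial: "\<exists>x. tr x = 1"
proof -
  have "\<exists>x. tr x \<noteq> 0"
  proof (rule ccontr)
    assume a: "\<not> ?thesis"
    define P :: "'a poly" where "P = (\<Sum>i<s. Polynomial.monom 1 (p ^ i))"
    have c: "Polynomial.coeff P (p ^ j) = 1" if "j < s" for j
    proof -
      have "Polynomial.coeff P (p ^ j) = (\<Sum>i<s. if i = j then 1 else 0)"
        unfolding P_def coeff_sum using p_ge3 by (intro sum.cong) auto
      then show ?thesis using that by simp
    qed
    then have "P \<noteq> 0" using s_pos by (metis coeff_0 zero_neq_one)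
    have "degree P \<le> p ^ (s - 1)" unfolding P_def
    proof (intro degree_sum_le)
      fix i assume "i \<in> {..<s}"
      then have "p ^ i \<le> p ^ (s - 1)" using p_ge3 by (intro power_increasing) auto
      then show "degree (Polynomial.monom (1::'a) (p ^ i)) \<le> p ^ (s - 1)"
        using degree_monom_le order_trans by blast
    qed auto
    moreover have "{x. poly P x = 0} = UNIV"
      using a unfolding P_def abs_trace_def by (simp add: poly_sum poly_monom)
    then have "CARD('a) \<le> degree P" using card_poly_roots_bound[OF \<open>P \<noteq> 0\<close>] by simp
    moreover have "p ^ (s - 1) < p ^ s" using p_ge3 s_pos by (intro power_strict_increasing) auto
    ultimately show False using card_field by simp
  qed
  then obtain x where x: "tr x \<noteq> 0" by blast
  have "tr (1 / tr x * x) = 1 / tr x * tr x" by (rule tr_scale) (intro FP_divide FP_1 tr_FP)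
  then show ?thesis using x by auto
qed

text \<open>An additive character of the prime field. Outside \<open>FP\<close> the description in
  \<open>prime_field_rep\<close> is unspecified, so its laws are stated for arguments in
  \<open>FP\<close>.\<close>

definition ep :: "'a \<Rightarrow> complex" where "ep c = zeta p ^ prime_field_rep p c"

lemma zeta_pow: "n > 0 \<Longrightarrow> zeta n ^ n = 1"
  by (simp add: zeta_def exp_of_nat_mult[symmetric])

lemma zeta_power_mod: "zeta p ^ (n mod p) = zeta p ^ n"
proof -
  have "zeta p ^ n = zeta p ^ (p * (n div p) + n mod p)" by simp
  also have "\<dots> = zeta p ^ (n mod p)"
    unfolding power_add power_mult using zeta_pow[of p] p_ge3 by simp
  finally show ?thesis by simp
qed

lemma rep_of_nat: "prime_field_rep p (of_nat n :: 'a) = n mod p"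
  unfolding prime_field_rep_def
proof (rule the_equality)
  show "n mod p < p \<and> of_nat (n mod p) = (of_nat n :: 'a)" using p_ge3 of_nat_mod by simp
next
  fix k assume "k < p \<and> of_nat k = (of_nat n :: 'a)"
  then have "k mod p = n mod p" "k < p" by (simp_all add: of_nat_eq_iff_cong_CHAR char_field cong_def)
  then show "k = n mod p" by simp
qed

lemma ep_of_nat: "ep (of_nat n) = zeta p ^ n"
  by (simp add: ep_def rep_of_nat zeta_power_mod)

lemma ep_add: "a \<in> FP \<Longrightarrow> b \<in> FP \<Longrightarrow> ep (a + b) = ep a * ep b"
  by (elim FP_E) (simp add: ep_of_nat power_add flip: of_nat_add)

lemma ep_0 [simp]: "ep 0 = 1" using ep_of_nat[of 0] by simp

lemma ep_cnj: "a \<in> FP \<Longrightarrow> cnj (ep a) = ep (- a)"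
proof -
  assume a: "a \<in> FP"
  then have 1: "ep a * ep (- a) = 1" using ep_add[of a "- a"] FP_uminus by simp
  have "norm (zeta p) = 1" unfolding zeta_def by (simp add: norm_exp_eq_Re)
  then have "norm (ep a) = 1" by (simp add: ep_def norm_power)
  then have "ep a * cnj (ep a) = 1" using complex_norm_square[of "ep a"] by simp
  then show ?thesis using 1 by (metis mult_cancel_left mult_zero_left zero_neq_one)
qed

lemma zeta_p_neq_1: "zeta p \<noteq> 1"
proof
  have "zeta p = cis (2 * pi / real p)" by (simp add: zeta_def cis_conv_exp mult_ac)
  then have "Im (zeta p) = sin (2 * pi / real p)" by simp
  moreover have "sin (2 * pi / real p) > 0"
    using p_ge3 by (intro sin_gt_zero) (simp_all add: field_simps)
  moreover assume "zeta p = 1"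
  ultimately show False by simp
qed

lemma sum_ep: assumes "y \<in> FP" shows "(\<Sum>c\<in>FP. ep (c * y)) = (if y = 0 then of_nat p else 0)"
proof (cases "y = 0")
  case True then show ?thesis by (simp add: card_FP)
next
  case False
  have "(\<Sum>c\<in>FP. ep (c * y)) = (\<Sum>c\<in>FP. ep c)"
    by (rule sum.reindex_bij_witness[of _ "\<lambda>c. c / y" "\<lambda>c. c * y"])
       (use False assms FP_mult FP_divide in auto)
  also have "\<dots> = (\<Sum>n<p. zeta p ^ n)"
    unfolding FP_def by (subst sum.reindex[OF inj_of_nat]) (simp add: ep_of_nat)
  also have "\<dots> = 0" using zeta_p_neq_1 zeta_pow[of p] p_ge3 by (simp add: sum_gp_strict)
  finally show ?thesis using False by simp
qed

definition psi :: "'a \<Rightarrow> complex" where "psi x = ep (tr x)"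

lemma psi_add: "psi (x + y) = psi x * psi y" by (simp add: psi_def tr_add ep_add tr_FP)
lemma tr_0 [simp]: "tr 0 = 0" using tr_add[of 0 0] by (metis add.right_neutral add_left_imp_eq)
lemma tr_uminus: "tr (- x) = - tr x" using tr_add[of x "- x"] by (simp add: eq_neg_iff_add_eq_0 add.commute)
lemma psi_0 [simp]: "psi 0 = 1" by (simp add: psi_def)
lemma psi_frob: "psi (x ^ p) = psi x" by (simp add: psi_def tr_frob)
lemma psi_cnj: "cnj (psi x) = psi (- x)" by (simp add: psi_def ep_cnj tr_FP tr_uminus)

lemma sum_psi: "(\<Sum>x\<in>UNIV. psi (x * a)) = (if a = 0 then of_nat Q else 0)"
proof (cases "a = 0")
  case True then show ?thesis using card_field Q_def by simp
next
  case False
  obtain t where t: "tr t = 1" using tr_nontrivial by blast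
  have "ep 1 = zeta p" using ep_of_nat[of 1] by simp
  then have pt: "psi t \<noteq> 1" using t zeta_p_neq_1 by (simp add: psi_def)
  have *: "(\<Sum>x\<in>UNIV. psi (x * a)) = (\<Sum>x\<in>UNIV. psi x)"
    by (rule sum.reindex_bij_witness[of _ "\<lambda>c. c / a" "\<lambda>c. c * a"]) (use False in auto)
  have "(\<Sum>x\<in>UNIV. psi x) = (\<Sum>x\<in>UNIV. psi (x + t))"
    by (rule sum.reindex_bij_witness[of _ "\<lambda>c. c + t" "\<lambda>c. c - t"]) auto
  moreover have "(\<Sum>x\<in>UNIV. psi (x + t)) = (\<Sum>x\<in>UNIV. psi x) * psi t"
    unfolding psi_add sum_distrib_right ..
  ultimately have "(\<Sum>x\<in>UNIV. psi x) = 0" using pt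
    by (metis mult_cancel_left1)
  then show ?thesis using False * by simp
qed

end

section \<open>Gauss and Jacobi sums\<close>

lemma sum_double_period:
  fixes f :: "nat \<Rightarrow> 'b::comm_semiring_1"
  assumes "\<And>k. f (k + M) = f k"
  shows "(\<Sum>k<2 * M. f k) = 2 * (\<Sum>k<M. f k)"
proof -
  have "(\<Sum>k<M + M. f k) = (\<Sum>k<M. f k) + (\<Sum>k<M. f (k + M))"
    unfolding lessThan_atLeast0 by (subst sum.atLeastLessThan_concat[of 0 M "M + M", symmetric])
      (use sum.shift_bounds_nat_ivl[of f 0 M M] in auto)
  then show ?thesis using assms by (simp add: mult_2)
qed

lemma sum_split_parity:
  fixes f :: "nat \<Rightarrow> 'b::comm_monoid_add"
  shows "(\<Sum>k<2 * M. f k) = (\<Sum>k<M. f (2 * k)) + (\<Sum>k<M. f (2 * k + 1))"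
  by (induction M) (simp_all add: ac_simps)

text \<open>Bookkeeping of parity only; it serves to find a sum of fourth roots of unity modulo
  2.\<close>

lemma sum_odd_integers:
  fixes f :: "'b \<Rightarrow> real"
  assumes "finite A" "\<And>k. k \<in> A \<Longrightarrow> \<exists>n::int. odd n \<and> f k = of_int n"
  shows "\<exists>n::int. sum f A = of_int n \<and> (odd n \<longleftrightarrow> odd (card A))"
  using assms
proof (induction A rule: finite_induct)
  case empty
  show ?case by (intro exI[of _ 0]) simp
next
  case (insert x A)
  then obtain n :: int where n: "sum f A = of_int n" "odd n \<longleftrightarrow> odd (card A)" by blast
  obtain m :: int where m: "odd m" "f x = of_int m" using insert.prems by blast
  show ?case by (intro exI[of _ "m + n"]) (use insert.hyps n m in auto)
qed

lemma power_eq_1_coprime: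
  fixes t :: complex
  assumes "t ^ a = 1" "t ^ (2 ^ m) = 1" "odd a"
  shows "t = 1"
  using assms(2)
proof (induction m)
  case (Suc m)
  have "t ^ (2 ^ m) = 1 \<or> t ^ (2 ^ m) = - 1"
    using Suc.prems unfolding power_Suc mult.commute[of 2] power_mult by (simp add: power2_eq_1_iff)
  moreover have "t ^ (2 ^ m) \<noteq> - 1"
  proof
    assume "t ^ (2 ^ m) = - 1"
    then have "(t ^ (2 ^ m)) ^ a = - 1" using assms(3) by simp
    moreover have "(t ^ (2 ^ m)) ^ a = (t ^ a) ^ (2 ^ m)" by (simp only: power_mult[symmetric] mult.commute)
    ultimately show False using assms(1) by simp
  qed
  ultimately show ?case using Suc.IH by blast
qed simp

context cyclotomic_field
begin

definition gauss :: "complex \<Rightarrow> complex" where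
  "gauss w = (\<Sum>x\<in>UNIV. chi w x * psi x)"

definition jacobi :: "complex \<Rightarrow> complex \<Rightarrow> complex" where
  "jacobi w v = (\<Sum>x\<in>UNIV. chi w x * chi v (1 - x))"

lemma gauss_twist:
  assumes "root w" "a \<noteq> 0"
  shows "chi w a * (\<Sum>x\<in>UNIV. chi w x * psi (x * a)) = gauss w"
proof -
  have "chi w a * (\<Sum>x\<in>UNIV. chi w x * psi (x * a)) = (\<Sum>x\<in>UNIV. chi w (x * a) * psi (x * a))"
    by (simp add: chi_mult[OF assms(1)] sum_distrib_left mult_ac)
  also have "\<dots> = gauss w" unfolding gauss_def
    by (rule sum.reindex_bij_witness[of _ "\<lambda>c. c / a" "\<lambda>c. c * a"]) (use assms in auto)
  finally show ?thesis .
qed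

text \<open>The map \<open>x \<mapsto> x ^ p\<close> permutes the field and preserves the
  trace.\<close>

lemma gauss_frob: assumes "root w" shows "gauss (w ^ p) = gauss w"
proof -
  have "gauss (w ^ p) = (\<Sum>x\<in>UNIV. chi w (x ^ p) * psi (x ^ p))"
    by (simp add: gauss_def chi_frobenius assms psi_frob)
  also have "\<dots> = gauss w" unfolding gauss_def
    by (rule sum.reindex_bij_witness[of _ "\<lambda>x. x ^ (p ^ (s - 1))" "\<lambda>x. x ^ p"]) (simp_all only: frob_inverse UNIV_I)
  finally show ?thesis .
qed

lemma chi_m1_sq: "root w \<Longrightarrow> chi w (- 1) * chi w (- 1) = 1"
  by (simp flip: chi_mult)

lemma chi_m1_inverse: "root w \<Longrightarrow> chi (inverse w) (- 1) = chi w (- 1)"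
  using chi_m1_sq[of w] by (simp add: chi_inverse_char inverse_unique)

lemma chi_inverse_mult: "root w \<Longrightarrow> x \<noteq> 0 \<Longrightarrow> chi (inverse w) x * chi w x = 1"
  by (simp add: chi_inverse_char chi_nz)

text \<open>After the substitution \<open>x \<mapsto> x * y\<close> the sum over \<open>y\<close> is
  a sum of values of the additive character, and its orthogonality leaves only
  \<open>x = - 1\<close>.\<close>

lemma gauss_inverse:
  assumes "root w" "w \<noteq> 1"
  shows "gauss w * gauss (inverse w) = chi w (- 1) * of_nat Q"
proof -
  let ?v = "inverse w"
  have "gauss w * gauss ?v = (\<Sum>y\<in>UNIV - {0}. chi ?v y * psi y * gauss w)"
    unfolding gauss_def[of ?v] sum_distrib_left
    by (rule sum.mono_neutral_cong_right) auto
  also have "\<dots> = (\<Sum>y\<in>UNIV - {0}. psi y * (\<Sum>x\<in>UNIV. chi w x * psi (x * y)))"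
  proof (rule sum.cong)
    fix y :: 'a assume y: "y \<in> UNIV - {0}"
    have g: "gauss w = chi w y * (\<Sum>x\<in>UNIV. chi w x * psi (x * y))"
      using gauss_twist[OF assms(1), of y] y by simp
    have "chi ?v y * psi y * gauss w = (chi ?v y * chi w y) * (psi y * (\<Sum>x\<in>UNIV. chi w x * psi (x * y)))"
      unfolding g by (simp only: mult_ac)
    also have "chi ?v y * chi w y = 1" using y by (intro chi_inverse_mult assms) simp
    finally show "chi ?v y * psi y * gauss w = psi y * (\<Sum>x\<in>UNIV. chi w x * psi (x * y))"
      by (simp only: mult_1)
  qed simp
  also have "\<dots> = (\<Sum>y\<in>UNIV - {0}. \<Sum>x\<in>UNIV. chi w x * psi (y * (1 + x)))"
    by (simp add: sum_distrib_left psi_add distrib_left mult_ac)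
  also have "\<dots> = (\<Sum>x\<in>UNIV. chi w x * (\<Sum>y\<in>UNIV - {0}. psi (y * (1 + x))))"
    by (subst sum.swap) (simp add: sum_distrib_left)
  also have "\<dots> = (\<Sum>x\<in>UNIV. chi w x * ((if x = - 1 then of_nat Q else 0) - 1))"
  proof (rule sum.cong)
    fix x :: 'a
    have "(\<Sum>y\<in>UNIV. psi (y * (1 + x))) = 1 + (\<Sum>y\<in>UNIV - {0}. psi (y * (1 + x)))"
      by (subst sum.remove[of _ 0]) auto
    moreover have "1 + x = 0 \<longleftrightarrow> x = - 1" by (metis add.commute add_eq_0_iff)
    ultimately have "(\<Sum>y\<in>UNIV - {0}. psi (y * (1 + x))) = (if x = - 1 then of_nat Q else 0) - 1"
      unfolding sum_psi by (auto simp: algebra_simps)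
    then show "chi w x * (\<Sum>y\<in>UNIV - {0}. psi (y * (1 + x))) =
        chi w x * ((if x = - 1 then of_nat Q else 0) - 1)" by simp
  qed simp
  also have "\<dots> = (\<Sum>x\<in>UNIV. if x = - 1 then chi w x * of_nat Q else 0) - (\<Sum>x\<in>UNIV. chi w x)"
    unfolding sum_subtractf[symmetric] by (rule sum.cong) (auto simp: algebra_simps)
  also have "\<dots> = chi w (- 1) * of_nat Q" by (simp add: sum_chi assms)
  finally show ?thesis .
qed

lemma gauss_cnj: "root w \<Longrightarrow> cnj (gauss w) = chi w (- 1) * gauss (inverse w)"
proof -
  assume w: "root w"
  have "cnj (gauss w) = (\<Sum>x\<in>UNIV. chi (inverse w) x * psi (x * - 1))"
    by (simp add: gauss_def chi_cnj psi_cnj root_cnj[OF w])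
  then have "chi (inverse w) (- 1) * cnj (gauss w) = gauss (inverse w)"
    using gauss_twist[OF root_inverse[OF w], of "- 1"] by simp
  then have "chi w (- 1) * chi w (- 1) * cnj (gauss w) = chi w (- 1) * gauss (inverse w)"
    using chi_m1_inverse[OF w] by (simp add: mult_ac)
  then show ?thesis using chi_m1_sq[OF w] by simp
qed

lemma gauss_norm: "root w \<Longrightarrow> w \<noteq> 1 \<Longrightarrow> gauss w * cnj (gauss w) = of_nat Q"
proof -
  assume w: "root w" "w \<noteq> 1"
  have "gauss w * cnj (gauss w) = chi w (- 1) * (gauss w * gauss (inverse w))"
    by (simp add: gauss_cnj w)
  then show ?thesis using chi_m1_sq[OF w(1)] by (simp add: gauss_inverse w flip: mult.assoc)
qed

lemma gauss_nz: "root w \<Longrightarrow> w \<noteq> 1 \<Longrightarrow> gauss w \<noteq> 0"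
  using gauss_norm[of w] Q_ge by auto

lemma gauss_jacobi:
  assumes w: "root w" and v: "root v" and wv: "w * v \<noteq> 1"
  shows "gauss w * gauss v = jacobi w v * gauss (w * v)"
proof -
  have rwv: "root (w * v)" using root_mult w v by blast
  have "gauss w * gauss v = (\<Sum>x\<in>UNIV. \<Sum>y\<in>UNIV. chi w x * chi v y * psi (x + y))"
    unfolding gauss_def sum_product by (simp add: psi_add mult_ac)
  also have "\<dots> = (\<Sum>x\<in>UNIV. \<Sum>u\<in>UNIV. chi w x * chi v (u - x) * psi u)"
  proof (rule sum.cong)
    fix x :: 'a
    show "(\<Sum>y\<in>UNIV. chi w x * chi v y * psi (x + y)) = (\<Sum>u\<in>UNIV. chi w x * chi v (u - x) * psi u)"
      by (rule sum.reindex_bij_witness[of _ "\<lambda>u. u - x" "\<lambda>y. x + y"]) auto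
  qed simp
  also have "\<dots> = (\<Sum>u\<in>UNIV. psi u * (\<Sum>x\<in>UNIV. chi w x * chi v (u - x)))"
    by (subst sum.swap) (simp add: sum_distrib_left mult_ac)
  also have "\<dots> = (\<Sum>u\<in>UNIV. psi u * (chi (w * v) u * jacobi w v))"
  proof (rule sum.cong)
    fix u :: 'a
    have "(\<Sum>x\<in>UNIV. chi w x * chi v (u - x)) = chi (w * v) u * jacobi w v"
    \<comment> \<open>The terms with \<open>x + y = 0\<close> form a complete character sum for
      \<open>w * v\<close>, which vanishes because this character is nontrivial.\<close>
    proof (cases "u = 0")
      case True
      have "chi w x * chi v (- x) = chi v (- 1) * chi (w * v) x" for x
        using chi_mult[OF v, of "- 1" x] by (simp add: chi_mult_char)
      then have "(\<Sum>x\<in>UNIV. chi w x * chi v (- x)) = chi v (- 1) * (\<Sum>x\<in>UNIV. chi (w * v) x)"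
        by (simp add: sum_distrib_left)
      then show ?thesis using True sum_chi[OF rwv wv] by simp
    next
      case False
      have "(\<Sum>x\<in>UNIV. chi w x * chi v (u - x)) = (\<Sum>x\<in>UNIV. chi w (u * x) * chi v (u * (1 - x)))"
        by (rule sum.reindex_bij_witness[of _ "\<lambda>x. u * x" "\<lambda>x. x / u"])
           (use False in \<open>auto simp: right_diff_distrib\<close>)
      also have "\<dots> = chi (w * v) u * jacobi w v"
        by (simp add: jacobi_def chi_mult w v chi_mult_char sum_distrib_left mult_ac)
      finally show ?thesis .
    qed
    then show "psi u * (\<Sum>x\<in>UNIV. chi w x * chi v (u - x)) = psi u * (chi (w * v) u * jacobi w v)"
      by simp
  qed simp
  also have "\<dots> = jacobi w v * gauss (w * v)"
    by (simp add: gauss_def sum_distrib_left mult_ac)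
  finally show ?thesis .
qed

section \<open>The quadratic character and the duplication formula\<close>

lemma sum_squares:
  fixes f :: "'a \<Rightarrow> complex"
  shows "(\<Sum>y\<in>UNIV. f (y\<^sup>2)) = (\<Sum>x\<in>UNIV. f x * (1 + chi (- 1) x))"
proof -
  obtain M where M: "L = 2 * M" using sixteen_dvd_L by auto
  have "(\<Sum>y\<in>UNIV. f (y\<^sup>2)) = f 0 + (\<Sum>y\<in>UNIV - {0}. f (y\<^sup>2))"
    by (subst sum.remove[of _ 0]) auto
  also have "(\<Sum>y\<in>UNIV - {0}. f (y\<^sup>2)) = (\<Sum>k<2 * M. f (\<gamma> ^ (2 * k)))"
    by (simp add: sum_units M power_mult[symmetric] mult.commute)
  also have "\<dots> = 2 * (\<Sum>k<M. f (\<gamma> ^ (2 * k)))"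
  proof (rule sum_double_period)
    fix k
    have "\<gamma> ^ (2 * (k + M)) = \<gamma> ^ (2 * k)" unfolding gamma_eq_iff M cong_def by simp
    then show "f (\<gamma> ^ (2 * (k + M))) = f (\<gamma> ^ (2 * k))" by simp
  qed
  \<comment> \<open>The weight is 2 at even exponents, the squares, and 0 at odd ones.\<close>
  also have "\<dots> = (\<Sum>k<2 * M. f (\<gamma> ^ k) * (1 + (- 1) ^ k))"
    unfolding sum_split_parity by (simp add: sum_distrib_left mult.commute)
  also have "\<dots> = (\<Sum>x\<in>UNIV - {0}. f x * (1 + chi (- 1) x))"
    by (simp add: sum_units M chi_gamma root_minus1)
  also have "f 0 + \<dots> = (\<Sum>x\<in>UNIV. f x * (1 + chi (- 1) x))"
    by (subst sum.remove[of UNIV 0]) auto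
  finally show ?thesis .
qed

lemma jacobi_quadratic:
  assumes "root w" "w \<noteq> 1"
  shows "jacobi w (- 1) = (\<Sum>y\<in>UNIV. chi w (1 - y\<^sup>2))"
proof -
  have "(\<Sum>x\<in>UNIV. chi w (1 - x)) = (\<Sum>x\<in>UNIV. chi w x)"
    by (rule sum.reindex_bij_witness[of _ "\<lambda>x. 1 - x" "\<lambda>x. 1 - x"]) auto
  then have "(\<Sum>y\<in>UNIV. chi w (1 - y\<^sup>2)) = (\<Sum>x\<in>UNIV. chi w (1 - x) * chi (- 1) x)"
    unfolding sum_squares[of "\<lambda>x. chi w (1 - x)"] using sum_chi[OF assms]
    by (simp add: distrib_left sum.distrib)
  also have "\<dots> = jacobi w (- 1)" unfolding jacobi_def
    by (rule sum.reindex_bij_witness[of _ "\<lambda>x. 1 - x" "\<lambda>x. 1 - x"]) auto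
  finally show ?thesis by simp
qed

lemma two_nz: "(2::'a) \<noteq> 0"
proof -
  have "(of_nat 2 :: 'a) \<noteq> of_nat 0"
    using p_ge3 by (simp only: of_nat_eq_iff_cong_CHAR char_field) (simp add: cong_def)
  then show ?thesis by simp
qed

text \<open>As 2 lies in the prime field, 4 has order dividing \<open>(p - 1) div 2\<close>, which
  is odd because \<open>p\<close> is 3 modulo 4. A character of 2-power order is therefore trivial
  on it.\<close>

lemma chi_4: assumes "root w" "w ^ (2 ^ m) = 1" shows "chi w 4 = 1"
proof (rule power_eq_1_coprime)
  have "(of_nat 2 :: 'a) ^ p = of_nat 2" using FP_iff of_nat_FP by blast
  then have "(2::'a) * 2 ^ (p - 1) = 2" using p_ge3 by (simp add: power_eq_if)
  then have "(2::'a) ^ (p - 1) = 1" using two_nz by simp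
  moreover have "p - 1 = 2 * ((p - 1) div 2)" using odd_p p_ge3 by simp
  ultimately have "((2::'a)\<^sup>2) ^ ((p - 1) div 2) = 1" by (metis power_mult)
  then show "chi w 4 ^ ((p - 1) div 2) = 1"
    using assms(1) by (simp flip: chi_power)
  show "odd ((p - 1) div 2)" using p_mod by presburger
  have "(4::'a) \<noteq> 0" using two_nz by (metis mult_eq_0_iff numeral_Bit0 mult_2 one_add_one)
  then show "chi w 4 ^ 2 ^ m = 1" using assms(2)
    by (simp add: chi_def) (metis mult.commute power_mult power_one)
qed

text \<open>Completing the square: \<open>4 * x * (1 - x)\<close> is 1 minus the square of
  \<open>2 * x - 1\<close>, and the factor 4 is invisible to the character.\<close>

lemma jacobi_same:
  assumes "root w" "w \<noteq> 1" "chi w 4 = 1"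
  shows "jacobi w w = jacobi w (- 1)"
proof -
  have e: "4 * (x * (1 - x)) = 1 - (2 * x - 1)\<^sup>2" for x :: 'a
    by (simp add: power2_eq_square algebra_simps)
  have "chi w x * chi w (1 - x) = chi w (1 - (2 * x - 1)\<^sup>2)" for x
    using chi_mult[OF assms(1), of 4 "x * (1 - x)"] assms(3) chi_mult[OF assms(1), of x "1 - x"]
    unfolding e by simp
  then have "jacobi w w = (\<Sum>x\<in>UNIV. chi w (1 - (2 * x - 1)\<^sup>2))" by (simp add: jacobi_def)
  also have "\<dots> = (\<Sum>y\<in>UNIV. chi w (1 - y\<^sup>2))"
    by (rule sum.reindex_bij_witness[of _ "\<lambda>y. (y + 1) / 2" "\<lambda>x. 2 * x - 1"]) (use two_nz in \<open>auto simp: field_simps\<close>)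
  finally show ?thesis using jacobi_quadratic assms by simp
qed

text \<open>The case of the Hasse--Davenport product formula for the factor 2, in which the usual
  factor \<open>\<chi>(4)\<close> is trivial.\<close>

lemma gauss_duplication:
  assumes w: "root w" "w ^ 2 \<noteq> 1" "chi w 4 = 1"
  shows "gauss w * gauss (- w) = gauss (w ^ 2) * gauss (- 1)"
proof -
  have w1: "w \<noteq> 1" "- w \<noteq> 1" using w(2) by (auto simp: minus_equation_iff)
  have 1: "gauss w * gauss w = jacobi w (- 1) * gauss (w ^ 2)"
    using gauss_jacobi[of w w] jacobi_same w w1 by (simp add: power2_eq_square)
  have 2: "gauss w * gauss (- 1) = jacobi w (- 1) * gauss (- w)"
    using gauss_jacobi[of w "- 1"] w root_minus1 w1 by simp
  have "gauss w * (gauss w * gauss (- w)) = (gauss w * gauss w) * gauss (- w)" by simp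
  also have "\<dots> = (jacobi w (- 1) * gauss (- w)) * gauss (w ^ 2)" unfolding 1 by (simp add: mult_ac)
  also have "\<dots> = gauss w * (gauss (w ^ 2) * gauss (- 1))" unfolding 2[symmetric] by (simp add: mult_ac)
  finally have "gauss w * (gauss w * gauss (- w)) = gauss w * (gauss (w ^ 2) * gauss (- 1))" .
  then show ?thesis using gauss_nz[OF w(1) w1(1)] by simp
qed

end

section \<open>Characters of 2-power order\<close>

text \<open>A coherent system of primitive \<open>2 ^ r\<close>-th roots of unity: squaring lowers
  the level by one, which matches the square of the character in the duplication formula.\<close>

definition zr :: "nat \<Rightarrow> complex" where "zr r = cis (2 * pi / 2 ^ r)"

lemma zr_Suc_sq: "zr (Suc r) ^ 2 = zr r"
  unfolding zr_def DeMoivre by simp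

lemma zr_add_power: "zr (r + n) ^ (2 ^ n) = zr r"
proof (induction n)
  case (Suc n)
  have "zr (r + Suc n) ^ (2 ^ Suc n) = (zr (Suc (r + n)) ^ 2) ^ (2 ^ n)"
    by (simp add: power_mult)
  then show ?case using Suc by (simp add: zr_Suc_sq)
qed simp

lemma zr_0: "zr 0 = 1" by (simp add: zr_def)
lemma zr_1: "zr (Suc 0) = - 1" by (simp add: zr_def)
lemma zr_2: "zr 2 = \<i>" by (simp add: zr_def)
lemma zr_power: "zr r ^ (2 ^ r) = 1" using zr_add_power[of 0 r] by (simp add: zr_0)
lemma zr_half: "zr (Suc r) ^ (2 ^ r) = - 1" using zr_add_power[of 1 r] by (simp add: zr_1)
lemma zr_nz: "zr r \<noteq> 0" by (simp add: zr_def)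
lemma zr_neq_1: "r > 0 \<Longrightarrow> zr r \<noteq> 1"
  using zr_half[of "r - 1"] by auto

lemma zr_power_cong: "[j = k] (mod 2 ^ r) \<Longrightarrow> zr r ^ j = zr r ^ k"
proof -
  have "zr r ^ j = zr r ^ (j mod 2 ^ r)" for j
  proof -
    have "zr r ^ j = zr r ^ (2 ^ r * (j div 2 ^ r) + j mod 2 ^ r)" by simp
    also have "\<dots> = zr r ^ (j mod 2 ^ r)" unfolding power_add power_mult zr_power by simp
    finally show ?thesis .
  qed
  then show "[j = k] (mod 2 ^ r) \<Longrightarrow> zr r ^ j = zr r ^ k" unfolding cong_def by metis
qed

text \<open>The origin of every \<open>sqrt 2\<close> below: the eighth roots with exponents 1 and
  3, the classes of powers of \<open>p\<close>, add up to a square root of -2.\<close>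

lemma zr_3: "zr 3 + zr 3 ^ 3 = \<i> * sqrt 2"
proof -
  have "zr 3 + zr 3 ^ 3 = cis (pi / 4) + cis (pi - pi / 4)"
    unfolding zr_def DeMoivre by (simp add: field_simps)
  also have "\<dots> = \<i> * sqrt 2"
    by (simp only: complex_eq_iff plus_complex.simps cis.simps cos_pi_minus sin_pi_minus cos_45 sin_45) simp
  finally show ?thesis .
qed

lemma sum_blocks_four:
  fixes f :: "nat \<Rightarrow> 'b::comm_monoid_add"
  shows "(\<Sum>j<4 * M. f j) = (\<Sum>i<M. f (4 * i) + f (4 * i + 1) + f (4 * i + 2) + f (4 * i + 3))"
proof (induction M)
  case (Suc M)
  have "4 * Suc M = Suc (Suc (Suc (Suc (4 * M))))" by simp
  then show ?case using Suc by (simp add: ac_simps eval_nat_numeral)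
qed simp

text \<open>If \<open>u\<close> is 1 or -1, all terms agree; otherwise this is a vanishing geometric
  sum. The factor \<open>2 ^ (r - 1)\<close> is what yields integrality in
  \<open>chi_sum_integral\<close>.\<close>

lemma sum_odd_powers:
  fixes u :: complex
  assumes "u ^ (2 ^ r) = 1" "r \<ge> 1"
  shows "\<exists>n::int. (\<Sum>j<2 ^ (r - 1). u ^ (2 * j + 1)) = 2 ^ (r - 1) * of_int n"
proof (cases "u\<^sup>2 = 1")
  case True
  then have "u = 1 \<or> u = - 1" by (simp add: power2_eq_1_iff)
  then obtain n :: int where "u = of_int n" by (metis of_int_1 of_int_minus)
  then show ?thesis using True by (intro exI[of _ n]) (simp add: power_add power_mult)
next
  case False
  have "2 * 2 ^ (r - 1) = (2::nat) ^ r" using assms(2) by (simp add: power_eq_if)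
  then have "(u\<^sup>2) ^ (2 ^ (r - 1)) = 1" using assms(1) by (simp flip: power_mult)
  then have "(\<Sum>j<2 ^ (r - 1). (u\<^sup>2) ^ j) = 0" using False by (simp add: sum_gp_strict)
  then have "(\<Sum>j<2 ^ (r - 1). u ^ (2 * j + 1)) = 0"
    by (simp add: power_add power_mult flip: sum_distrib_left)
  then show ?thesis by (intro exI[of _ 0]) simp
qed

context cyclotomic_field
begin

lemma root_zr: "2 ^ r dvd L \<Longrightarrow> root (zr r)"
  unfolding root_def by (auto simp: power_mult zr_power elim!: dvdE)

lemma invariant_power:
  assumes F: "\<And>w. root w \<Longrightarrow> F (w ^ p) = F w" and w: "root w"
  shows "F (w ^ (p ^ a)) = (F w :: complex)"
proof (induction a)
  case (Suc a)
  have "F (w ^ (p ^ Suc a)) = F ((w ^ (p ^ a)) ^ p)"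
    by (simp only: power_mult[symmetric] power_Suc mult.commute)
  then show ?case using Suc F root_power w by simp
qed simp

text \<open>The powers of \<open>p\<close> are the classes 1 and 3 modulo 8, so that a function of the
  primitive \<open>2 ^ r\<close>-th roots of unity that is invariant under \<open>w \<mapsto> w ^ p\<close> takes two values.\<close>

lemma invariant_zr:
  assumes F: "\<And>w. root w \<Longrightarrow> F (w ^ p) = (F w :: complex)" and r: "r \<ge> 3" "2 ^ r dvd L"
  shows "j mod 8 = 1 \<or> j mod 8 = 3 \<Longrightarrow> F (zr r ^ j) = F (zr r)"
    and "j mod 8 = 5 \<or> j mod 8 = 7 \<Longrightarrow> F (zr r ^ j) = F (inverse (zr r))"
proof -
  assume "j mod 8 = 1 \<or> j mod 8 = 3"
  then obtain a where a: "[p ^ a = j] (mod 2 ^ r)"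
    using power_cong_surj[OF p_mod r(1)] by blast
  then have "zr r ^ j = zr r ^ (p ^ a)" using zr_power_cong cong_sym by metis
  then show "F (zr r ^ j) = F (zr r)" using invariant_power[of F, OF F root_zr[OF r(2)]] by simp
next
  assume j: "j mod 8 = 5 \<or> j mod 8 = 7"
  \<comment> \<open>A natural number congruent to \<open>- j\<close> modulo \<open>2 ^ r\<close>; it
    moves the classes 5 and 7 to 3 and 1.\<close>
  define k where "k = j * (2 ^ r - 1)"
  have "(2::nat) ^ r = 8 * 2 ^ (r - 3)" using r by (simp add: power_eq_if numeral_3_eq_3)
  then obtain t where t: "(2::nat) ^ r - 1 = 8 * t + 7"
    by (intro that[of "2 ^ (r - 3) - 1"]) (simp add: diff_mult_distrib2)
  have "k mod 8 = (j mod 8) * ((8 * t + 7) mod 8) mod 8" unfolding k_def t by (rule mod_mult_eq[symmetric])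
  moreover have "(8 * t + 7) mod 8 = 7" by presburger
  ultimately have "k mod 8 = (j mod 8) * 7 mod 8" by simp
  then have "k mod 8 = 1 \<or> k mod 8 = 3" using j by auto
  then obtain a where a: "[p ^ a = k] (mod 2 ^ r)"
    using power_cong_surj[OF p_mod r(1)] by blast
  have jk: "j + k = j * 2 ^ r"
  proof -
    have "j + k = j * (1 + (2 ^ r - 1))" unfolding k_def by (simp only: distrib_left mult_1_right)
    then show ?thesis by simp
  qed
  have "zr r ^ j * zr r ^ k = (zr r ^ (2 ^ r)) ^ j"
    unfolding power_add[symmetric] jk by (simp only: power_mult[symmetric] mult.commute)
  then have "zr r ^ j * zr r ^ k = 1" by (simp add: zr_power)
  moreover have "zr r ^ k = zr r ^ (p ^ a)" using a zr_power_cong cong_sym by metis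
  ultimately have "zr r ^ j = inverse (zr r) ^ (p ^ a)"
    by (metis inverse_unique mult.commute power_inverse)
  then show "F (zr r ^ j) = F (inverse (zr r))"
    using invariant_power[of F, OF F root_inverse[OF root_zr[OF r(2)]]] by simp
qed

text \<open>The odd exponents are cut into blocks 1, 3, 5, 7 modulo 8; on each block
  \<open>F\<close> takes its two values twice, and \<open>u ^ 8\<close> passes from one block to the
  next.\<close>

lemma sum_invariant:
  assumes F: "\<And>w. root w \<Longrightarrow> F (w ^ p) = (F w :: complex)" and r: "r \<ge> 3" "2 ^ r dvd L"
  shows "(\<Sum>j<2 ^ (r - 1). u ^ (2 * j + 1) * F (zr r ^ (2 * j + 1))) =
    (\<Sum>i<2 ^ (r - 3). (u ^ 8) ^ i) *
      ((u + u ^ 3) * F (zr r) + (u ^ 5 + u ^ 7) * F (inverse (zr r)))"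
proof -
  have e: "(2::nat) ^ (r - 1) = 4 * 2 ^ (r - 3)" using r by (simp add: power_eq_if numeral_3_eq_3)
  have "(2 * (4 * i) + 1) mod 8 = 1" "(2 * (4 * i + 1) + 1) mod 8 = 3"
    "(2 * (4 * i + 2) + 1) mod 8 = 5" "(2 * (4 * i + 3) + 1) mod 8 = 7" for i :: nat
    by presburger+
  then have 1: "F (zr r ^ (2 * (4 * i) + 1)) = F (zr r)" "F (zr r ^ (2 * (4 * i + 1) + 1)) = F (zr r)"
     "F (zr r ^ (2 * (4 * i + 2) + 1)) = F (inverse (zr r))"
     "F (zr r ^ (2 * (4 * i + 3) + 1)) = F (inverse (zr r))" for i
    using invariant_zr[of F r] F r by blast+
  have 2: "u ^ (2 * (4 * i) + 1) = (u ^ 8) ^ i * u" "u ^ (2 * (4 * i + 1) + 1) = (u ^ 8) ^ i * u ^ 3"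
    "u ^ (2 * (4 * i + 2) + 1) = (u ^ 8) ^ i * u ^ 5" "u ^ (2 * (4 * i + 3) + 1) = (u ^ 8) ^ i * u ^ 7" for i
    by (simp_all add: power_mult power_add power2_eq_square flip: power_mult)
       (simp_all add: power_add mult_ac eval_nat_numeral)
  show ?thesis unfolding e sum_blocks_four 1 2 sum_distrib_right
    by (rule sum.cong) (simp_all add: algebra_simps)
qed

lemma gauss_zr_sum:
  assumes "r \<ge> 3" "2 ^ r dvd L"
  shows "(\<Sum>j<2 ^ (r - 1). u ^ (2 * j + 1) * gauss (zr r ^ (2 * j + 1))) =
    (\<Sum>i<2 ^ (r - 3). (u ^ 8) ^ i) *
      ((u + u ^ 3) * gauss (zr r) + (u ^ 5 + u ^ 7) * gauss (inverse (zr r)))"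
  by (rule sum_invariant[of gauss, OF gauss_frob assms])

text \<open>Summing over all primitive \<open>2 ^ r\<close>-th roots counts each of the two values
  \<open>2 ^ (r - 2)\<close> times, while pointwise the sum is \<open>2 ^ (r - 1)\<close> times an
  integer. The quotient leaves an even integer. The sets \<open>S\<close> in use are fibres of the
  trace.\<close>

lemma chi_sum_integral:
  assumes r: "r \<ge> 3" "2 ^ r dvd L" and S: "\<And>x. x \<in> S \<Longrightarrow> x ^ p \<in> S"
    and S0: "\<And>x. x ^ p \<in> S \<Longrightarrow> x \<in> S"
  shows "\<exists>n::int. (\<Sum>x\<in>S. chi (zr r) x) + (\<Sum>x\<in>S. chi (inverse (zr r)) x) = of_int (2 * n)"
proof -
  define F where "F w = (\<Sum>x\<in>S. chi w x)" for w
  have bij: "bij_betw (\<lambda>x. x ^ p) S S"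
  proof -
    have "(\<lambda>x. x ^ p) ` S = S"
    proof (intro equalityI subsetI)
      fix x assume "x \<in> S"
      obtain y where "x = y ^ p" using frob_surj by blast
      then show "x \<in> (\<lambda>x. x ^ p) ` S" using S0 \<open>x \<in> S\<close> by blast
    qed (use S in auto)
    then show ?thesis by (simp add: bij_betw_def eq_card_imp_inj_on)
  qed
  have F: "F (w ^ p) = F w" if "root w" for w
    unfolding F_def chi_frobenius[OF that] by (rule sum.reindex_bij_betw[OF bij])
  have e: "2 ^ (r - 1) = (2 * 2 ^ (r - 2) :: complex)"
    using r by (simp add: power_eq_if numeral_2_eq_2)
  have e': "2 ^ (r - 2) = (2 * 2 ^ (r - 3) :: complex)"
    using r by (simp add: power_eq_if numeral_3_eq_3 numeral_2_eq_2)
  have 1: "(\<Sum>j<2 ^ (r - 1). F (zr r ^ (2 * j + 1))) = 2 ^ (r - 2) * (F (zr r) + F (inverse (zr r)))"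
    using sum_invariant[of F, OF F r, of 1] by (simp add: e' algebra_simps)
  have "\<forall>x. \<exists>n::int. (\<Sum>j<2 ^ (r - 1). chi (zr r ^ (2 * j + 1)) x) = 2 ^ (r - 1) * of_int n"
  proof
    fix x
    show "\<exists>n::int. (\<Sum>j<2 ^ (r - 1). chi (zr r ^ (2 * j + 1)) x) = 2 ^ (r - 1) * of_int n"
    proof (cases "x = 0")
      case True then show ?thesis by (intro exI[of _ 0]) simp
    next
      case False
      have "chi (zr r) x ^ (2 ^ r) = 1"
        using False zr_power[of r] by (simp add: chi_def) (metis mult.commute power_mult power_one)
      moreover have "chi (zr r ^ (2 * j + 1)) x = chi (zr r) x ^ (2 * j + 1)" for j
        by (rule chi_power_char) simp
      ultimately show ?thesis using sum_odd_powers[of "chi (zr r) x" r] r by (simp only:)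
    qed
  qed
  then obtain n :: "'a \<Rightarrow> int" where n: "\<And>x. (\<Sum>j<2 ^ (r - 1). chi (zr r ^ (2 * j + 1)) x) = 2 ^ (r - 1) * of_int (n x)"
    by metis
  have "(\<Sum>j<2 ^ (r - 1). F (zr r ^ (2 * j + 1))) = 2 ^ (r - 1) * of_int (\<Sum>x\<in>S. n x)"
    unfolding F_def by (subst sum.swap) (simp only: n of_int_sum sum_distrib_left)
  then have "F (zr r) + F (inverse (zr r)) = of_int (2 * (\<Sum>x\<in>S. n x))"
    unfolding 1 e by simp
  then show ?thesis unfolding F_def by blast
qed

text \<open>The squares of the prime field form a group of odd order \<open>(p - 1) div 2\<close>,
  on which a character of 2-power order is trivial, and -1 represents the other coset.\<close>

lemma chi_FP_sq:
  assumes "2 ^ r dvd L" "c \<in> FP" "c \<noteq> 0"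
  shows "chi (zr r) c = (if c ^ ((p - 1) div 2) = 1 then 1 else chi (zr r) (- 1))"
    and "c ^ ((p - 1) div 2) = 1 \<or> c ^ ((p - 1) div 2) = - 1"
proof -
  have z: "root (zr r)" using root_zr assms by blast
  have one: "chi (zr r) d = 1" if "d ^ ((p - 1) div 2) = 1" "d \<noteq> 0" for d
  proof (rule power_eq_1_coprime)
    show "chi (zr r) d ^ ((p - 1) div 2) = 1" using that z by (simp flip: chi_power)
    show "odd ((p - 1) div 2)" using p_mod by presburger
    show "chi (zr r) d ^ (2 ^ r) = 1"
      using that zr_power[of r] by (simp add: chi_def) (metis mult.commute power_mult power_one)
  qed
  have "c * c ^ (p - 1) = c" using assms FP_iff p_ge3 by (simp add: power_eq_if)
  then have "c ^ (p - 1) = 1" using assms by simp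
  moreover have "p - 1 = (p - 1) div 2 * 2" using odd_p p_ge3 by simp
  ultimately have "(c ^ ((p - 1) div 2))\<^sup>2 = 1" by (metis power_mult)
  then show or: "c ^ ((p - 1) div 2) = 1 \<or> c ^ ((p - 1) div 2) = - 1" by (simp add: power2_eq_1_iff)
  have "chi (zr r) c = chi (zr r) (- 1)" if "c ^ ((p - 1) div 2) \<noteq> 1"
  proof -
    have "odd ((p - 1) div 2)" using p_mod by presburger
    then have "(- c) ^ ((p - 1) div 2) = 1" using or that by auto
    then have "chi (zr r) (- c) = 1" using one assms by simp
    then have "chi (zr r) (- 1) * chi (zr r) (- c) = chi (zr r) (- 1)" by simp
    then show ?thesis by (simp flip: chi_mult[OF z])
  qed
  then show "chi (zr r) c = (if c ^ ((p - 1) div 2) = 1 then 1 else chi (zr r) (- 1))"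
    using one assms by simp
qed

section \<open>Gauss sums as character sums over fibres of the trace\<close>

lemma sum_ep_nonzero: "y \<in> FP \<Longrightarrow> (\<Sum>c\<in>FP - {0}. ep (c * y)) = (if y = 0 then of_nat p else 0) - 1"
  unfolding sum_ep[symmetric] using FP_0 by (subst sum.remove[of FP 0]) (auto simp: FP_def)

lemma psi_scale: "c \<in> FP \<Longrightarrow> psi (x * c) = ep (c * tr x)"
  by (simp add: psi_def tr_scale mult.commute[of x])

text \<open>The character is trivial on the units of the prime field, so the Gauss sum does not
  change when the additive character is scaled by \<open>c\<close>. Summing over all
  \<open>c\<close> turns the additive character into the indicator of trace 0.\<close>

lemma gauss_trace_zero:
  assumes r: "2 ^ r dvd L" "r \<ge> 1" and w: "w = zr r \<or> w = inverse (zr r)" and m1: "chi (zr r) (- 1) = 1"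
  shows "of_nat (p - 1) * gauss w = of_nat p * (\<Sum>x | tr x = 0. chi w x)"
proof -
  have rw: "root w" using w root_zr[OF r(1)] root_inverse by blast
  have w1: "w \<noteq> 1" using w zr_neq_1 r by (auto simp: inverse_eq_1_iff)
  have one: "chi w c = 1" if "c \<in> FP - {0}" for c
    using chi_FP_sq(1)[OF r(1), of c] that m1 w by (auto simp: chi_inverse_char)
  have "of_nat (p - 1) * gauss w = (\<Sum>c\<in>FP - {0}. gauss w)"
    using FP_0 by (simp add: card_FP card_Diff_singleton)
  also have "\<dots> = (\<Sum>c\<in>FP - {0}. \<Sum>x\<in>UNIV. chi w x * ep (c * tr x))"
  proof (rule sum.cong)
    fix c assume c: "c \<in> FP - {0}"
    then show "gauss w = (\<Sum>x\<in>UNIV. chi w x * ep (c * tr x))"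
      using gauss_twist[OF rw, of c] one[OF c] by (simp add: psi_scale)
  qed simp
  also have "\<dots> = (\<Sum>x\<in>UNIV. chi w x * ((if tr x = 0 then of_nat p else 0) - 1))"
    by (subst sum.swap) (simp add: tr_FP sum_ep_nonzero flip: sum_distrib_left)
  also have "\<dots> = (\<Sum>x\<in>UNIV. if tr x = 0 then of_nat p * chi w x else 0) - (\<Sum>x\<in>UNIV. chi w x)"
    unfolding sum_subtractf[symmetric] by (rule sum.cong) (auto simp: algebra_simps)
  also have "\<dots> = of_nat p * (\<Sum>x | tr x = 0. chi w x)"
    using sum_chi[OF rw w1] by (simp add: sum.If_cases sum_distrib_left)
  finally show ?thesis .
qed

lemma gauss_rational:
  assumes r: "r \<ge> 3" "2 ^ r dvd L" and m1: "chi (zr r) (- 1) = 1"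
  shows "\<exists>n::int. of_nat (p - 1) * (gauss (zr r) + gauss (inverse (zr r))) = of_int (2 * n)"
proof -
  obtain n :: int where n: "(\<Sum>x | tr x = 0. chi (zr r) x) + (\<Sum>x | tr x = 0. chi (inverse (zr r)) x) = of_int (2 * n)"
    using chi_sum_integral[OF r, of "{x. tr x = 0}"] by (auto simp: tr_frob)
  have "of_nat (p - 1) * (gauss (zr r) + gauss (inverse (zr r))) =
      of_nat p * ((\<Sum>x | tr x = 0. chi (zr r) x) + (\<Sum>x | tr x = 0. chi (inverse (zr r)) x))"
    using gauss_trace_zero[OF r(2) _ _ m1] r(1) by (simp add: distrib_left)
  then show ?thesis unfolding n by (intro exI[of _ "int p * n"]) simp
qed

text \<open>Here the character restricts to the quadratic character of the prime field.
  Multiplication by its Gauss sum \<open>g\<close>, whose square is \<open>- p\<close>, plays the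
  part of the averaging in \<open>gauss_trace_zero\<close> and leaves a sum over the elements of
  trace 1.\<close>

lemma gauss_irrational:
  assumes r: "r \<ge> 3" "2 ^ r dvd L" and m1: "chi (zr r) (- 1) = - 1"
  shows "\<exists>n::int. (gauss (zr r) + gauss (inverse (zr r)))\<^sup>2 = - of_int (4 * int p * n\<^sup>2)"
proof -
  let ?z = "zr r"
  have rz: "root ?z" "root (inverse ?z)" using root_zr[OF r(2)] root_inverse by blast+
  have val: "chi ?z c = 1 \<or> chi ?z c = - 1" if "c \<in> FP - {0}" for c
    using chi_FP_sq(1)[OF r(2), of c] that m1 by auto
  have inv: "chi (inverse ?z) c = chi ?z c" if "c \<in> FP - {0}" for c
    using val[OF that] by (auto simp: chi_inverse_char)
  have sq: "chi ?z c * chi ?z c = 1" if "c \<in> FP - {0}" for c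
    using val[OF that] by auto
  \<comment> \<open>The argument \<open>- c\<close> shifts the trace, so that the sum over
    \<open>c\<close> singles out \<open>tr x = 1\<close>.\<close>
  define g where "g = (\<Sum>c\<in>FP - {0}. chi ?z c * ep (- c))"
  have key: "g * gauss w = of_nat p * (\<Sum>x | tr x = 1. chi w x)" if w: "w = ?z \<or> w = inverse ?z" for w
  proof -
    have rw: "root w" using w rz by blast
    have w1: "w \<noteq> 1" using w zr_neq_1 r by (auto simp: inverse_eq_1_iff)
    have "g * gauss w = (\<Sum>c\<in>FP - {0}. \<Sum>x\<in>UNIV. chi w x * ep (c * (tr x - 1)))"
      unfolding g_def sum_distrib_right
    proof (rule sum.cong)
      fix c assume c: "c \<in> FP - {0}"
      have "chi ?z c * ep (- c) * gauss w =
          (chi ?z c * chi w c) * (\<Sum>x\<in>UNIV. chi w x * (ep (c * tr x) * ep (- c)))"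
      proof -
        have "gauss w = chi w c * (\<Sum>x\<in>UNIV. chi w x * ep (c * tr x))"
          using gauss_twist[OF rw, of c] c by (simp add: psi_scale)
        then have "chi ?z c * ep (- c) * gauss w
            = (chi ?z c * chi w c) * ((\<Sum>x\<in>UNIV. chi w x * ep (c * tr x)) * ep (- c))"
          by (simp only: mult_ac)
        then show ?thesis by (simp only: sum_distrib_right mult.assoc)
      qed
      also have "chi ?z c * chi w c = 1" using w sq[OF c] inv[OF c] by auto
      finally have e1: "chi ?z c * ep (- c) * gauss w
          = 1 * (\<Sum>x\<in>UNIV. chi w x * (ep (c * tr x) * ep (- c)))" .
      have "ep (c * tr x) * ep (- c) = ep (c * (tr x - 1))" for x
        using c ep_add[of "c * tr x" "- c"] by (simp add: FP_mult tr_FP FP_uminus right_diff_distrib)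
      then show "chi ?z c * ep (- c) * gauss w = (\<Sum>x\<in>UNIV. chi w x * ep (c * (tr x - 1)))"
        using e1 by simp
    qed simp
    also have "\<dots> = (\<Sum>x\<in>UNIV. chi w x * ((if tr x = 1 then of_nat p else 0) - 1))"
    proof -
      have "tr x - 1 \<in> FP" for x using FP_add[OF tr_FP FP_uminus[OF FP_1]] by simp
      then show ?thesis by (subst sum.swap) (simp add: sum_ep_nonzero flip: sum_distrib_left)
    qed
    also have "\<dots> = (\<Sum>x\<in>UNIV. if tr x = 1 then of_nat p * chi w x else 0) - (\<Sum>x\<in>UNIV. chi w x)"
      unfolding sum_subtractf[symmetric] by (rule sum.cong) (auto simp: algebra_simps)
    also have "\<dots> = of_nat p * (\<Sum>x | tr x = 1. chi w x)"
      using sum_chi[OF rw w1] by (simp add: sum.If_cases sum_distrib_left)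
    finally show ?thesis .
  qed
  have gg: "g * g = - of_nat p"
  proof -
    have bij: "(\<Sum>d\<in>FP - {0}. f d) = (\<Sum>t\<in>FP - {0}. f (c * t))" if "c \<in> FP - {0}" for c and f :: "'a \<Rightarrow> complex"
      by (rule sum.reindex_bij_witness[of _ "\<lambda>t. c * t" "\<lambda>d. d / c"])
         (use that FP_mult FP_divide in auto)
    have zero: "(\<Sum>t\<in>FP - {0}. chi ?z t) = 0"
    proof -
      have "(\<Sum>t\<in>FP - {0}. chi ?z t) = (\<Sum>t\<in>FP - {0}. chi ?z (- 1 * t))"
        by (rule bij) (use FP_1 FP_uminus in auto)
      also have "\<dots> = - (\<Sum>t\<in>FP - {0}. chi ?z t)"
        unfolding chi_mult[OF rz(1)] m1 by (simp add: sum_negf)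
      finally show ?thesis by simp
    qed
    have "g * g = (\<Sum>c\<in>FP - {0}. \<Sum>d\<in>FP - {0}. chi ?z c * ep (- c) * (chi ?z d * ep (- d)))"
      unfolding g_def sum_product ..
    also have "\<dots> = (\<Sum>c\<in>FP - {0}. \<Sum>t\<in>FP - {0}. chi ?z t * ep (c * (- 1 - t)))"
    proof (rule sum.cong)
      fix c assume c: "c \<in> FP - {0}"
      have "(\<Sum>d\<in>FP - {0}. chi ?z c * ep (- c) * (chi ?z d * ep (- d)))
          = (\<Sum>t\<in>FP - {0}. chi ?z c * ep (- c) * (chi ?z (c * t) * ep (- (c * t))))"
        by (rule bij[OF c])
      also have "\<dots> = (\<Sum>t\<in>FP - {0}. chi ?z t * ep (c * (- 1 - t)))"
      proof (rule sum.cong)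
        fix t assume t: "t \<in> FP - {0}"
        have "chi ?z c * ep (- c) * (chi ?z (c * t) * ep (- (c * t)))
          = (chi ?z c * chi ?z c) * chi ?z t * (ep (- c) * ep (- (c * t)))"
          unfolding chi_mult[OF rz(1)] by (simp only: mult_ac)
        also have "\<dots> = chi ?z t * ep (- c + - (c * t))"
          using ep_add[of "- c" "- (c * t)"] sq[OF c] c t by (simp add: FP_uminus FP_mult)
        also have "- c + - (c * t) = c * (- 1 - t)" by (simp add: algebra_simps)
        finally show "chi ?z c * ep (- c) * (chi ?z (c * t) * ep (- (c * t))) = chi ?z t * ep (c * (- 1 - t))" .
      qed simp
      finally show "(\<Sum>d\<in>FP - {0}. chi ?z c * ep (- c) * (chi ?z d * ep (- d)))
          = (\<Sum>t\<in>FP - {0}. chi ?z t * ep (c * (- 1 - t)))" .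
    qed simp
    also have "\<dots> = (\<Sum>t\<in>FP - {0}. chi ?z t * ((if - 1 - t = 0 then of_nat p else 0) - 1))"
    proof -
      have "- 1 - t \<in> FP" if "t \<in> FP - {0}" for t
        using FP_add[of "- 1" "- t"] FP_uminus FP_1 that by auto
      then show ?thesis
        by (subst sum.swap) (simp add: sum_ep_nonzero flip: sum_distrib_left)
    qed
    also have "\<dots> = (\<Sum>t\<in>FP - {0}. if t = - 1 then - of_nat p else 0) - (\<Sum>t\<in>FP - {0}. chi ?z t)"
      unfolding sum_subtractf[symmetric] by (rule sum.cong) (auto simp: algebra_simps m1)
    also have "\<dots> = - of_nat p"
      using zero FP_uminus[OF FP_1] by (simp add: FP_def)
    finally show ?thesis .
  qed
  obtain n :: int where n: "(\<Sum>x | tr x = 1. chi ?z x) + (\<Sum>x | tr x = 1. chi (inverse ?z) x) = of_int (2 * n)"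
    using chi_sum_integral[OF r, of "{x. tr x = 1}"] by (auto simp: tr_frob)
  have "g * (gauss ?z + gauss (inverse ?z)) = of_nat p * of_int (2 * n)"
    unfolding distrib_left using key[of ?z] key[of "inverse ?z"] n by (simp flip: distrib_left)
  then have "(g * (gauss ?z + gauss (inverse ?z)))\<^sup>2 = (of_nat p * of_int (2 * n))\<^sup>2" by simp
  then have "(g * g) * (gauss ?z + gauss (inverse ?z))\<^sup>2 = of_nat p * (of_nat p * (4 * of_int (n\<^sup>2)))"
    by (simp add: power2_eq_square mult_ac)
  then have "of_nat p * (gauss ?z + gauss (inverse ?z))\<^sup>2 = of_nat p * (- (of_nat p * (4 * of_int (n\<^sup>2))))"
    unfolding gg by (simp add: minus_equation_iff)
  then have "(gauss ?z + gauss (inverse ?z))\<^sup>2 = - (of_nat p * (4 * of_int (n\<^sup>2)))"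
    using p_ge3 by (subst (asm) mult_cancel_left) simp
  then show ?thesis by (intro exI[of _ n]) simp
qed

end

section \<open>The quadratic and the octic character\<close>

text \<open>The irrationality of the square root of 2, in the form that refutes a wrong
  sign.\<close>

lemma two_times_square_eq:
  fixes b c :: int
  assumes "b\<^sup>2 = 2 * c\<^sup>2"
  shows "c = 0"
proof (rule ccontr)
  assume c: "c \<noteq> 0"
  then have b: "b \<noteq> 0" using assms by auto
  have p2: "prime_elem (2::int)" by simp
  have "multiplicity 2 (b\<^sup>2) = 2 * multiplicity 2 b"
    using p2 b by (rule prime_elem_multiplicity_power_distrib)
  moreover have "multiplicity 2 (2 * c\<^sup>2) = 1 + 2 * multiplicity 2 c"
    using c p2 by (simp add: prime_elem_multiplicity_mult_distrib prime_elem_multiplicity_power_distrib)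
  ultimately have "2 * multiplicity 2 b = 1 + 2 * multiplicity 2 c" using assms by simp
  then show False by presburger
qed

text \<open>Real plus imaginary part assigns an odd integer to every power of \<open>\<i>\<close>,
  so that sums of such powers can be treated modulo 2.\<close>

lemma i_power_parity: "\<exists>n::int. odd n \<and> Re (\<i> ^ k) + Im (\<i> ^ k) = of_int n"
proof (induction k rule: less_induct)
  case (less k)
  consider "k = 0" | "k = 1" | l where "k = l + 2" by (metis One_nat_def add_2_eq_Suc' not0_implies_Suc)
  then show ?case
  proof cases
    case 1 then show ?thesis by (intro exI[of _ 1]) simp
  next
    case 2 then show ?thesis by (intro exI[of _ 1]) simp
  next
    case 3
    then obtain n :: int where "odd n" "Re (\<i> ^ l) + Im (\<i> ^ l) = of_int n"
      using less[of l] by auto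
    then show ?thesis using 3 by (intro exI[of _ "- n"]) (auto simp: power_add)
  qed
qed

context cyclotomic_field
begin

definition h :: nat where "h = p ^ (s div 2)"

lemma h_sq: "h * h = Q"
proof -
  have "s div 2 + s div 2 = s" using four_dvd_s by (auto elim!: dvdE)
  then show ?thesis by (simp add: h_def Q_def flip: power_add)
qed

lemma h_mod_4: "h mod 4 = 1"
proof -
  obtain t where t: "s = 4 * t" using four_dvd_s by blast
  have "s div 2 = 2 * t" using t by simp
  then have "h = (p\<^sup>2) ^ t" unfolding h_def by (simp flip: power_mult)
  moreover have "[p\<^sup>2 = 1] (mod 8)" using cong_one_power_two_power[OF p_mod, of 1] by simp
  then have "[p\<^sup>2 = 1] (mod 4)" by (rule cong_dvd_modulus_nat) simp
  then have "[(p\<^sup>2) ^ t = 1 ^ t] (mod 4)" by (rule cong_pow)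
  ultimately show ?thesis by (simp add: cong_def)
qed

lemma chi_zr_m1:
  assumes "r \<ge> 1" "2 ^ r dvd L"
  shows "chi (zr r) (- 1) = (if 2 ^ Suc r dvd L then 1 else - 1)"
proof -
  obtain b where b: "L = 2 ^ r * b" using assms by blast
  have "(2::nat) ^ r = 2 * 2 ^ (r - 1)" using assms(1) by (cases r) auto
  then have "L div 2 = 2 ^ (r - 1) * b" using b by simp
  then have "chi (zr r) (- 1) = (- 1) ^ b"
    using chi_m1[OF root_zr[OF assms(2)]] zr_half[of "r - 1"] assms(1) by (simp add: power_mult)
  moreover have "2 ^ Suc r dvd L \<longleftrightarrow> even b" unfolding b by (simp add: mult.commute)
  ultimately show ?thesis by simp
qed

lemma quadratic_gauss_abs: "gauss (- 1) = of_nat h \<or> gauss (- 1) = - of_nat h"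
proof -
  have "2 ^ Suc 1 dvd L" using sixteen_dvd_L by (rule dvd_trans[rotated]) simp
  moreover have "2 ^ 1 dvd L" using sixteen_dvd_L by (rule dvd_trans[rotated]) simp
  moreover have "zr 1 = - 1" using zr_1 by simp
  ultimately have "chi (- 1) (- 1) = 1" using chi_zr_m1[of 1] by (simp only:) simp
  then have "gauss (- 1) * gauss (- 1) = of_nat (h * h)"
    using gauss_inverse[OF root_minus1] h_sq by simp
  then have "(gauss (- 1))\<^sup>2 = (of_nat h)\<^sup>2" by (simp add: power2_eq_square)
  then show ?thesis by (simp add: power2_eq_iff)
qed

lemma root_i: "root \<i>"
  using root_zr[of 2] zr_2 sixteen_dvd_L dvd_trans[of 4 16 L] by simp

lemma gauss_minus_i: "gauss (- \<i>) = gauss \<i>"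
proof -
  have "p = 4 * (p div 4) + 3" using p_mod by presburger
  then have "\<i> ^ p = (\<i> ^ 4) ^ (p div 4) * \<i> ^ 3" by (metis power_add power_mult)
  moreover have "\<i> ^ 4 = 1" "\<i> ^ 3 = - \<i>" by (simp_all add: eval_nat_numeral)
  ultimately have "\<i> ^ p = - \<i>" by simp
  then show ?thesis using gauss_frob[OF root_i] by simp
qed

text \<open>Since \<open>gauss (- \<i>) = gauss \<i>\<close>, the quadratic Gauss sum equals a
  quartic Jacobi sum. Pairing \<open>y\<close> with \<open>- y\<close> writes the latter as
  \<open>1 + 2 * T\<close>, where \<open>T\<close> has an odd number of nonzero terms. The value is
  real, hence 3 modulo 4, whereas \<open>h\<close> is 1 modulo 4.\<close>

lemma quadratic_gauss: "gauss (- 1) = - of_nat h"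
proof -
  note gauss_minus_i
  moreover have "gauss \<i> * gauss (- 1) = jacobi \<i> (- 1) * gauss (- \<i>)"
    using gauss_jacobi[OF root_i root_minus1] by (simp add: complex_eq_iff)
  moreover have i1: "\<i> \<noteq> 1" by (simp add: complex_eq_iff)
  ultimately have J: "gauss (- 1) = jacobi \<i> (- 1)"
    using gauss_nz[OF root_i] by (simp add: mult.commute)
  define f where "f y = chi \<i> (1 - y\<^sup>2)" for y
  obtain N where N: "L = 2 * (8 * N)" using sixteen_dvd_L by (auto elim!: dvdE)
  have Npos: "8 * N > 0" using L_ge N by simp
  have "jacobi \<i> (- 1) = (\<Sum>y\<in>UNIV. f y)"
    using jacobi_quadratic[OF root_i i1] by (simp add: f_def)
  also have "\<dots> = f 0 + (\<Sum>y\<in>UNIV - {0}. f y)" by (rule sum.remove) auto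
  also have "f 0 = 1" using root_i by (simp add: f_def)
  also have "(\<Sum>y\<in>UNIV - {0}. f y) = 2 * (\<Sum>k<8 * N. f (\<gamma> ^ k))"
    unfolding sum_units N
  proof (rule sum_double_period)
    fix k
    have "(\<gamma> ^ (k + 8 * N))\<^sup>2 = (\<gamma> ^ k)\<^sup>2" unfolding power_mult[symmetric] gamma_eq_iff N cong_def
      by (simp add: algebra_simps)
    then show "f (\<gamma> ^ (k + 8 * N)) = f (\<gamma> ^ k)" by (simp only: f_def)
  qed
  \<comment> \<open>At \<open>k = 0\<close> the summand is the character at 0 and drops out; the
    remaining number of terms is odd.\<close>
  also have "(\<Sum>k<8 * N. f (\<gamma> ^ k)) = (\<Sum>k\<in>{1..<8 * N}. f (\<gamma> ^ k))"
  proof (rule sum.mono_neutral_right)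
    show "\<forall>k\<in>{..<8 * N} - {1..<8 * N}. f (\<gamma> ^ k) = 0"
    proof
      fix k assume "k \<in> {..<8 * N} - {1..<8 * N}"
      then have "k = 0" by auto
      then show "f (\<gamma> ^ k) = 0" by (simp add: f_def)
    qed
  qed auto
  finally have e: "jacobi \<i> (- 1) = 1 + 2 * (\<Sum>k\<in>{1..<8 * N}. f (\<gamma> ^ k))" .
  define T where "T = (\<Sum>k\<in>{1..<8 * N}. f (\<gamma> ^ k))"
  have "\<exists>n::int. (\<Sum>k\<in>{1..<8 * N}. Re (f (\<gamma> ^ k)) + Im (f (\<gamma> ^ k))) = of_int n \<and> (odd n \<longleftrightarrow> odd (card {1..<8 * N}))"
  proof (rule sum_odd_integers)
    fix k assume k: "k \<in> {1..<8 * N}"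
    have "(\<gamma> ^ k)\<^sup>2 \<noteq> 1"
    proof
      assume "(\<gamma> ^ k)\<^sup>2 = 1"
      then have "\<gamma> ^ (k * 2) = \<gamma> ^ 0" by (simp add: power_mult)
      then have "[k * 2 = 0] (mod L)" by (simp only: gamma_eq_iff)
      then have "L dvd k * 2" by (simp add: cong_0_iff)
      then show False using k N by (auto dest: dvd_imp_le)
    qed
    then have "f (\<gamma> ^ k) = \<i> ^ dlog (1 - (\<gamma> ^ k)\<^sup>2)" by (simp add: f_def chi_def)
    then show "\<exists>n::int. odd n \<and> Re (f (\<gamma> ^ k)) + Im (f (\<gamma> ^ k)) = of_int n"
      using i_power_parity by simp
  qed simp
  then obtain n :: int where n: "Re T + Im T = of_int n" "odd n"
    using Npos by (auto simp: T_def sum.distrib Re_sum Im_sum)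
  have eT: "gauss (- 1) = 1 + 2 * T" using J e T_def by simp
  have im: "Im T = 0" using quadratic_gauss_abs eT by (auto simp: complex_eq_iff)
  have "gauss (- 1) \<noteq> of_nat h"
  proof
    assume "gauss (- 1) = of_nat h"
    then have "real h = 1 + 2 * of_int n" using eT n im by (simp add: complex_eq_iff)
    then have "int h = 1 + 2 * n" by linarith
    then show False using h_mod_4 n(2) by presburger
  qed
  then show ?thesis using quadratic_gauss_abs by blast
qed

text \<open>The reduction of \<open>K\<close> at one of the two primes of \<open>\<int>[\<surd>-2]\<close> over \<open>p\<close> is, up to sign, a
  binomial coefficient.\<close>

definition K :: complex where "K = jacobi (zr 3) (- 1)"

text \<open>The quadratic character with integer values, which can be mapped into the complex
  numbers (\<open>chi_rho\<close>) and into the finite field (\<open>rho_field\<close>).\<close>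

definition rho :: "'a \<Rightarrow> int" where "rho y = (if y = 0 then 0 else (- 1) ^ dlog y)"

text \<open>Integer coefficients of an octic Jacobi sum with the quadratic character. Inserting a
  complex eighth root of unity gives \<open>K\<close>; inserting one from the finite field gives its
  reduction.\<close>

definition cls :: "nat \<Rightarrow> int" where
  "cls j = (\<Sum>x | x \<noteq> 0 \<and> dlog x mod 8 = j. rho (1 - x))"

lemma chi_rho: "chi (- 1) y = of_int (rho y)"
  by (simp add: chi_def rho_def)

lemma rho_field: "(of_int (rho y) :: 'a) = y ^ (L div 2)"
proof (cases "y = 0")
  case True then show ?thesis using L_ge by (simp add: rho_def power_0_left)
next
  case False
  have "y ^ (L div 2) = (\<gamma> ^ (L div 2)) ^ dlog y"
    using False by (metis gamma_dlog mult.commute power_mult)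
  then show ?thesis using False by (simp add: gamma_half rho_def)
qed

lemma rho_frob: "rho (y ^ p) = rho y"
proof -
  have "complex_of_int (rho (y ^ p)) = of_int (rho y) ^ p"
    using chi_power[OF root_minus1, of y p] by (simp add: chi_rho)
  then have "rho (y ^ p) = rho y ^ p" by (metis of_int_eq_iff of_int_power)
  also have "rho y ^ p = rho y"
  proof -
    have "rho y = 0 \<or> rho y = 1 \<or> rho y = - 1" by (auto simp: rho_def) (metis neg_one_even_power neg_one_odd_power)
    then show ?thesis using odd_p p_ge3 by auto
  qed
  finally show ?thesis .
qed

lemma sum_cls:
  fixes g :: "nat \<Rightarrow> 'b::comm_ring_1"
  shows "(\<Sum>x\<in>UNIV - {0}. g (dlog x mod 8) * of_int (rho (1 - x))) = (\<Sum>j<8. g j * of_int (cls j))"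
proof -
  have "(\<Sum>x\<in>UNIV - {0::'a}. g (dlog x mod 8) * of_int (rho (1 - x))) =
      (\<Sum>j<8. \<Sum>x | x \<in> UNIV - {0} \<and> dlog x mod 8 = j. g (dlog x mod 8) * of_int (rho (1 - x)))"
    by (rule sum.group[symmetric]) auto
  also have "\<dots> = (\<Sum>j<8. g j * of_int (cls j))"
    by (rule sum.cong) (auto simp: cls_def sum_distrib_left intro!: sum.cong)
  finally show ?thesis .
qed

text \<open>Frobenius multiplies \<open>dlog\<close> by \<open>p\<close>, that is by 3 modulo 8, and
  preserves \<open>rho (1 - x)\<close>.\<close>

lemma cls_frob: "j < 8 \<Longrightarrow> cls (3 * j mod 8) = cls j"
proof -
  assume j: "j < 8"
  have d: "dlog (x ^ p) mod 8 = 3 * (dlog x) mod 8" if "x \<noteq> 0" for x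
  proof -
    have "\<gamma> ^ dlog (x ^ p) = \<gamma> ^ (dlog x * p)" using that by (simp add: gamma_dlog power_mult)
    then have "[dlog (x ^ p) = dlog x * p] (mod L)" by (simp only: gamma_eq_iff)
    then have "[dlog (x ^ p) = dlog x * p] (mod 8)"
      using sixteen_dvd_L by (elim cong_dvd_modulus_nat) (auto intro: dvd_trans[of 8 16])
    moreover have "[dlog x * p = dlog x * 3] (mod 8)" using p_mod by (intro cong_mult) (simp_all add: cong_def)
    ultimately show ?thesis by (simp add: cong_def mult.commute)
  qed
  have "surj (\<lambda>x::'a. x ^ p)" using frob_surj by (simp add: surj_def)
  then have inj: "inj (\<lambda>x::'a. x ^ p)" by (simp add: finite_UNIV_surj_inj)
  have img: "(\<lambda>x. x ^ p) ` {x::'a. x \<noteq> 0 \<and> dlog x mod 8 = j} = {x. x \<noteq> 0 \<and> dlog x mod 8 = 3 * j mod 8}"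
  proof (intro equalityI subsetI)
    fix x assume "x \<in> (\<lambda>x. x ^ p) ` {x::'a. x \<noteq> 0 \<and> dlog x mod 8 = j}"
    then obtain y where y: "x = y ^ p" "y \<noteq> 0" "dlog y mod 8 = j" by blast
    then have "dlog x mod 8 = 3 * j mod 8" using d[of y] by (metis mod_mult_right_eq)
    then show "x \<in> {x. x \<noteq> 0 \<and> dlog x mod 8 = 3 * j mod 8}" using y by simp
  next
    fix x assume x: "x \<in> {x::'a. x \<noteq> 0 \<and> dlog x mod 8 = 3 * j mod 8}"
    obtain y where y: "x = y ^ p" using frob_surj by blast
    have "y \<noteq> 0" using x y p_ge3 by (auto simp: power_0_left)
    then have "3 * dlog y mod 8 = 3 * j mod 8" using d[of y] x y by simp
    then have "[3 * dlog y = 3 * j] (mod 8)" by (simp add: cong_def)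
    moreover have "coprime 3 (8::nat)" by code_simp
    ultimately have "[dlog y = j] (mod 8)" using cong_mult_lcancel_nat by blast
    then have "dlog y mod 8 = j" using j by (simp add: cong_def)
    then show "x \<in> (\<lambda>x. x ^ p) ` {x::'a. x \<noteq> 0 \<and> dlog x mod 8 = j}" using y \<open>y \<noteq> 0\<close> by blast
  qed
  have "rho (1 - x ^ p) = rho (1 - x)" for x
  proof -
    have "(1 - x) ^ p = 1 - x ^ p" using frob_add[of 1 "- x" 1] odd_p by simp
    then show ?thesis using rho_frob[of "1 - x"] by simp
  qed
  then show ?thesis unfolding cls_def img[symmetric]
    by (subst sum.reindex) (use inj in \<open>auto intro: inj_on_subset\<close>)
qed

lemma cls_eqs: "cls 3 = cls 1" "cls 7 = cls 5" "cls 6 = cls 2"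
  using cls_frob[of 1] cls_frob[of 5] cls_frob[of 2] by simp_all

lemma sum_lessThan_8: "(\<Sum>j<8. f j) = f 0 + f 1 + f 2 + f 3 + f 4 + f 5 + f 6 + f (7::nat)"
  for f :: "nat \<Rightarrow> 'b::comm_monoid_add"
  by (simp add: eval_nat_numeral ac_simps)

text \<open>Stated for any commutative ring because it is used for the complex value and for its
  reduction; in both, \<open>w + w ^ 3\<close> is a square root of -2.\<close>

lemma eighth_sum:
  fixes w :: "'b::comm_ring_1"
  assumes "w ^ 4 = - 1"
  shows "(\<Sum>j<8. w ^ j * of_int (cls j)) = of_int (cls 0 - cls 4) + of_int (cls 1 - cls 5) * (w + w ^ 3)"
proof -
  have "w ^ 5 = - w" "w ^ 6 = - (w ^ 2)" "w ^ 7 = - (w ^ 3)"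
    using assms power_add[of w 4 1] power_add[of w 4 2] power_add[of w 4 3] by simp_all
  then show ?thesis unfolding sum_lessThan_8 using assms by (simp add: cls_eqs algebra_simps)
qed

lemma K_eq: "K = of_int (cls 0 - cls 4) + of_int (cls 1 - cls 5) * (\<i> * sqrt 2)"
proof -
  have r: "root (zr 3)" using root_zr[of 3] sixteen_dvd_L dvd_trans[of 8 16 L] by simp
  have z4: "zr 3 ^ 4 = - 1" using zr_half[of 2] by simp
  have z8: "zr 3 ^ 8 = 1" using zr_power[of 3] by simp
  have "K = (\<Sum>x\<in>UNIV - {0}. zr 3 ^ (dlog x mod 8) * of_int (rho (1 - x)))"
    unfolding K_def jacobi_def
  proof (rule sum.mono_neutral_cong_right)
    have "zr 3 ^ n = zr 3 ^ (n mod 8)" for n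
      using zr_power_cong[of n "n mod 8" 3] by (simp add: cong_def)
    then show "\<And>x. x \<in> UNIV - {0} \<Longrightarrow> chi (zr 3) x * chi (- 1) (1 - x) = zr 3 ^ (dlog x mod 8) * of_int (rho (1 - x))"
      by (auto simp: chi_rho) (simp add: chi_def)
  qed auto
  then show ?thesis unfolding sum_cls[of "\<lambda>j. zr 3 ^ j"] eighth_sum[OF z4] zr_3 .
qed

lemma power_sum_field:
  assumes "k > 0"
  shows "(\<Sum>x\<in>UNIV. x ^ k :: 'a) = (if L dvd k then - 1 else 0)"
proof -
  have "(\<Sum>x\<in>UNIV. x ^ k :: 'a) = (\<Sum>x\<in>UNIV - {0}. x ^ k)"
    by (rule sum.mono_neutral_right) (use assms in \<open>auto simp: power_0_left\<close>)
  also have "\<dots> = (\<Sum>i<L. (\<gamma> ^ k) ^ i)"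
    unfolding sum_units by (simp add: mult.commute flip: power_mult)
  also have "\<dots> = (if L dvd k then - 1 else 0)"
  proof -
    have "\<gamma> ^ k = 1 \<longleftrightarrow> L dvd k" using gamma_eq_iff[of k 0] by (simp add: cong_0_iff)
    moreover have "(\<gamma> ^ k) ^ L = 1" using unit_power_Q gamma_nz by simp
    moreover have "(of_nat Q :: 'a) = 0" using of_nat_p s_pos by (simp add: Q_def)
    then have "(of_nat L :: 'a) = - 1" unfolding Q_L by (simp add: eq_neg_iff_add_eq_0 add.commute)
    ultimately show ?thesis by (auto simp: sum_gp_strict)
  qed
  finally show ?thesis .
qed

text \<open>The Jacobi sum with both characters replaced by powers inside the field. After the
  binomial expansion only exponents divisible by \<open>L\<close> survive, which leaves the single
  coefficient at \<open>i = N\<close>.\<close>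

lemma binomial_sum_nz:
  assumes N: "L = 8 * N"
  shows "(\<Sum>x\<in>UNIV. x ^ (7 * N) * (1 - x) ^ (4 * N) :: 'a) \<noteq> 0"
proof -
  have N0: "N > 0" using N L_ge by simp
  have e: "x ^ (7 * N) * (1 - x) ^ (4 * N) = (\<Sum>i\<le>4 * N. of_nat (4 * N choose i) * (- 1) ^ i * x ^ (7 * N + i))" for x :: 'a
  proof -
    have "(1 - x) ^ (4 * N) = (- x + 1) ^ (4 * N)" by simp
    also have "\<dots> = (\<Sum>i\<le>4 * N. of_nat (4 * N choose i) * (- x) ^ i)"
      unfolding binomial_ring by simp
    finally show ?thesis
      by (simp add: sum_distrib_left power_minus[of x] power_add mult_ac)
  qed
  have "(\<Sum>x\<in>UNIV. x ^ (7 * N) * (1 - x) ^ (4 * N) :: 'a) =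
      (\<Sum>i\<le>4 * N. of_nat (4 * N choose i) * (- 1) ^ i * (\<Sum>x\<in>UNIV. x ^ (7 * N + i)))"
    unfolding e by (subst sum.swap) (simp add: sum_distrib_left)
  also have "\<dots> = (\<Sum>i\<le>4 * N. if i = N then - (of_nat (4 * N choose N) * (- 1) ^ N) else 0)"
  proof (rule sum.cong)
    fix i assume i: "i \<in> {..4 * N}"
    have "L dvd 7 * N + i \<longleftrightarrow> i = N"
    proof
      assume "L dvd 7 * N + i"
      then obtain c where c: "7 * N + i = 8 * N * c" unfolding N by (rule dvdE)
      have "c < 2"
      proof (rule ccontr)
        assume "\<not> c < 2"
        then have "8 * N * 2 \<le> 8 * N * c" by (intro mult_le_mono2) simp
        then have "8 * N * 2 \<le> 7 * N + i" by (simp only: c)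
        then show False using i N0 by simp
      qed
      moreover have "c \<noteq> 0" using c N0 by (cases c) auto
      ultimately have "c = 1" by simp
      then show "i = N" using c by simp
    qed (use N in simp)
    then show "of_nat (4 * N choose i) * (- 1) ^ i * (\<Sum>x\<in>UNIV. x ^ (7 * N + i)) =
        (if i = N then - (of_nat (4 * N choose N) * (- 1) ^ N) else (0::'a))"
      using power_sum_field[of "7 * N + i"] N0 by simp
  qed simp
  also have "\<dots> = - (of_nat (4 * N choose N) * (- 1) ^ N)" by simp
  finally have *: "(\<Sum>x\<in>UNIV. x ^ (7 * N) * (1 - x) ^ (4 * N) :: 'a) = - (of_nat (4 * N choose N) * (- 1) ^ N)" .
  have "N = (p ^ s - 1) div 8" using N L_def by simp
  then have "\<not> p dvd (4 * N choose N)"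
    using prime_not_dvd_binomial_half[OF prime_p p_mod, of s] four_dvd_s dvd_trans[of 2 4 s] by simp
  then have "(of_nat (4 * N choose N) :: 'a) \<noteq> 0"
    by (simp add: of_nat_eq_0_iff_char_dvd char_field)
  then show ?thesis unfolding * by simp
qed

lemma cls_not_both: "\<not> (int p dvd cls 0 - cls 4 \<and> int p dvd cls 1 - cls 5)"
proof
  assume a: "int p dvd cls 0 - cls 4 \<and> int p dvd cls 1 - cls 5"
  obtain N where N: "L = 8 * N" using sixteen_dvd_L dvd_trans[of 8 16 L] by (auto elim!: dvdE)
  \<comment> \<open>The choice of the prime over \<open>p\<close>: with \<open>\<gamma> ^ N\<close>
    instead, all exponents in the expansion would lie strictly between 0 and \<open>L\<close>, and
    the sum would vanish.\<close>
  define w where "w = \<gamma> ^ (7 * N)"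
  have w4: "w ^ 4 = - 1"
  proof -
    have "w ^ 4 = (\<gamma> ^ (L div 2)) ^ 7" unfolding w_def N by (simp flip: power_mult)
    then show ?thesis by (simp add: gamma_half)
  qed
  have w8: "w ^ 8 = 1" using w4 power_add[of w 4 4] by simp
  have "(\<Sum>x\<in>UNIV. x ^ (7 * N) * (1 - x) ^ (4 * N) :: 'a) = (\<Sum>x\<in>UNIV - {0}. w ^ (dlog x mod 8) * of_int (rho (1 - x)))"
  proof (rule sum.mono_neutral_cong_right)
    fix x :: 'a assume x: "x \<in> UNIV - {0}"
    have "x ^ (7 * N) = w ^ dlog x" using x unfolding w_def
      by (metis DiffD2 gamma_dlog insertI1 mult.commute power_mult)
    also have "\<dots> = w ^ (8 * (dlog x div 8) + dlog x mod 8)" by simp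
    also have "\<dots> = w ^ (dlog x mod 8)" unfolding power_add power_mult w8 by simp
    finally show "x ^ (7 * N) * (1 - x) ^ (4 * N) = w ^ (dlog x mod 8) * of_int (rho (1 - x))"
      by (simp add: rho_field N)
  qed (use N L_ge in \<open>auto simp: power_0_left\<close>)
  also have "\<dots> = of_int (cls 0 - cls 4) + of_int (cls 1 - cls 5) * (w + w ^ 3)"
    unfolding sum_cls[of "\<lambda>j. w ^ j"] eighth_sum[OF w4] ..
  also have "\<dots> = 0"
  proof -
    have "(of_int t :: 'a) = 0" if "int p dvd t" for t
      using that of_nat_p by (auto elim!: dvdE)
    then have "(of_int (cls 0 - cls 4) :: 'a) = 0" "(of_int (cls 1 - cls 5) :: 'a) = 0"
      using a by blast+
    then show ?thesis by (simp only: mult_zero_left add_0_right)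
  qed
  finally show False using binomial_sum_nz[OF N] by blast
qed

section \<open>Evaluation of the Gauss sums\<close>

lemma dvd_L_iff:
  assumes "r \<ge> 3"
  shows "2 ^ r dvd L \<longleftrightarrow> 2 ^ (r - 2) dvd s"
proof -
  have "r - 2 + 2 = r" using assms by simp
  then show ?thesis using two_power_dvd_iff[OF p_mod, of "r - 2" s] assms by (simp only: L_def)
qed

definition G where "G r = gauss (zr r)"
definition G' where "G' r = gauss (inverse (zr r))"

lemma G'_cnj:
  assumes "r \<ge> 1" "2 ^ r dvd L"
  shows "G' r = (if 2 ^ Suc r dvd L then cnj (G r) else - cnj (G r))"
proof -
  have "chi (zr r) (- 1) * cnj (G r) = (chi (zr r) (- 1) * chi (zr r) (- 1)) * G' r"
    unfolding G_def G'_def by (simp add: gauss_cnj root_zr assms)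
  then have "G' r = chi (zr r) (- 1) * cnj (G r)"
    by (simp add: chi_m1_sq root_zr assms)
  then show ?thesis using chi_zr_m1[OF assms] by simp
qed

lemma G_norm:
  assumes "r \<ge> 1" "2 ^ r dvd L"
  shows "G r * cnj (G r) = of_nat Q"
  unfolding G_def using gauss_norm[OF root_zr[OF assms(2)]] zr_neq_1 assms by simp

lemma G_G':
  assumes "r \<ge> 1" "2 ^ r dvd L"
  shows "G r * G' r = (if 2 ^ Suc r dvd L then of_nat Q else - of_nat Q)"
  using G'_cnj[OF assms] G_norm[OF assms] by simp

text \<open>As \<open>- zr 3 = zr 3 ^ 5\<close> lies in the class of the inverse, duplication yields
  \<open>G 3 * G' 3\<close>, which is known, and so evaluates the quartic sum. The Jacobi relation
  with the quadratic character also contains \<open>G' 3\<close>; multiplying it by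
  \<open>G 3\<close> gives the square.\<close>

lemma gauss_quartic: "gauss \<i> = - of_nat h" and G_3_sq: "(G 3)\<^sup>2 = - of_nat h * K"
proof -
  have L3: "2 ^ 3 dvd L" and L4: "2 ^ Suc 3 dvd L"
    using sixteen_dvd_L dvd_trans[of 8 16 L] by simp_all
  have r: "root (zr 3)" using root_zr L3 .
  have z4: "zr 3 ^ 4 = - 1" using zr_half[of 2] by simp
  have sq: "zr 3 ^ 2 = \<i>" using zr_Suc_sq[of 2] zr_2 by simp
  have m: "- zr 3 = zr 3 ^ 5" using z4 power_add[of "zr 3" 4 1] by simp
  have G5: "gauss (- zr 3) = G' 3"
    unfolding m G'_def using invariant_zr(2)[of gauss 3 5, OF gauss_frob] L3 by simp
  have "h \<noteq> 0" using h_sq Q_ge by (cases h) auto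
  then have h0: "(of_nat h :: complex) \<noteq> 0" by simp
  have qq: "(of_nat Q :: complex) = of_nat h * of_nat h" using h_sq by (metis of_nat_mult)
  have "chi (zr 3) 4 = 1" by (rule chi_4[OF r zr_power])
  moreover have "zr 3 ^ 2 \<noteq> 1" unfolding sq by (simp add: complex_eq_iff)
  ultimately have "G 3 * G' 3 = gauss \<i> * - of_nat h"
    using gauss_duplication[OF r] by (simp add: G_def G5 sq quadratic_gauss)
  then have "of_nat h * of_nat h = gauss \<i> * - of_nat h" using G_G'[of 3] L3 L4 qq by simp
  then have "of_nat h * (of_nat h + gauss \<i>) = 0" by (simp add: algebra_simps)
  then show "gauss \<i> = - of_nat h" using h0 by (simp add: add_eq_0_iff)
  have "- zr 3 \<noteq> 1"
  proof
    assume "- zr 3 = 1"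
    then have "zr 3 = - 1" by (simp add: minus_equation_iff)
    then show False using sq by (simp add: complex_eq_iff)
  qed
  then have "G 3 * - of_nat h = K * G' 3"
    using gauss_jacobi[OF r root_minus1] by (simp add: G_def K_def G5 quadratic_gauss)
  then have "G 3 * (G 3 * - of_nat h) = K * (G 3 * G' 3)" by (simp add: mult_ac)
  also have "\<dots> = K * (of_nat h * of_nat h)" using G_G'[of 3] L3 L4 qq by simp
  finally have *: "G 3 * (G 3 * - of_nat h) = K * (of_nat h * of_nat h)" .
  have "of_nat h * ((G 3)\<^sup>2 + of_nat h * K) = K * (of_nat h * of_nat h) - G 3 * (G 3 * - of_nat h)"
    by (simp add: power2_eq_square algebra_simps)
  then have "of_nat h * ((G 3)\<^sup>2 + of_nat h * K) = 0" unfolding * by simp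
  then show "(G 3)\<^sup>2 = - of_nat h * K" using h0 by (simp add: add_eq_0_iff)
qed

text \<open>From order 16 on, \<open>- zr (Suc r)\<close> is the power with exponent
  \<open>1 + 2 ^ r\<close>, which is 1 modulo 8, so the two Gauss sums in the duplication formula
  coincide.\<close>

lemma G_Suc_sq:
  assumes r: "r \<ge> 3" "2 ^ Suc r dvd L"
  shows "(G (Suc r))\<^sup>2 = - of_nat h * G r"
proof -
  let ?z = "zr (Suc r)"
  have z: "root ?z" using root_zr r by blast
  have sq: "?z ^ 2 = zr r" by (rule zr_Suc_sq)
  have 8: "(2::nat) ^ r = 8 * 2 ^ (r - 3)" using r by (simp add: power_eq_if numeral_3_eq_3)
  have "- ?z = ?z ^ (1 + 2 ^ r)" using zr_half[of r] by (simp add: power_add)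
  moreover have "(1 + 2 ^ r) mod 8 = (1::nat)" unfolding 8 by simp
  ultimately have Gm: "gauss (- ?z) = G (Suc r)"
    unfolding G_def using invariant_zr(1)[of gauss "Suc r" "1 + 2 ^ r", OF gauss_frob] r by simp
  have "chi ?z 4 = 1" by (rule chi_4[OF z zr_power])
  moreover have "?z ^ 2 \<noteq> 1" unfolding sq using zr_neq_1 r by simp
  ultimately have "G (Suc r) * G (Suc r) = G r * - of_nat h"
    using gauss_duplication[OF z] Gm by (simp add: G_def sq quadratic_gauss)
  then show ?thesis by (simp add: power2_eq_square)
qed

text \<open>\<open>D r\<close> is the trace \<open>G(\<chi>) + G(\<chi>\<inverse>)\<close> for \<open>\<chi>\<close> of order \<open>2 ^ r\<close>; the value at \<open>r = 2\<close> is
  chosen such that the recursion also holds there.\<close>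

definition D :: "nat \<Rightarrow> complex" where
  "D r = (if r = 2 then K + cnj K else G r + G' r)"

text \<open>The combination that enters the periods when \<open>w\<close> is a primitive eighth root
  of unity: there \<open>w + w ^ 3\<close> is a square root of -2 and multiplies
  \<open>G r - G' r\<close>.\<close>

definition C :: "nat \<Rightarrow> complex" where "C r = \<i> * sqrt 2 * (G r - G' r)"

text \<open>The two squares are replaced by the recursion and its conjugate, and the cross term is
  the known product \<open>G * G'\<close>, whose sign tells whether the field has a further
  level.\<close>

lemma D_step:
  assumes r: "r \<ge> 2" "2 ^ Suc r dvd L"
  shows "(D (Suc r))\<^sup>2 = - of_nat h * D r + (if 2 ^ Suc (Suc r) dvd L then 2 else - 2) * of_nat Q"
proof -
  have L: "2 ^ r dvd L" using r by (rule_tac dvd_trans[of _ "2 ^ Suc r"]) (auto simp: le_imp_power_dvd)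
  define X where "X = (if r = 2 then K else G r)"
  have X: "(G (Suc r))\<^sup>2 = - of_nat h * X"
    using G_3_sq G_Suc_sq[of r] r by (auto simp: X_def numeral_3_eq_3 numeral_2_eq_2)
  have DX: "D r = X + cnj X" using G'_cnj[of r] r L by (simp add: D_def X_def)
  have "(G' (Suc r))\<^sup>2 = (cnj (G (Suc r)))\<^sup>2" using G'_cnj[of "Suc r"] r by simp
  then have X': "(G' (Suc r))\<^sup>2 = - of_nat h * cnj X"
    using X by (metis complex_cnj_minus complex_cnj_mult complex_cnj_of_nat complex_cnj_power)
  have "(D (Suc r))\<^sup>2 = (G (Suc r))\<^sup>2 + (G' (Suc r))\<^sup>2 + 2 * (G (Suc r) * G' (Suc r))"
    using r by (simp add: D_def power2_eq_square algebra_simps)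
  then show ?thesis unfolding X X' DX using G_G'[of "Suc r"] r by (simp add: algebra_simps)
qed

abbreviation n where "n r \<equiv> s div 2 ^ (r - 2)"

definition u where "u = cls 0 - cls 4"
definition v where "v = cls 1 - cls 5"

lemma K_uv: "K = of_int u + of_int v * (\<i> * sqrt 2)" "D 2 = of_int (2 * u)"
  by (simp_all add: K_eq u_def v_def D_def)

text \<open>\<open>G 3\<close> has absolute value \<open>sqrt Q\<close>, and the formula for its
  square transfers this to \<open>K\<close>.\<close>

lemma uv_norm: "u\<^sup>2 + 2 * v\<^sup>2 = int p ^ s"
proof -
  have L3: "2 ^ 3 dvd L" using sixteen_dvd_L dvd_trans[of 8 16 L] by simp
  have N: "G 3 * cnj (G 3) = of_nat Q" using G_norm[of 3] L3 by simp
  have "(of_nat Q)\<^sup>2 = (G 3)\<^sup>2 * cnj ((G 3)\<^sup>2)"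
    by (simp add: N[symmetric] power_mult_distrib)
  also have "\<dots> = of_nat Q * (K * cnj K)"
    unfolding G_3_sq h_sq[symmetric] by simp
  finally have "of_nat Q * of_nat Q = of_nat Q * (K * cnj K)" by (simp only: power2_eq_square)
  moreover have "of_nat Q \<noteq> (0::complex)" using Q_ge by simp
  ultimately have "K * cnj K = of_nat Q" by (simp only: mult_cancel_left) simp
  moreover have "K * cnj K = of_int (u\<^sup>2 + 2 * v\<^sup>2)"
    unfolding K_uv by (simp add: complex_eq_iff power2_eq_square algebra_simps)
  ultimately have "complex_of_int (u\<^sup>2 + 2 * v\<^sup>2) = of_int (int Q)" by simp
  then show ?thesis by (simp only: of_int_eq_iff Q_def of_nat_power)
qed

lemma u_not_dvd: "\<not> int p dvd u"
proof
  assume u: "int p dvd u"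
  have "int p dvd int p ^ s" using s_pos by simp
  then have "int p dvd 2 * v\<^sup>2" using u uv_norm by (metis dvd_add_right_iff dvd_mult2 power2_eq_square)
  moreover have "prime (int p)" using prime_p by simp
  ultimately have "int p dvd v"
    using not_prime_dvd_two_int[OF prime_p odd_p] by (metis prime_dvd_mult_iff power2_eq_square)
  then show False using u cls_not_both unfolding u_def v_def by blast
qed

lemma n_Suc: "r \<ge> 2 \<Longrightarrow> 2 ^ (Suc r - 2) dvd s \<Longrightarrow> n r = 2 * n (Suc r)"
proof -
  assume r: "r \<ge> 2" "2 ^ (Suc r - 2) dvd s"
  have "Suc r - 2 = Suc (r - 2)" using r by simp
  then have e: "(2::nat) ^ (Suc r - 2) = 2 * 2 ^ (r - 2)" by simp
  then show ?thesis using r(2) unfolding e by (auto elim!: dvdE)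
qed

lemma n_pos: "2 ^ (r - 2) dvd s \<Longrightarrow> n r > 0"
  using s_pos by (auto elim!: dvdE)

text \<open>Level 2 comes from the Jacobi sum \<open>K\<close>; every further level halves the
  exponent.\<close>

lemma rep_exists: "r \<ge> 2 \<Longrightarrow> 2 ^ (r - 2) dvd s \<Longrightarrow> \<exists>A B. is_rep p (n r) A B"
proof (induction r rule: dec_induct)
  case base
  then show ?case using is_rep_exists[OF prime_p odd_p uv_norm u_not_dvd] by auto
next
  case (step r)
  have "(2::nat) ^ (r - 2) dvd 2 ^ (Suc r - 2)" by (rule le_imp_power_dvd) simp
  then obtain A B where "is_rep p (n r) A B" using step dvd_trans by blast
  then show ?case
    using is_rep_halve[OF prime_p odd_p, of "n (Suc r)" A B] n_Suc[of r] n_pos[of "Suc r"] step by simp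
qed

end

text \<open>The integers \<open>B r\<close> enter the factorization in pairs of factors with both
  signs, or squared.\<close>

locale cyclotomic_reps = cyclotomic_field +
  fixes A B :: "nat \<Rightarrow> int"
  assumes rep: "\<And>r. r \<ge> 2 \<Longrightarrow> 2 ^ (r - 2) dvd s \<Longrightarrow> is_rep p (n r) (A r) (B r)"
begin

lemma rep_eq: "r \<ge> 2 \<Longrightarrow> 2 ^ (r - 2) dvd s \<Longrightarrow> int p ^ n r = (A r)\<^sup>2 + 2 * (B r)\<^sup>2"
  using rep by (simp add: is_rep_def)

lemma A_odd: "r \<ge> 2 \<Longrightarrow> 2 ^ (r - 2) dvd s \<Longrightarrow> odd (A r)"
proof -
  assume "r \<ge> 2" "2 ^ (r - 2) dvd s"
  then have "[A r = -1] (mod 4)" using rep by (simp add: is_rep_def)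
  then show "odd (A r)" unfolding cong_def by presburger
qed

lemma B_nz: "r \<ge> 2 \<Longrightarrow> 2 ^ (r - 2) dvd s \<Longrightarrow> B r \<noteq> 0"
proof
  assume r: "r \<ge> 2" "2 ^ (r - 2) dvd s" and "B r = 0"
  then have "int p ^ n r = (A r)\<^sup>2" using rep_eq by simp
  moreover have "int p dvd int p ^ n r" using n_pos[OF r(2)] by simp
  ultimately have "int p dvd A r" using prime_p by (metis prime_dvd_power_int prime_int_nat_transfer prime_nat_int_transfer)
  then show False using rep[OF r] by (simp add: is_rep_def)
qed

lemma A_rec: "r \<ge> 2 \<Longrightarrow> 2 ^ (Suc r - 2) dvd s \<Longrightarrow>
  A r = (if even (n (Suc r)) then int p ^ n (Suc r) - 2 * (A (Suc r))\<^sup>2 else 2 * (A (Suc r))\<^sup>2 - int p ^ n (Suc r))"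
proof -
  assume r: "r \<ge> 2" "2 ^ (Suc r - 2) dvd s"
  have "(2::nat) ^ (r - 2) dvd 2 ^ (Suc r - 2)" by (rule le_imp_power_dvd) simp
  then have r': "2 ^ (r - 2) dvd s" using r dvd_trans by blast
  show ?thesis
    using is_rep_double[OF prime_p p_mod n_pos[OF r(2)] rep[of "Suc r"]] rep[of r] n_Suc[OF r] r r' by simp
qed

text \<open>\<open>hh r\<close> is \<open>q\<close> to the power \<open>1/2 - 1/2 ^ (r - 1)\<close>, and \<open>hs r\<close> is its square.\<close>

definition hh :: "nat \<Rightarrow> int" where "hh r = int p ^ (s div 2 - s div 2 ^ (r - 1))"
definition hs :: "nat \<Rightarrow> int" where "hs r = int p ^ (s - s div 2 ^ (r - 2))"

lemma hs_mult: "2 ^ (r - 2) dvd s \<Longrightarrow> hs r * int p ^ n r = int Q"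
  by (simp add: hs_def Q_def flip: power_add)

lemma h_hh: assumes "r \<ge> 2" "2 ^ (Suc r - 2) dvd s" shows "int h * hh r = hs (Suc r)"
proof -
  have e: "Suc r - 2 = r - 1" using assms by simp
  have "even s" using four_dvd_s by (auto dest: dvd_trans[of 2 4])
  moreover have "s div 2 ^ (r - 1) \<le> s div 2 ^ 1" using assms by (intro div_le_mono2 power_increasing) auto
  ultimately have "s div 2 + (s div 2 - s div 2 ^ (r - 1)) = s - s div 2 ^ (r - 1)"
    by (auto elim!: evenE)
  then show ?thesis unfolding hh_def hs_def h_def e by (simp flip: power_add)
qed

lemma hh_sq: assumes "r \<ge> 2" "2 ^ (r - 1) dvd s" shows "(hh r)\<^sup>2 = hs r"
proof -
  obtain t where t: "s = 2 ^ (r - 1) * t" using assms by blast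
  have e: "(2::nat) ^ (r - 1) = 2 * 2 ^ (r - 2)" using assms by (simp add: power_eq_if numeral_2_eq_2)
  have "s div 2 = 2 ^ (r - 2) * t" "s div 2 ^ (r - 1) = t" "s div 2 ^ (r - 2) = 2 * t"
    unfolding t e by (simp_all add: mult.assoc)
  then have "(s div 2 - s div 2 ^ (r - 1)) * 2 = s - s div 2 ^ (r - 2)"
    using t e by (simp add: diff_mult_distrib)
  then show ?thesis unfolding hh_def hs_def power_mult[symmetric] by simp
qed

text \<open>The sign \<open>e\<close> of level \<open>r\<close> is decided and that of level
  \<open>Suc r\<close> left open. With \<open>e = -1\<close>, \<open>D (Suc r)\<close> would be
  \<open>2 * sqrt 2 * hh (Suc r) * B (Suc r)\<close> up to sign, whereas \<open>p - 1\<close> times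
  it is an integer.\<close>

lemma D_even_step:
  assumes r: "r \<ge> 2" "2 ^ r dvd s" and e: "e = 1 \<or> e = - 1"
    and D: "D r = of_int (2 * e * hh r * A r)"
  shows "e = 1 \<and> (D (Suc r) = of_int (2 * hh (Suc r) * A (Suc r)) \<or> D (Suc r) = of_int (2 * (-1) * hh (Suc r) * A (Suc r)))"
proof -
  let ?r = "Suc r"
  have "(2::nat) ^ (?r - 2) dvd 2 ^ r" by (rule le_imp_power_dvd) simp
  then have r1: "2 ^ (?r - 2) dvd s" using r dvd_trans by blast
  have LL: "2 ^ Suc (Suc r) dvd L" using dvd_L_iff[of "Suc (Suc r)"] r by simp
  have L: "2 ^ ?r dvd L" using dvd_L_iff[of ?r] r r1 by simp
  have ev: "even (n ?r)"
  proof -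
    have e': "(2::nat) ^ r = 2 * 2 ^ (?r - 2)" using r by (simp add: power_eq_if numeral_2_eq_2)
    show ?thesis using r(2) unfolding e' by (auto elim!: dvdE)
  qed
  have "(D ?r)\<^sup>2 = of_int (- (int h * (2 * e * hh r * A r)) + 2 * int Q)"
    using D_step[OF r(1) L] LL unfolding D by simp
  also have "- (int h * (2 * e * hh r * A r)) + 2 * int Q = hs ?r * (2 * int p ^ n ?r - 2 * e * A r)"
    unfolding hs_mult[OF r1, symmetric] h_hh[OF r(1) r1, symmetric] by (simp add: algebra_simps)
  finally have sq: "(D ?r)\<^sup>2 = of_int (hs ?r * (2 * int p ^ n ?r - 2 * e * A r))" .
  have hs: "hs ?r = (hh ?r)\<^sup>2" using hh_sq[of ?r] r by simp
  have Ar: "A r = int p ^ n ?r - 2 * (A ?r)\<^sup>2" using A_rec[OF r(1) r1] ev by simp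
  have "e \<noteq> - 1"
  proof
    assume e: "e = - 1"
    have "2 * int p ^ n ?r - 2 * e * A r = 8 * (B ?r)\<^sup>2"
      unfolding e Ar using rep_eq[of ?r] r1 r by simp
    then have D8: "(D ?r)\<^sup>2 = of_int (2 * (2 * hh ?r * B ?r)\<^sup>2)"
      unfolding sq hs by (simp add: power_mult_distrib)
    have "chi (zr ?r) (- 1) = 1" using chi_zr_m1[of ?r] L LL by simp
    then obtain m :: int where m: "of_nat (p - 1) * (gauss (zr ?r) + gauss (inverse (zr ?r))) = of_int (2 * m)"
      using gauss_rational[of ?r] L r by auto
    then have "of_nat (p - 1) * D ?r = of_int (2 * m)" using r by (simp add: D_def G_def G'_def)
    then have "of_int ((2 * m)\<^sup>2) = (of_nat (p - 1))\<^sup>2 * (D ?r)\<^sup>2"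
      by (metis of_int_power power_mult_distrib)
    also have "\<dots> = of_int (2 * (int (p - 1) * (2 * hh ?r * B ?r))\<^sup>2)"
      unfolding D8 by (simp add: power_mult_distrib)
    finally have "(2 * m)\<^sup>2 = 2 * (int (p - 1) * (2 * hh ?r * B ?r))\<^sup>2" by (simp only: of_int_eq_iff)
    then have "int (p - 1) * (2 * hh ?r * B ?r) = 0" by (rule two_times_square_eq)
    then show False using p_ge3 B_nz[of ?r] r1 r by (auto simp: hh_def)
  qed
  then have e1: "e = 1" using e by simp
  have "(D ?r)\<^sup>2 = (of_int (2 * hh ?r * A ?r))\<^sup>2"
    unfolding sq hs e1 Ar by (simp add: power_mult_distrib algebra_simps)
  then show ?thesis using e1 by (auto simp: power2_eq_iff)
qed

text \<open>For odd \<open>n (Suc r)\<close> both \<open>A_rec\<close> and the cross term change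
  sign. Now \<open>D (Suc r)\<close> is imaginary with square \<open>- p\<close> times an integer
  square, and \<open>hs (Suc r)\<close> is \<open>p\<close> times a square because
  \<open>s - n (Suc r)\<close> is odd, so again a factor 2 would be left over for
  \<open>e = -1\<close>.\<close>

lemma D_odd_step:
  assumes r: "r \<ge> 2" "2 ^ (r - 1) dvd s" "\<not> 2 ^ r dvd s" and e: "e = 1 \<or> e = - 1"
    and D: "D r = of_int (2 * e * hh r * A r)"
  shows "e = 1 \<and> (D (Suc r))\<^sup>2 = - of_int (4 * hs (Suc r) * (A (Suc r))\<^sup>2)"
proof -
  let ?r = "Suc r"
  have r1: "2 ^ (?r - 2) dvd s" using r by simp
  have LL: "\<not> 2 ^ Suc (Suc r) dvd L" using dvd_L_iff[of "Suc (Suc r)"] r by simp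
  have L: "2 ^ ?r dvd L" using dvd_L_iff[of ?r] r r1 by simp
  have e': "(2::nat) ^ r = 2 * 2 ^ (?r - 2)" using r by (simp add: power_eq_if numeral_2_eq_2)
  have od: "odd (n ?r)"
    using r(3) r1 unfolding e' by (auto elim!: dvdE)
  have "even s" using four_dvd_s by (auto dest: dvd_trans[of 2 4])
  have "(D ?r)\<^sup>2 = of_int (- (int h * (2 * e * hh r * A r)) - 2 * int Q)"
    using D_step[OF r(1) L] LL unfolding D by simp
  also have "- (int h * (2 * e * hh r * A r)) - 2 * int Q = - (hs ?r * (2 * int p ^ n ?r + 2 * e * A r))"
    unfolding hs_mult[OF r1, symmetric] h_hh[OF r(1) r1, symmetric] by (simp add: algebra_simps)
  finally have sq: "(D ?r)\<^sup>2 = of_int (- (hs ?r * (2 * int p ^ n ?r + 2 * e * A r)))" .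
  have Ar: "A r = 2 * (A ?r)\<^sup>2 - int p ^ n ?r" using A_rec[OF r(1) r1] od by simp
  have "e \<noteq> - 1"
  proof
    assume e: "e = - 1"
    have "2 * int p ^ n ?r + 2 * e * A r = 8 * (B ?r)\<^sup>2"
      unfolding e Ar using rep_eq[of ?r] r1 r by simp
    then have D8: "(D ?r)\<^sup>2 = of_int (- (8 * hs ?r * (B ?r)\<^sup>2))"
      unfolding sq by simp
    have "chi (zr ?r) (- 1) = - 1" using chi_zr_m1[of ?r] L LL by simp
    then obtain m :: int where m: "(gauss (zr ?r) + gauss (inverse (zr ?r)))\<^sup>2 = - of_int (4 * int p * m\<^sup>2)"
      using gauss_irrational[of ?r] L r by auto
    then have "of_int (- (8 * hs ?r * (B ?r)\<^sup>2)) = complex_of_int (- (4 * int p * m\<^sup>2))"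
      using D8 r by (simp add: D_def G_def G'_def)
    then have "- (8 * hs ?r * (B ?r)\<^sup>2) = - (4 * int p * m\<^sup>2)" by (simp only: of_int_eq_iff)
    then have m2: "2 * hs ?r * (B ?r)\<^sup>2 = int p * m\<^sup>2" by simp
    have "odd (s - n ?r)" using od \<open>even s\<close> by (simp add: not_less)
    then obtain w where w: "s - n ?r = 2 * w + 1" by (rule oddE)
    then have "hs ?r = int p * (int p ^ w)\<^sup>2"
      unfolding hs_def by (simp add: power_add mult.commute flip: power_mult)
    then have "int p * (2 * (int p ^ w * B ?r)\<^sup>2) = int p * m\<^sup>2"
      using m2 by (simp add: power_mult_distrib mult_ac)
    then have "m\<^sup>2 = 2 * (int p ^ w * B ?r)\<^sup>2" using p_ge3 by simp
    then have "int p ^ w * B ?r = 0" by (rule two_times_square_eq)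
    then show False using p_ge3 B_nz[of ?r] r1 r by auto
  qed
  then have e1: "e = 1" using e by simp
  show ?thesis unfolding sq e1 Ar by (simp add: algebra_simps)
qed

text \<open>The induction has to carry an unknown sign, because each step settles only the sign of
  the level below.\<close>

lemma D_sign: "r \<ge> 2 \<Longrightarrow> 2 ^ (r - 1) dvd s \<Longrightarrow> \<exists>e. (e = 1 \<or> e = - 1) \<and> D r = of_int (2 * e * hh r * A r)"
proof (induction r rule: dec_induct)
  case base
  have h2: "hh 2 = 1" by (simp add: hh_def)
  obtain A' B' where "is_rep p s A' B'" "u = A' \<or> u = - A'"
    using is_rep_exists[OF prime_p odd_p uv_norm u_not_dvd] by blast
  moreover then have "A' = A 2" using is_rep_unique[OF prime_p odd_p, of s A' B' "A 2" "B 2"] rep[of 2] by simp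
  ultimately have "u = A 2 \<or> u = - A 2" by simp
  then show ?case
  proof
    assume "u = A 2" then show ?thesis using K_uv(2) h2 by (intro exI[of _ 1]) simp
  next
    assume "u = - A 2" then show ?thesis using K_uv(2) h2 by (intro exI[of _ "- 1"]) simp
  qed
next
  case (step r)
  have r: "2 ^ r dvd s" using step by simp
  have "(2::nat) ^ (r - 1) dvd 2 ^ r" by (rule le_imp_power_dvd) simp
  then obtain e where "e = 1 \<or> e = - 1" "D r = of_int (2 * e * hh r * A r)"
    using step r dvd_trans by blast
  from D_even_step[OF _ r this] step show ?case by auto
qed

text \<open>The divisibility ensures that level \<open>Suc r\<close> still exists in the field;
  whether it is the last one or not, it settles the sign at \<open>r\<close>.\<close>

lemma D_eq:
  assumes "r \<ge> 2" "2 ^ (r - 1) dvd s"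
  shows "D r = of_int (2 * hh r * A r)"
proof -
  obtain e where e: "e = 1 \<or> e = - 1" "D r = of_int (2 * e * hh r * A r)"
    using D_sign[OF assms] by blast
  then have "e = 1" using D_even_step[OF assms(1) _ e] D_odd_step[OF assms _ e] by blast
  then show ?thesis using e by simp
qed

lemma D_top:
  assumes "r \<ge> 3" "2 ^ (r - 2) dvd s" "\<not> 2 ^ (r - 1) dvd s"
  shows "(D r)\<^sup>2 = - of_int (4 * hs r * (A r)\<^sup>2)"
proof -
  obtain r' where r': "r = Suc r'" "r' \<ge> 2" using assms by (cases r) auto
  then show ?thesis using D_odd_step[of r' 1] D_eq[of r'] assms by simp
qed

lemma C_sq: "(C r)\<^sup>2 = 8 * (G r * G' r) - 2 * (G r + G' r)\<^sup>2"
proof -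
  have "(\<i> * complex_of_real (sqrt 2))\<^sup>2 = - 2"
    by (simp add: power_mult_distrib flip: of_real_power)
  then have "(C r)\<^sup>2 = - 2 * (G r - G' r)\<^sup>2" unfolding C_def power_mult_distrib by simp
  then show ?thesis by (simp add: power2_eq_square algebra_simps)
qed

text \<open>Sum and product of \<open>G r\<close> and \<open>G' r\<close> are known, hence also the
  square of their difference. Its sign stays open and only exchanges two factors of the
  polynomial.\<close>

lemma C_eq:
  assumes "r \<ge> 3" "2 ^ (r - 1) dvd s"
  shows "C r = of_int (4 * hh r * B r) \<or> C r = - of_int (4 * hh r * B r)"
proof -
  have "(2::nat) ^ (r - 2) dvd 2 ^ (r - 1)" by (rule le_imp_power_dvd) simp
  then have r1: "2 ^ (r - 2) dvd s" using assms dvd_trans by blast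
  have L: "2 ^ r dvd L" using dvd_L_iff r1 assms by simp
  have LL: "2 ^ Suc r dvd L" using dvd_L_iff[of "Suc r"] assms by simp
  have "(C r)\<^sup>2 = 8 * of_nat Q - 2 * (of_int (2 * hh r * A r))\<^sup>2"
    unfolding C_sq using G_G'[of r] D_eq[of r] L LL assms by (simp add: D_def)
  also have "\<dots> = of_int (8 * int Q - 2 * (2 * hh r * A r)\<^sup>2)" by simp
  also have "8 * int Q - 2 * (2 * hh r * A r)\<^sup>2 = (4 * hh r * B r)\<^sup>2"
    unfolding hs_mult[OF r1, symmetric] rep_eq[of r, OF _ r1, simplified] using rep_eq[of r] r1 assms hh_sq[of r]
    by (simp add: power_mult_distrib algebra_simps)
  finally have "(C r)\<^sup>2 = (of_int (4 * hh r * B r))\<^sup>2" by simp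
  then show ?thesis by (simp add: power2_eq_iff)
qed

lemma C_top:
  assumes "r \<ge> 3" "2 ^ (r - 2) dvd s" "\<not> 2 ^ (r - 1) dvd s"
  shows "(C r)\<^sup>2 = - of_int (16 * hs r * (B r)\<^sup>2)"
proof -
  have L: "2 ^ r dvd L" using dvd_L_iff assms by simp
  have LL: "\<not> 2 ^ Suc r dvd L" using dvd_L_iff[of "Suc r"] assms by simp
  have "(C r)\<^sup>2 = - 8 * of_nat Q + 2 * of_int (4 * hs r * (A r)\<^sup>2)"
    unfolding C_sq using G_G'[of r] D_top[of r] L LL assms by (simp add: D_def)
  also have "\<dots> = of_int (- 8 * int Q + 2 * (4 * hs r * (A r)\<^sup>2))" by simp
  also have "- 8 * int Q + 2 * (4 * hs r * (A r)\<^sup>2) = - (16 * hs r * (B r)\<^sup>2)"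
    unfolding hs_mult[OF assms(2), symmetric] using rep_eq[of r] assms
    by (simp add: algebra_simps)
  finally show ?thesis by simp
qed

end

section \<open>The periods\<close>

lemma sum_periodic:
  fixes f :: "nat \<Rightarrow> 'b::comm_semiring_1"
  assumes "\<And>k. f (k + M) = f k"
  shows "(\<Sum>k<2 ^ m * M. f k) = 2 ^ m * (\<Sum>k<M. f k)"
proof (induction m)
  case (Suc m)
  have per: "f (k + c * M) = f k" for k c
  proof (induction c)
    case (Suc c)
    then show ?case using assms[of "k + c * M"] by (simp add: add_ac)
  qed simp
  have "(\<Sum>k<2 * (2 ^ m * M). f k) = 2 * (\<Sum>k<2 ^ m * M. f k)"
    by (rule sum_double_period) (rule per)
  then show ?case using Suc by (simp add: mult.assoc)
qed simp

text \<open>The indices are sorted by their 2-adic valuation \<open>t\<close>, with 0 apart.\<close>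

lemma prod_dyadic:
  fixes f :: "nat \<Rightarrow> 'b::comm_monoid_mult"
  shows "(\<Prod>k<2 ^ m. f k) = f 0 * (\<Prod>t<m. \<Prod>j<2 ^ (m - 1 - t). f (2 ^ t * (2 * j + 1)))"
proof (induction m arbitrary: f)
  case (Suc m)
  have split: "(\<Prod>k<2 * M. f k) = (\<Prod>k<M. f (2 * k)) * (\<Prod>k<M. f (2 * k + 1))" for M
    by (induction M) (simp_all add: mult_ac)
  have "(\<Prod>t<Suc m. \<Prod>j<2 ^ (Suc m - 1 - t). f (2 ^ t * (2 * j + 1))) =
      (\<Prod>j<2 ^ m. f (2 * j + 1)) * (\<Prod>t<m. \<Prod>j<2 ^ (m - 1 - t). f (2 * (2 ^ t * (2 * j + 1))))"
    by (subst prod.lessThan_Suc_shift) (simp add: mult.assoc)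
  then show ?case using Suc[of "\<lambda>k. f (2 * k)"] by (simp add: split mult_ac)
qed simp

lemma prod_blocks_four:
  fixes f :: "nat \<Rightarrow> 'b::comm_monoid_mult"
  assumes "\<And>j. f j = (if j mod 4 < 2 then x else y)"
  shows "(\<Prod>j<4 * M. f j) = (x * y) ^ (2 * M)"
proof (induction M)
  case (Suc M)
  have "4 * Suc M = Suc (Suc (Suc (Suc (4 * M))))" by simp
  then have "(\<Prod>j<4 * Suc M. f j) = (\<Prod>j<4 * M. f j) * f (4 * M) * f (4 * M + 1) * f (4 * M + 2) * f (4 * M + 3)"
    by (simp add: mult_ac eval_nat_numeral)
  moreover have "(4 * M) mod 4 = 0" "(4 * M + 1) mod 4 = 1" "(4 * M + 2) mod 4 = 2" "(4 * M + 3) mod 4 = 3"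
    by presburger+
  ultimately show ?case using Suc assms by (simp add: power_add power2_eq_square mult_ac)
qed simp

lemma zr_power_eq_1_iff: "zr r ^ a = 1 \<longleftrightarrow> 2 ^ r dvd a"
proof
  assume "2 ^ r dvd a"
  then show "zr r ^ a = 1" by (auto simp: power_mult zr_power elim!: dvdE)
next
  assume z: "zr r ^ a = 1"
  show "2 ^ r dvd a"
  proof (rule ccontr)
    assume nd: "\<not> 2 ^ r dvd a"
    then have "a \<noteq> 0" by (metis dvd_0_right)
    then obtain b c where bc: "a = 2 ^ b * c" "odd c"
      by (rule_tac multiplicity_decompose'[of a "2::nat"]) auto
    have br: "b < r" using nd bc by (metis dvd_mult2 le_imp_power_dvd not_le)
    then have "zr r ^ (2 ^ b) = zr (r - b)" using zr_add_power[of "r - b" b] by simp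
    then have "zr (r - b) ^ c = 1" using z bc by (simp add: power_mult)
    then have "zr (r - b) = 1" using power_eq_1_coprime[OF _ zr_power bc(2)] by blast
    then show False using zr_neq_1[of "r - b"] br by simp
  qed
qed

context cyclotomic_field
begin

lemma reduced_period_psi: "reduced_period p s \<gamma> e k = (\<Sum>x\<in>UNIV. psi (\<gamma> ^ k * x ^ e))"
  by (simp add: reduced_period_def psi_def ep_def)

text \<open>The share of the characters of exact order \<open>2 ^ r\<close> in the period with index
  \<open>k\<close>.\<close>

definition S :: "nat \<Rightarrow> nat \<Rightarrow> complex" where
  "S r k = (\<Sum>j<2 ^ (r - 1). (inverse (zr r) ^ k) ^ (2 * j + 1) * gauss (zr r ^ (2 * j + 1)))"

text \<open>Even powers of \<open>zr (Suc m)\<close> belong to level \<open>m\<close>, odd ones form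
  \<open>S (Suc m) k\<close>; the trivial character contributes -1.\<close>

lemma gauss_sum_expand:
  "(\<Sum>j<2 ^ m. (inverse (zr m) ^ k) ^ j * gauss (zr m ^ j)) = - 1 + (\<Sum>r = 1..m. S r k)"
proof (induction m)
  case 0
  have "(\<Sum>x\<in>UNIV. psi x) = psi 0 + (\<Sum>x\<in>UNIV - {0}. psi x)" by (rule sum.remove) auto
  moreover have "(\<Sum>x\<in>UNIV. psi x) = 0" using sum_psi[of 1] by simp
  ultimately have "(\<Sum>x\<in>UNIV - {0}. psi x) = - 1" by (simp add: eq_neg_iff_add_eq_0 add.commute)
  moreover have "gauss 1 = (\<Sum>x\<in>UNIV - {0}. psi x)"
    unfolding gauss_def by (rule sum.mono_neutral_cong_right) (auto simp: chi_def)
  ultimately show ?case by (simp add: zr_0)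
next
  case (Suc m)
  have "(inverse (zr (Suc m)) ^ k) ^ (2 * j) = (inverse (zr m) ^ k) ^ j" for j
  proof -
    have "(inverse (zr (Suc m)) ^ k) ^ (2 * j) = (inverse (zr (Suc m) ^ 2) ^ k) ^ j"
      by (simp add: power_inverse mult_ac flip: power_mult)
    then show ?thesis by (simp only: zr_Suc_sq)
  qed
  moreover have "zr (Suc m) ^ (2 * j) = zr m ^ j" for j
    by (simp only: power_mult zr_Suc_sq)
  ultimately have "(\<Sum>j<2 ^ Suc m. (inverse (zr (Suc m)) ^ k) ^ j * gauss (zr (Suc m) ^ j)) =
      (\<Sum>j<2 ^ m. (inverse (zr m) ^ k) ^ j * gauss (zr m ^ j)) + S (Suc m) k"
    unfolding power_Suc sum_split_parity S_def by simp
  then show ?case using Suc by simp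
qed

text \<open>Fourier inversion: orthogonality of the characters of order dividing
  \<open>2 ^ m\<close> selects the \<open>\<gamma> ^ i\<close> with \<open>i\<close> congruent to
  \<open>k\<close>. The -1 of the trivial character cancels the term of the period at
  \<open>x = 0\<close>.\<close>

lemma reduced_period_eq:
  assumes m: "2 ^ m dvd L" and k: "k < 2 ^ m"
  shows "reduced_period p s \<gamma> (2 ^ m) k = (\<Sum>r = 1..m. S r k)"
proof -
  let ?z = "zr m"
  obtain N where N: "L = 2 ^ m * N" using m by blast
  have rz: "root ?z" using root_zr m by blast
  have *: "(\<Sum>j<2 ^ m. (inverse ?z ^ k * ?z ^ i) ^ j) = (if i mod 2 ^ m = k then 2 ^ m else 0)" for i
  proof -
    have w: "(inverse ?z ^ k * ?z ^ i) ^ (2 ^ m) = 1"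
    proof -
      have "(inverse ?z ^ k * ?z ^ i) ^ (2 ^ m) = inverse (?z ^ (2 ^ m)) ^ k * (?z ^ (2 ^ m)) ^ i"
        by (simp add: power_mult_distrib power_inverse mult.commute flip: power_mult)
      then show ?thesis by (simp add: zr_power)
    qed
    have "inverse ?z ^ k * ?z ^ i = 1 \<longleftrightarrow> i mod 2 ^ m = k"
    proof -
      have "?z ^ i = ?z ^ (i mod 2 ^ m)" using zr_power_cong[of i "i mod 2 ^ m" m] by (simp add: cong_def)
      moreover have "inverse ?z ^ k * ?z ^ i = 1 \<longleftrightarrow> ?z ^ i = ?z ^ k"
        using zr_nz by (auto simp: power_inverse field_simps)
      moreover have "?z ^ a = ?z ^ b \<longleftrightarrow> a = b" if "a \<le> b" "b < 2 ^ m" for a b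
      proof
        assume "?z ^ a = ?z ^ b"
        moreover have "?z ^ b = ?z ^ a * ?z ^ (b - a)" using that by (simp flip: power_add)
        ultimately have "?z ^ (b - a) = 1" using zr_nz by simp
        then have "2 ^ m dvd b - a" by (simp only: zr_power_eq_1_iff)
        then show "a = b" using that by (auto dest!: dvd_imp_le)
      qed simp
      then have "?z ^ a = ?z ^ b \<longleftrightarrow> a = b" if "a < 2 ^ m" "b < 2 ^ m" for a b
        using that by (metis linear)
      ultimately show ?thesis using k by simp
    qed
    then show ?thesis using w by (auto simp: sum_gp_strict)
  qed
  have "- 1 + (\<Sum>r = 1..m. S r k) = (\<Sum>j<2 ^ m. \<Sum>x\<in>UNIV. psi x * ((inverse ?z ^ k) ^ j * chi (?z ^ j) x))"
    unfolding gauss_sum_expand[symmetric] gauss_def sum_distrib_left by (simp add: mult_ac)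
  also have "\<dots> = (\<Sum>x\<in>UNIV. psi x * (\<Sum>j<2 ^ m. (inverse ?z ^ k) ^ j * chi (?z ^ j) x))"
    by (subst sum.swap) (simp add: sum_distrib_left)
  also have "\<dots> = (\<Sum>x\<in>UNIV - {0}. psi x * (\<Sum>j<2 ^ m. (inverse ?z ^ k) ^ j * chi (?z ^ j) x))"
    by (rule sum.mono_neutral_right) auto
  also have "\<dots> = (\<Sum>i<L. psi (\<gamma> ^ i) * (\<Sum>j<2 ^ m. (inverse ?z ^ k * ?z ^ i) ^ j))"
    unfolding sum_units
    by (intro sum.cong arg_cong2[of _ _ _ _ "(*)"] refl)
       (simp add: chi_gamma root_power rz power_mult_distrib mult.commute flip: power_mult)
  also have "\<dots> = (\<Sum>i<L. if i mod 2 ^ m = k then 2 ^ m * psi (\<gamma> ^ i) else 0)"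
    unfolding * by (rule sum.cong) auto
  also have "\<dots> = (\<Sum>i \<in> {i. i < L \<and> i mod 2 ^ m = k}. 2 ^ m * psi (\<gamma> ^ i))"
    by (simp add: sum.If_cases Int_def conj_commute)
  also have "\<dots> = (\<Sum>i<N. 2 ^ m * psi (\<gamma> ^ (k + 2 ^ m * i)))"
  proof (rule sum.reindex_bij_witness[of _ "\<lambda>i. k + 2 ^ m * i" "\<lambda>i. i div 2 ^ m"])
    fix i assume i: "i \<in> {i. i < L \<and> i mod 2 ^ m = k}"
    then show e: "k + 2 ^ m * (i div 2 ^ m) = i" using mod_mult_div_eq[of i "2 ^ m"] by simp
    show "i div 2 ^ m \<in> {..<N}" using i N by (simp add: less_mult_imp_div_less mult.commute)
    show "2 ^ m * psi (\<gamma> ^ (k + 2 ^ m * (i div 2 ^ m))) = 2 ^ m * psi (\<gamma> ^ i)" unfolding e ..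
  next
    fix i assume i: "i \<in> {..<N}"
    show "(k + 2 ^ m * i) div 2 ^ m = i" using k by simp
    have "k + 2 ^ m * i < 2 ^ m * Suc i" using k by simp
    also have "\<dots> \<le> 2 ^ m * N" using i by (intro mult_le_mono2) simp
    finally show "k + 2 ^ m * i \<in> {i. i < L \<and> i mod 2 ^ m = k}" using k N by simp
  qed
  \<comment> \<open>The weight \<open>2 ^ m\<close> is the number of solutions \<open>x\<close> for
    each value of \<open>x ^ (2 ^ m)\<close> on the units.\<close>
  also have "\<dots> = (\<Sum>i<2 ^ m * N. psi (\<gamma> ^ (k + 2 ^ m * i)))"
  proof (subst sum_periodic)
    fix i
    have "\<gamma> ^ (k + 2 ^ m * (i + N)) = \<gamma> ^ (k + 2 ^ m * i)"
      unfolding gamma_eq_iff cong_def N by (simp add: distrib_left flip: add.assoc)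
    then show "psi (\<gamma> ^ (k + 2 ^ m * (i + N))) = psi (\<gamma> ^ (k + 2 ^ m * i))" by simp
  qed (simp add: sum_distrib_left)
  also have "\<dots> = (\<Sum>x\<in>UNIV - {0}. psi (\<gamma> ^ k * x ^ (2 ^ m)))"
    unfolding sum_units N by (simp add: power_add mult.commute flip: power_mult)
  finally have "(\<Sum>x\<in>UNIV - {0}. psi (\<gamma> ^ k * x ^ (2 ^ m))) = - 1 + (\<Sum>r = 1..m. S r k)" by simp
  then show ?thesis unfolding reduced_period_psi
    by (subst sum.remove[of UNIV 0]) (auto simp: power_0_left)
qed

lemma S_1: "S 1 k = - of_nat h * (- 1) ^ k"
  by (simp add: S_def zr_1 quadratic_gauss)

lemma S_2: "S 2 k = (if odd k then 0 else if 4 dvd k then - 2 * of_nat h else 2 * of_nat h)"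
proof -
  let ?w = "inverse \<i> ^ k"
  have i3: "\<i> ^ 3 = - \<i>" by (simp add: eval_nat_numeral)
  have S: "S 2 k = - of_nat h * (?w + ?w ^ 3)"
  proof -
    have two: "(\<Sum>j<(2::nat). f j) = f 0 + f 1" for f :: "nat \<Rightarrow> complex"
      by (simp add: numeral_2_eq_2)
    have "S 2 k = ?w * gauss \<i> + ?w ^ 3 * gauss (\<i> ^ 3)"
      unfolding S_def zr_2 by (simp add: two i3 power3_eq_cube power2_eq_square)
    then show ?thesis unfolding i3 gauss_minus_i by (simp add: gauss_quartic algebra_simps)
  qed
  have w: "?w = (- \<i>) ^ k" by simp
  have w3: "?w ^ 3 = \<i> ^ k"
  proof -
    have "?w ^ 3 = ((- \<i>) ^ 3) ^ k" unfolding w by (simp only: power_mult[symmetric] mult.commute)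
    moreover have "(- \<i>) ^ 3 = \<i>" by (simp add: eval_nat_numeral)
    ultimately show ?thesis by simp
  qed
  have S': "S 2 k = - of_nat h * ((- \<i>) ^ k + \<i> ^ k)" unfolding S w3 unfolding w ..
  show ?thesis
  proof (cases "odd k")
    case True then show ?thesis unfolding S' by simp
  next
    case False
    then obtain l where l: "k = 2 * l" by blast
    have "4 dvd k \<longleftrightarrow> even l" unfolding l by presburger
    then show ?thesis unfolding S' using False l by (simp add: power_mult)
  qed
qed

text \<open>The sign of \<open>w + w ^ 3\<close> relative to \<open>\<i> * sqrt 2\<close> at the odd
  power \<open>2 * j + 1\<close> of \<open>inverse (zr 3)\<close>; the inverse makes the classes 1
  and 3 negative.\<close>

definition sg :: "nat \<Rightarrow> complex" where "sg j = (if j mod 4 < 2 then - 1 else 1)"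

lemma eighth_root_sign: "inverse (zr 3) ^ (2 * j + 1) + (inverse (zr 3) ^ (2 * j + 1)) ^ 3 = sg j * (\<i> * sqrt 2)"
proof -
  let ?w = "inverse (zr 3)"
  have z4: "zr 3 ^ 4 = - 1" using zr_half[of 2] by simp
  have z31: "zr 3 * zr 3 ^ 3 = - 1" using z4 power_add[of "zr 3" 1 3] by simp
  then have w: "?w = - (zr 3 ^ 3)" by (intro inverse_unique) simp
  have w4: "?w ^ 4 = - 1" by (simp add: power_inverse z4)
  have w3: "?w ^ 3 = - zr 3"
    using z31 by (subst power_inverse, intro inverse_unique) (simp add: mult.commute)
  have s: "?w + ?w ^ 3 = - (\<i> * sqrt 2)" unfolding w3 unfolding w zr_3[symmetric] by simp
  have s': "- ?w + - (?w ^ 3) = \<i> * sqrt 2" "- (?w ^ 3) + - ?w = \<i> * sqrt 2"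
    using arg_cong[OF s, of uminus] by (simp_all add: algebra_simps)
  have w8: "?w ^ 8 = 1" using w4 power_add[of ?w 4 4] by simp
  have "?w ^ n = ?w ^ (n mod 8)" for n
  proof -
    have "?w ^ n = ?w ^ (8 * (n div 8) + n mod 8)" by simp
    then show ?thesis unfolding power_add power_mult w8 by simp
  qed
  then have e: "?w ^ (2 * j + 1) = ?w ^ ((2 * j + 1) mod 8)" "(?w ^ (2 * j + 1)) ^ 3 = ?w ^ ((2 * j + 1) * 3 mod 8)"
    by (metis, metis power_mult)
  have w5: "?w ^ 5 = - ?w" "?w ^ 7 = - (?w ^ 3)"
    using power_add[of ?w 4 1] power_add[of ?w 4 3] w4 by simp_all
  consider "j mod 4 = 0" | "j mod 4 = 1" | "j mod 4 = 2" | "j mod 4 = 3" by linarith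
  then show ?thesis
  proof cases
    case 1
    then have "(2 * j + 1) mod 8 = 1" "(2 * j + 1) * 3 mod 8 = 3" by presburger+
    then show ?thesis unfolding e(2) unfolding e(1) sg_def using 1 s by simp
  next
    case 2
    then have "(2 * j + 1) mod 8 = 3" "(2 * j + 1) * 3 mod 8 = 1" by presburger+
    then show ?thesis unfolding e(2) unfolding e(1) sg_def using 2 s by (simp add: add.commute)
  next
    case 3
    then have "(2 * j + 1) mod 8 = 5" "(2 * j + 1) * 3 mod 8 = 7" by presburger+
    then show ?thesis unfolding e(2) unfolding e(1) sg_def w5 using 3 s' w5 by simp
  next
    case 4
    then have "(2 * j + 1) mod 8 = 7" "(2 * j + 1) * 3 mod 8 = 5" by presburger+
    then show ?thesis unfolding e(2) unfolding e(1) sg_def w5 using 4 s' w5 by simp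
  qed
qed

lemma S_zero:
  assumes r: "r \<ge> 3" "2 ^ r dvd L"
  shows "S r 0 = 2 ^ (r - 2) * D r"
proof -
  have e: "2 ^ (r - 2) = (2 * 2 ^ (r - 3) :: complex)"
    using r by (simp add: power_eq_if numeral_3_eq_3 numeral_2_eq_2)
  show ?thesis unfolding S_def gauss_zr_sum[OF r] using r by (simp add: e D_def G_def G'_def algebra_simps)
qed

text \<open>\<open>w\<close> has order \<open>2 ^ (r - t)\<close> for \<open>r \<ge> t\<close>. It
  is 1 for \<open>r \<le> t\<close> and -1 for \<open>r = t + 1\<close>; for
  \<open>r = t + 2\<close> it is a primitive fourth root of unity and \<open>w + w ^ 3\<close>
  vanishes; for \<open>r = t + 3\<close> it is a primitive eighth root, and beyond that the
  geometric sum of the powers of \<open>w ^ 8\<close> is 0.\<close>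

lemma S_eq:
  assumes r: "r \<ge> 3" "2 ^ r dvd L"
  shows "S r (2 ^ t * (2 * j + 1)) = (if r \<le> t then 2 ^ (r - 2) * D r else 0)
     + (if r = t + 1 then - (2 ^ (t - 1) * D (t + 1)) else 0)
     + (if r = t + 3 then sg j * (2 ^ t * C (t + 3)) else 0)"
proof -
  let ?k = "2 ^ t * (2 * j + 1)"
  define w where "w = inverse (zr r) ^ ?k"
  have e: "2 ^ (r - 2) = (2 * 2 ^ (r - 3) :: complex)"
    using r by (simp add: power_eq_if numeral_3_eq_3 numeral_2_eq_2)
  have S: "S r ?k = (\<Sum>i<2 ^ (r - 3). (w ^ 8) ^ i) * ((w + w ^ 3) * G r + (w ^ 5 + w ^ 7) * G' r)"
    unfolding S_def gauss_zr_sum[OF r] w_def G_def G'_def ..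
  have red: "w = inverse (zr (r - t)) ^ (2 * j + 1)" if "t \<le> r"
  proof -
    have "w = (inverse (zr r) ^ (2 ^ t)) ^ (2 * j + 1)" unfolding w_def by (simp only: power_mult)
    also have "inverse (zr r) ^ (2 ^ t) = inverse (zr (r - t))"
      using zr_add_power[of "r - t" t] that by (simp add: power_inverse)
    finally show ?thesis .
  qed
  consider "r \<le> t" | "r = t + 1" | "r = t + 2" | "r = t + 3" | "r > t + 3" by linarith
  then show ?thesis
  proof cases
    case 1
    then have "2 ^ r dvd ?k" by (intro dvd_mult2) (simp add: le_imp_power_dvd)
    then have "w = 1" unfolding w_def by (simp add: power_inverse zr_power_eq_1_iff)
    then show ?thesis unfolding S using 1 r by (simp add: e D_def algebra_simps)
  next
    case 2
    then have "w = - 1" using red zr_1 by simp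
    then have w: "w ^ 8 = 1" "w ^ 3 = - 1" "w ^ 5 = - 1" "w ^ 7 = - 1" by simp_all
    have "r - 2 = t - 1" using 2 by simp
    then have e': "2 ^ (t - 1) = (2 * 2 ^ (r - 3) :: complex)" using e by simp
    show ?thesis unfolding S w \<open>w = - 1\<close> using 2 r e' by (simp add: D_def algebra_simps)
  next
    case 3
    then have w: "w = inverse \<i> ^ (2 * j + 1)" using red zr_2 by simp
    have "w ^ 2 = (inverse \<i> ^ 2) ^ (2 * j + 1)" unfolding w by (simp only: power_mult[symmetric] mult.commute)
    then have w2: "w ^ 2 = - 1" by (simp add: power_inverse)
    have "w ^ 3 = - w" using w2 power_add[of w 2 1] by simp
    moreover have "w ^ 4 = 1" using w2 power_add[of w 2 2] by simp
    then have "w ^ 5 = w" "w ^ 7 = w ^ 3" using power_add[of w 4 1] power_add[of w 4 3] by simp_all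
    ultimately show ?thesis unfolding S using 3 by simp
  next
    case 4
    then have w: "w = inverse (zr 3) ^ (2 * j + 1)" using red by simp
    have z4: "zr 3 ^ 4 = - 1" using zr_half[of 2] by simp
    have "w ^ 4 = (inverse (zr 3) ^ 4) ^ (2 * j + 1)" unfolding w by (simp only: power_mult[symmetric] mult.commute)
    then have w4: "w ^ 4 = - 1" by (simp add: power_inverse z4)
    then have w5: "w ^ 5 = - w" "w ^ 7 = - (w ^ 3)" "w ^ 8 = 1"
      using power_add[of w 4 1] power_add[of w 4 3] power_add[of w 4 4] by simp_all
    have "S r ?k = 2 ^ (r - 3) * ((w + w ^ 3) * (G r - G' r))"
      unfolding S w5 by (simp add: algebra_simps)
    also have "w + w ^ 3 = sg j * (\<i> * sqrt 2)" unfolding w by (rule eighth_root_sign)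
    finally show ?thesis using 4 by (simp add: C_def mult_ac)
  next
    case 5
    have d: "r = (r - 3 - t) + (t + 3)" using 5 by simp
    have "\<not> 2 ^ r dvd ?k * 8"
    proof
      assume "2 ^ r dvd ?k * 8"
      moreover have "(2::nat) ^ (t + 4) dvd 2 ^ r" using 5 by (intro le_imp_power_dvd) simp
      ultimately have "2 ^ (t + 4) dvd ?k * 8" by (rule dvd_trans[rotated])
      then have "2 ^ t * 8 * 2 dvd 2 ^ t * 8 * (2 * j + 1)" by (simp add: power_add mult_ac)
      then have "2 dvd 2 * j + 1" by (subst (asm) dvd_times_left_cancel_iff) simp_all
      then show False by simp
    qed
    moreover have "w ^ 8 = inverse (zr r ^ (?k * 8))" unfolding w_def
      by (simp only: power_mult[symmetric] power_inverse)
    ultimately have w8: "w ^ 8 \<noteq> 1" by (simp add: zr_power_eq_1_iff)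
    have "(w ^ 8) ^ (2 ^ (r - 3)) = 1"
    proof -
      have "8 * 2 ^ (r - 3) = (2::nat) ^ r" using r by (simp add: power_eq_if numeral_3_eq_3)
      then have "(w ^ 8) ^ (2 ^ (r - 3)) = w ^ (2 ^ r)" by (simp flip: power_mult)
      also have "\<dots> = (inverse (zr r) ^ (2 ^ r)) ^ ?k" unfolding w_def by (simp only: power_mult[symmetric] mult.commute)
      finally show ?thesis by (simp add: power_inverse zr_power)
    qed
    then have "(\<Sum>i<2 ^ (r - 3). (w ^ 8) ^ i) = 0" using w8 by (simp add: sum_gp_strict)
    then show ?thesis unfolding S using 5 by simp
  qed
qed

text \<open>The constant is the joint share of orders 2 and 4 at indices divisible by 4; the sum
  collects the levels that do not see the index.\<close>

definition base :: "nat \<Rightarrow> complex" where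
  "base t = - 3 * of_nat h + (\<Sum>r = 3..t. 2 ^ (r - 2) * D r)"

text \<open>For \<open>t < 2\<close> the shares of orders 2 and 4 add up to \<open>h\<close>, and no
  level \<open>r \<ge> 3\<close> reaches the terms with \<open>D\<close>.\<close>

definition centre :: "nat \<Rightarrow> complex" where
  "centre t = (if t < 2 then of_nat h else base t - 2 ^ (t - 1) * D (t + 1))"

lemma dvd_L_less: "2 ^ m dvd L \<Longrightarrow> r \<le> m \<Longrightarrow> 2 ^ r dvd L"
  using le_imp_power_dvd dvd_trans by blast

lemma sum_split_12: "m \<ge> 2 \<Longrightarrow> (\<Sum>r = 1..m. f r) = f 1 + f 2 + (\<Sum>r = 3..m. f r)" for f :: "nat \<Rightarrow> complex"
  by (simp add: sum.atLeast_Suc_atMost numeral_2_eq_2 numeral_3_eq_3 add.assoc)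

lemma period_0:
  assumes m: "m \<ge> 4" "2 ^ m dvd L"
  shows "reduced_period p s \<gamma> (2 ^ m) 0 = base m"
proof -
  have "(\<Sum>r = 3..m. S r 0) = (\<Sum>r = 3..m. 2 ^ (r - 2) * D r)"
    by (rule sum.cong) (use S_zero dvd_L_less m in auto)
  moreover have "reduced_period p s \<gamma> (2 ^ m) 0 = S 1 0 + S 2 0 + (\<Sum>r = 3..m. S r 0)"
    using m by (subst reduced_period_eq[OF m(2)], simp, intro sum_split_12) simp
  ultimately show ?thesis unfolding S_1 S_2 base_def by simp
qed

lemma period_nonzero:
  assumes m: "m \<ge> 4" "2 ^ m dvd L" and t: "t < m" and k: "2 ^ t * (2 * j + 1) < 2 ^ m"
  shows "reduced_period p s \<gamma> (2 ^ m) (2 ^ t * (2 * j + 1)) =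
    centre t + (if t + 3 \<le> m then sg j * (2 ^ t * C (t + 3)) else 0)"
proof -
  let ?k = "2 ^ t * (2 * j + 1)"
  have "(\<Sum>r = 3..m. S r ?k) = (\<Sum>r = 3..m. (if r \<le> t then 2 ^ (r - 2) * D r else 0)
     + (if r = t + 1 then - (2 ^ (t - 1) * D (t + 1)) else 0)
     + (if r = t + 3 then sg j * (2 ^ t * C (t + 3)) else 0))"
    by (rule sum.cong) (use S_eq dvd_L_less m in auto)
  also have "\<dots> = (\<Sum>r = 3..t. 2 ^ (r - 2) * D r) + (if t \<ge> 2 then - (2 ^ (t - 1) * D (t + 1)) else 0)
     + (if t + 3 \<le> m then sg j * (2 ^ t * C (t + 3)) else 0)"
  proof -
    have "{3..m} \<inter> {r. r \<le> t} = {3..t}" using t by auto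
    then have "(\<Sum>r = 3..m. if r \<le> t then 2 ^ (r - 2) * D r else 0) = (\<Sum>r = 3..t. 2 ^ (r - 2) * D r)"
      by (simp add: sum.If_cases)
    moreover have "(\<Sum>r = 3..m. if r = t + 1 then - (2 ^ (t - 1) * D (t + 1)) else 0) =
        (if t \<ge> 2 then - (2 ^ (t - 1) * D (t + 1)) else 0)" using t by auto
    moreover have "(\<Sum>r = 3..m. if r = t + 3 then sg j * (2 ^ t * C (t + 3)) else 0) =
        (if t + 3 \<le> m then sg j * (2 ^ t * C (t + 3)) else 0)" by auto
    ultimately show ?thesis by (simp only: sum.distrib)
  qed
  finally have A: "(\<Sum>r = 3..m. S r ?k) = \<dots>" .
  have B: "S 1 ?k + S 2 ?k = (if t \<ge> 2 then - 3 * of_nat h else of_nat h)"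
  proof -
    consider "t = 0" | "t = 1" | t' where "t = t' + 2" by (metis One_nat_def add_2_eq_Suc' not0_implies_Suc)
    then show ?thesis
    proof cases
      case 1 then show ?thesis unfolding S_1 S_2 by simp
    next
      case 2
      then have "\<not> 4 dvd ?k" by simp presburger
      then show ?thesis unfolding S_1 S_2 using 2 by simp
    next
      case 3 then show ?thesis unfolding S_1 S_2 by (simp add: power_add)
    qed
  qed
  have "reduced_period p s \<gamma> (2 ^ m) ?k = (S 1 ?k + S 2 ?k) + (\<Sum>r = 3..m. S r ?k)"
    unfolding reduced_period_eq[OF m(2) k] using m by (intro sum_split_12) simp
  then show ?thesis unfolding A B by (auto simp: centre_def base_def)
qed

text \<open>Of the \<open>2 ^ (m - 1 - t)\<close> indices of valuation \<open>t\<close>, half have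
  each sign \<open>sg\<close>, which explains the exponents. For \<open>t \<ge> m - 2\<close> there
  is no level \<open>t + 3\<close>, and all these periods coincide.\<close>

lemma period_poly:
  assumes m: "m \<ge> 4" "2 ^ m dvd L"
  shows "reduced_period_poly p s \<gamma> (2 ^ m) = [:- base m, 1:] * [:- centre (m - 1), 1:] * [:- centre (m - 2), 1:]\<^sup>2 *
    (\<Prod>t<m - 2. ([:- (centre t - 2 ^ t * C (t + 3)), 1:] * [:- (centre t + 2 ^ t * C (t + 3)), 1:]) ^ 2 ^ (m - 2 - t))"
proof -
  define F where "F k = [:- reduced_period p s \<gamma> (2 ^ m) k, 1:]" for k
  have lt: "2 ^ t * (2 * j + 1) < 2 ^ m" if "t < m" "j < 2 ^ (m - 1 - t)" for t j :: nat
  proof -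
    have "2 * j + 1 < 2 * 2 ^ (m - 1 - t)" using that by simp
    then have "2 ^ t * (2 * j + 1) < 2 ^ t * (2 * 2 ^ (m - 1 - t))" by (rule mult_less_mono2) simp
    also have "\<dots> = 2 ^ (t + Suc (m - 1 - t))" by (simp only: power_add power_Suc)
    also have "t + Suc (m - 1 - t) = m" using that by simp
    finally show ?thesis .
  qed
  have F0: "F 0 = [:- base m, 1:]" by (simp add: F_def period_0[OF m])
  define P where "P t = (\<Prod>j<2 ^ (m - 1 - t). F (2 ^ t * (2 * j + 1)))" for t
  have last: "F (2 ^ t * (2 * j + 1)) = [:- centre t, 1:]" if "t < m" "t + 3 > m" "j < 2 ^ (m - 1 - t)" for t j
    using period_nonzero[OF m that(1) lt] that by (simp add: F_def)
  have P1: "P (m - 1) = [:- centre (m - 1), 1:]"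
    using last[of "m - 1" 0] m by (simp add: P_def)
  have P2: "P (m - 2) = [:- centre (m - 2), 1:]\<^sup>2"
  proof -
    have "m - 1 - (m - 2) = 1" using m by simp
    then have "P (m - 2) = (\<Prod>j<2::nat. [:- centre (m - 2), 1:])"
      unfolding P_def by (intro prod.cong last) (use m in auto)
    then show ?thesis by simp
  qed
  have P3: "P t = ([:- (centre t - 2 ^ t * C (t + 3)), 1:] * [:- (centre t + 2 ^ t * C (t + 3)), 1:]) ^ 2 ^ (m - 2 - t)"
    if "t < m - 2" for t
  proof -
    define f where "f j = [:- (centre t + sg j * (2 ^ t * C (t + 3))), 1:]" for j
    have e: "(2::nat) ^ (m - 1 - t) = 4 * 2 ^ (m - 3 - t)" "(2::nat) ^ (m - 2 - t) = 2 * 2 ^ (m - 3 - t)"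
    proof -
      have "m - 1 - t = Suc (Suc (m - 3 - t))" "m - 2 - t = Suc (m - 3 - t)" using that by simp_all
      then show "(2::nat) ^ (m - 1 - t) = 4 * 2 ^ (m - 3 - t)" "(2::nat) ^ (m - 2 - t) = 2 * 2 ^ (m - 3 - t)"
        by simp_all
    qed
    have "P t = (\<Prod>j<2 ^ (m - 1 - t). f j)" unfolding P_def
    proof (rule prod.cong)
      fix j :: nat assume "j \<in> {..<2 ^ (m - 1 - t)}"
      then have "2 ^ t * (2 * j + 1) < 2 ^ m" using lt that by simp
      then show "F (2 ^ t * (2 * j + 1)) = f j"
        using period_nonzero[OF m, of t j] that by (simp add: F_def f_def)
    qed simp
    also have "\<dots> = ([:- (centre t - 2 ^ t * C (t + 3)), 1:] * [:- (centre t + 2 ^ t * C (t + 3)), 1:]) ^ (2 * 2 ^ (m - 3 - t))"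
      unfolding e(1) by (rule prod_blocks_four) (simp add: f_def sg_def)
    finally show ?thesis unfolding e(2) .
  qed
  have "reduced_period_poly p s \<gamma> (2 ^ m) = F 0 * (\<Prod>t<m. P t)"
    unfolding reduced_period_poly_def F_def[symmetric] P_def by (rule prod_dyadic)
  also have "(\<Prod>t<m. P t) = (\<Prod>t<Suc (Suc (m - 2)). P t)" using m by (simp add: Suc_diff_Suc numeral_2_eq_2)
  also have "\<dots> = (\<Prod>t<m - 2. P t) * P (m - 2) * P (m - 1)"
  proof -
    have "Suc (m - 2) = m - 1" using m by simp
    then show ?thesis by (subst prod.lessThan_Suc, subst prod.lessThan_Suc) (simp only:)
  qed
  also have "(\<Prod>t<m - 2. P t) = (\<Prod>t<m - 2. ([:- (centre t - 2 ^ t * C (t + 3)), 1:] * [:- (centre t + 2 ^ t * C (t + 3)), 1:]) ^ 2 ^ (m - 2 - t))"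
    by (rule prod.cong) (simp_all add: P3)
  finally show ?thesis unfolding F0 P1 P2 by (simp only: mult_ac)
qed

end

section \<open>The factorization\<close>

lemma irreducible_over_rat_linear: "irreducible_over_rat [:of_int i, 1:]"
  unfolding irreducible_over_rat_def
  by (intro exI[of _ "[:of_int i, 1:]"] conjI irreducible_linear_field_poly) (simp_all add: map_poly_pCons)

text \<open>A square plus a positive number has no rational root, which suffices in degree
  2.\<close>

lemma irreducible_over_rat_quadratic:
  assumes "c > 0"
  shows "irreducible_over_rat ([:of_int i, 1:]\<^sup>2 + [:of_int c:])"
proof -
  define g :: "rat poly" where "g = [:of_int i, 1:]\<^sup>2 + [:of_int c:]"
  have g: "g = [:of_int i * of_int i + of_int c, 2 * of_int i, 1:]"
    by (simp add: g_def power2_eq_square)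
  have nr: "poly g x \<noteq> 0" for x
  proof -
    have "poly g x = (of_int i + x)\<^sup>2 + of_int c" by (simp add: g_def)
    moreover have "(of_int i + x)\<^sup>2 + of_int c > 0" using assms by (intro add_nonneg_pos) simp_all
    ultimately show ?thesis by simp
  qed
  have d: "Polynomial.degree g = 2" unfolding g by simp
  have "irreducible g"
  proof (rule irreducibleI)
    show "g \<noteq> 0" using d by auto
    show "\<not> g dvd 1" using d by (auto simp: is_unit_poly_iff)
    fix a b assume ab: "g = a * b"
    have nz: "a \<noteq> 0" "b \<noteq> 0" using ab \<open>g \<noteq> 0\<close> by auto
    have deg: "Polynomial.degree a + Polynomial.degree b = 2" using d ab nz by (simp add: degree_mult_eq)
    have "Polynomial.degree a \<noteq> 1"
    proof
      assume "Polynomial.degree a = 1"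
      then obtain u v where a: "a = [:u, v:]" "v \<noteq> 0" by (rule degree1_coeffs)
      have "poly g (- u / v) = 0" unfolding ab a(1) using a(2) by simp
      then show False using nr by blast
    qed
    then have "Polynomial.degree a = 0 \<or> Polynomial.degree b = 0" using deg by linarith
    then show "a dvd 1 \<or> b dvd 1" using nz by (auto simp: is_unit_iff_degree)
  qed
  moreover have "map_poly of_rat g = [:of_int i, 1:]\<^sup>2 + [:of_int c:]"
    unfolding g by (simp add: map_poly_pCons of_rat_add of_rat_mult power2_eq_square)
  ultimately show ?thesis unfolding irreducible_over_rat_def by blast
qed

lemma prod_list_concat_pairs:
  fixes g :: "'b \<Rightarrow> 'c::comm_monoid_mult"
  shows "prod_list (map g (concat (map (\<lambda>t. [a t, b t]) [i..<j]))) = (\<Prod>t = i..<j. g (a t) * g (b t))"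
proof -
  have "prod_list (map g (concat (map (\<lambda>t. [a t, b t]) ts))) = prod_list (map (\<lambda>t. g (a t) * g (b t)) ts)" for ts
    by (induction ts) (simp_all add: mult_ac)
  moreover have "prod_list (map f [i..<j]) = (\<Prod>t = i..<j. f t)" for f :: "nat \<Rightarrow> 'c"
    using prod.distinct_set_conv_list[of "[i..<j]" f] by simp
  ultimately show ?thesis by simp
qed

abbreviation cp :: "real poly \<Rightarrow> complex poly" where "cp \<equiv> map_poly complex_of_real"

lemma cp_linear: "cp [:x, 1:] = [:of_real x, 1:]"
  by (simp add: map_poly_pCons)

text \<open>Changing the sign of \<open>b\<close> only swaps the factors, so it is enough to know
  \<open>C\<close> up to sign.\<close>

lemma linear_pair:
  assumes "a = - of_int x" "b = of_int y \<or> b = - of_int y"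
  shows "[:- (a - b), 1:] * [:- (a + b), 1:] = cp [:of_int (x + y), 1:] * cp [:of_int (x - y), 1:]"
  using assms by (auto simp: cp_linear algebra_simps)

lemma quadratic_pair:
  assumes "a = - of_int x" "b\<^sup>2 = - of_int c"
  shows "[:- (a - b), 1:] * [:- (a + b), 1:] = cp ([:of_int x, 1:]\<^sup>2 + [:of_int c:])"
proof -
  have "cp ([:of_int x, 1:]\<^sup>2 + [:of_int c:]) = cp [:of_int x * of_int x + of_int c, 2 * of_int x, 1:]"
    by (simp add: power2_eq_square)
  also have "\<dots> = [:of_int x * of_int x + of_int c, 2 * of_int x, 1:]"
    by (simp add: map_poly_pCons)
  also have "of_int c = - b\<^sup>2" using assms(2) by simp
  finally have "cp ([:of_int x, 1:]\<^sup>2 + [:of_int c:]) = [:of_int x * of_int x + - b\<^sup>2, 2 * of_int x, 1:]" .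
  then show ?thesis unfolding assms(1) by (simp add: power2_eq_square algebra_simps)
qed

section \<open>The integers \<open>A\<close> and \<open>B\<close> are well defined\<close>

context cyclotomic_field
begin

lemma quad_rep_is_rep:
  assumes r: "r \<ge> 2" "2 ^ (r - 2) dvd s"
  shows "is_rep p (n r) (coeff_A p s \<gamma> r) (coeff_B p s \<gamma> r)"
proof -
  define \<tau> where "\<tau> = \<gamma> ^ ((CARD('a) - 1) div 8) + \<gamma> ^ (3 * ((CARD('a) - 1) div 8))"
  obtain N where N: "L = 8 * N" using sixteen_dvd_L dvd_trans[of 8 16 L] by (auto elim!: dvdE)
  have cN: "(CARD('a) - 1) div 8 = N" using card_field N by (simp add: L_def)
  have "(\<gamma> ^ N) ^ 4 = - 1"
    using gamma_half N by (simp add: mult.commute flip: power_mult)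
  moreover have "\<tau> = \<gamma> ^ N + (\<gamma> ^ N) ^ 3" unfolding \<tau>_def cN by (simp add: mult.commute flip: power_mult)
  ultimately have t2: "\<tau>\<^sup>2 = - 2"
  proof -
    assume w4: "(\<gamma> ^ N) ^ 4 = - 1" and t: "\<tau> = \<gamma> ^ N + (\<gamma> ^ N) ^ 3"
    have "\<tau>\<^sup>2 = (\<gamma> ^ N) ^ 2 + 2 * (\<gamma> ^ N) ^ 4 + (\<gamma> ^ N) ^ 4 * (\<gamma> ^ N) ^ 2"
      unfolding t by (simp add: power2_eq_square eval_nat_numeral algebra_simps)
    then show ?thesis unfolding w4 by simp
  qed
  have of_int_0: "(of_int k :: 'a) = 0 \<longleftrightarrow> int p dvd k" for k
  proof
    assume a: "(of_int k :: 'a) = 0"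
    have "k = int (nat \<bar>k\<bar>) \<or> k = - int (nat \<bar>k\<bar>)" by auto
    then have "(of_nat (nat \<bar>k\<bar>) :: 'a) = 0" using a
      by (metis of_int_minus of_int_of_nat_eq neg_equal_0_iff_equal)
    then have "p dvd nat \<bar>k\<bar>" by (simp only: of_nat_eq_0_iff_char_dvd char_field)
    then show "int p dvd k" by simp
  next
    assume "int p dvd k"
    then show "(of_int k :: 'a) = 0" using of_nat_p by (auto elim!: dvdE)
  qed
  obtain A0 B0 where AB: "is_rep p (n r) A0 B0" using rep_exists[OF r] by blast
  \<comment> \<open>As \<open>p\<close> divides the norm and \<open>\<tau>\<close> squares to -2,
    the congruence holds for \<open>B0\<close> or for \<open>- B0\<close>.\<close>
  have "(of_int (2 * B0) :: 'a)\<^sup>2 = (of_int A0 * \<tau>)\<^sup>2"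
  proof -
    have "int p dvd A0\<^sup>2 + 2 * B0\<^sup>2"
      using AB n_pos[OF r(2)] unfolding is_rep_def by (metis dvd_power)
    then have "(of_int (2 * (A0\<^sup>2 + 2 * B0\<^sup>2)) :: 'a) = 0" using of_int_0 by (meson dvd_mult)
    then show ?thesis by (simp add: power_mult_distrib t2 algebra_simps eq_neg_iff_add_eq_0)
  qed
  then have "of_int (2 * B0) = of_int A0 * \<tau> \<or> of_int (2 * B0) = - (of_int A0 * \<tau>)"
    by (simp only: power2_eq_iff)
  then obtain B1 where B1: "is_rep p (n r) A0 B1" "of_int (2 * B1) = of_int A0 * \<tau>"
  proof
    assume "of_int (2 * B0) = of_int A0 * \<tau>"
    then show ?thesis using that AB by blast
  next
    assume "of_int (2 * B0) = - (of_int A0 * \<tau>)"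
    then have "of_int (2 * (- B0)) = of_int A0 * \<tau>" by (simp add: minus_equation_iff)
    then show ?thesis using that AB is_rep_minus by blast
  qed
  have "quad_rep p s \<gamma> r = (A0, B1)"
    unfolding quad_rep_def \<tau>_def[symmetric]
  proof (rule the_equality)
    show "case (A0, B1) of (A, B) \<Rightarrow> int p ^ (s div 2 ^ (r - 2)) = A\<^sup>2 + 2 * B\<^sup>2 \<and> [A = -1] (mod 4) \<and>
        \<not> int p dvd A \<and> (of_int (2 * B) :: 'a) = of_int A * \<tau>"
      using B1 by (simp add: is_rep_def)
  next
    fix x assume x: "case x of (A, B) \<Rightarrow> int p ^ (s div 2 ^ (r - 2)) = A\<^sup>2 + 2 * B\<^sup>2 \<and> [A = -1] (mod 4) \<and>
        \<not> int p dvd A \<and> (of_int (2 * B) :: 'a) = of_int A * \<tau>"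
    obtain A' B' where xe: "x = (A', B')" by (cases x)
    have 2: "is_rep p (n r) A' B'" "of_int (2 * B') = of_int A' * \<tau>"
      using x unfolding xe is_rep_def by simp_all
    have u: "A0 = A' \<and> (B' = B1 \<or> B' = - B1)" using is_rep_unique[OF prime_p odd_p B1(1) 2(1)] .
    \<comment> \<open>If both signs satisfied the congruence, \<open>p\<close> would divide
      \<open>B1\<close> and then \<open>A0\<close>.\<close>
    have "B' = B1"
    proof (rule ccontr)
      assume "B' \<noteq> B1"
      then have "B' = - B1" using u by blast
      then have "(of_int (2 * B1) :: 'a) = - of_int (2 * B1)" using u B1(2) 2(2) by simp
      then have "(of_int (2 * B1 + 2 * B1) :: 'a) = 0" by (simp only: of_int_add) (metis add.right_inverse)
      then have "int p dvd 2 * (2 * B1)" unfolding of_int_0 by simp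
      then have "int p dvd B1" using not_prime_dvd_two_int[OF prime_p odd_p] prime_p
        by (metis prime_dvd_mult_iff prime_nat_int_transfer)
      moreover have "int p dvd int p ^ n r" using n_pos[OF r(2)] by simp
      ultimately have "int p dvd A0\<^sup>2" using B1(1) unfolding is_rep_def
        by (metis dvd_add_left_iff dvd_mult dvd_mult2 power2_eq_square)
      then have "int p dvd A0" using prime_p by (metis prime_dvd_power prime_nat_int_transfer)
      then show False using B1(1) unfolding is_rep_def by blast
    qed
    then show "x = (A0, B1)" using xe u by simp
  qed
  then show ?thesis using B1 unfolding coeff_A_def coeff_B_def by simp
qed

end

section \<open>Fractional powers of \<open>q\<close> as integers, and the three cases\<close>

context cyclotomic_reps
begin

lemma powr_Q:
  assumes "s = k * d" "d > 0"
  shows "real Q powr (real e / real d) = real (p ^ (k * e))"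
proof -
  have "real Q powr (real e / real d) = real p powr (real s * (real e / real d))"
    using p_ge3 by (simp add: Q_def powr_powr flip: powr_realpow)
  also have "real s * (real e / real d) = real (k * e)" using assms by simp
  also have "real p powr real (k * e) = real (p ^ (k * e))" using p_ge3 by (subst powr_realpow) simp_all
  finally show ?thesis .
qed

lemma powr_hh:
  assumes "r \<ge> 2" "2 ^ (r - 1) dvd s"
  shows "real Q powr ((2 ^ (r - 2) - 1) / 2 ^ (r - 1)) = of_int (hh r)"
proof -
  obtain k where k: "s = k * 2 ^ (r - 1)" using assms by (auto elim!: dvdE simp: mult.commute)
  have e: "(2::nat) ^ (r - 1) = 2 * 2 ^ (r - 2)" using assms by (simp add: power_eq_if numeral_2_eq_2)
  have "k * (2 ^ (r - 2) - 1) = s div 2 - s div 2 ^ (r - 1)"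
    using k e by (simp add: diff_mult_distrib2)
  then show ?thesis using powr_Q[OF k, of "2 ^ (r - 2) - 1"] by (simp add: hh_def of_nat_diff)
qed

lemma powr_hs:
  assumes "2 ^ (r - 2) dvd s"
  shows "real Q powr ((2 ^ (r - 2) - 1) / 2 ^ (r - 2)) = of_int (hs r)"
proof -
  obtain k where k: "s = k * 2 ^ (r - 2)" using assms by (auto elim!: dvdE simp: mult.commute)
  have "k * (2 ^ (r - 2) - 1) = s - s div 2 ^ (r - 2)"
    using k by (simp add: diff_mult_distrib2)
  then show ?thesis using powr_Q[OF k, of "2 ^ (r - 2) - 1"] by (simp add: hs_def of_nat_diff)
qed

lemma powr_half: "real Q powr (1 / 2) = of_int (int h)"
proof -
  have "s = (s div 2) * 2" using four_dvd_s dvd_trans[of 2 4 s] by simp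
  from powr_Q[OF this, of 1] show ?thesis by (simp add: h_def)
qed

lemma powr_small:
  shows "real Q powr (1 / 4) = of_int (hh 3)" and "real Q powr (3 / 4) = of_int (hs 4)"
    and "8 dvd s \<Longrightarrow> real Q powr (3 / 8) = of_int (hh 4)"
  using powr_hh[of 3] powr_hs[of 4] powr_hh[of 4] four_dvd_s by simp_all

definition pc :: "nat \<Rightarrow> int" where
  "pc t = 3 * int h - (\<Sum>r = 3..t. 2 ^ (r - 1) * A r * hh r)"

lemma dvd_s_less: "2 ^ k dvd s \<Longrightarrow> j \<le> k \<Longrightarrow> 2 ^ j dvd s"
  using le_imp_power_dvd dvd_trans by blast

lemma partial_const_eq:
  assumes "2 ^ (t - 1) dvd s"
  shows "partial_const (real Q) A t = of_int (pc t)"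
proof -
  have "(\<Sum>r = 3..t. 2 ^ (r - 1) * of_int (A r) * real Q powr ((2 ^ (r - 2) - 1) / 2 ^ (r - 1)))
      = (\<Sum>r = 3..t. 2 ^ (r - 1) * of_int (A r) * of_int (hh r))"
  proof (rule sum.cong)
    fix r assume r: "r \<in> {3..t}"
    then have "r - 1 \<le> t - 1" by auto
    with assms have "2 ^ (r - 1) dvd s" by (rule dvd_s_less)
    then show "2 ^ (r - 1) * of_int (A r) * real Q powr ((2 ^ (r - 2) - 1) / 2 ^ (r - 1))
      = 2 ^ (r - 1) * of_int (A r) * of_int (hh r)" using powr_hh[of r] r by simp
  qed simp
  then show ?thesis unfolding partial_const_def pc_def powr_half by simp
qed

lemma base_eq:
  assumes "2 ^ (t - 1) dvd s"
  shows "base t = - of_int (pc t)"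
proof -
  have "(\<Sum>r = 3..t. 2 ^ (r - 2) * D r) = (\<Sum>r = 3..t. of_int (2 ^ (r - 1) * A r * hh r))"
  proof (rule sum.cong)
    fix r assume r: "r \<in> {3..t}"
    then have "r - 1 \<le> t - 1" by auto
    with assms have "2 ^ (r - 1) dvd s" by (rule dvd_s_less)
    moreover have "(2::complex) ^ (r - 1) = 2 * 2 ^ (r - 2)" using r by (simp add: power_eq_if numeral_2_eq_2)
    ultimately show "2 ^ (r - 2) * D r = of_int (2 ^ (r - 1) * A r * hh r)"
      using D_eq[of r] r by simp
  qed simp
  then show ?thesis unfolding base_def pc_def by simp
qed

text \<open>The integer whose negative is \<open>centre t\<close>, hence the constant term of the
  corresponding factor.\<close>

definition ctr :: "nat \<Rightarrow> int" where
  "ctr t = (if t < 2 then - int h else pc t + 2 ^ t * A (t + 1) * hh (t + 1))"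

lemma centre_eq:
  assumes "2 ^ t dvd s"
  shows "centre t = - of_int (ctr t)"
proof (cases "t < 2")
  case True then show ?thesis by (simp add: centre_def ctr_def)
next
  case False
  have "(2::complex) ^ t = 2 * 2 ^ (t - 1)" using False by (simp add: power_eq_if)
  then show ?thesis using base_eq[of t] D_eq[of "t + 1"] dvd_s_less[OF assms, of "t - 1"] assms False
    by (simp add: centre_def ctr_def algebra_simps)
qed

lemma pair_linear:
  assumes "2 ^ (t + 2) dvd s"
  shows "[:- (centre t - 2 ^ t * C (t + 3)), 1:] * [:- (centre t + 2 ^ t * C (t + 3)), 1:] =
    cp [:of_int (ctr t + 2 ^ (t + 2) * B (t + 3) * hh (t + 3)), 1:] * cp [:of_int (ctr t - 2 ^ (t + 2) * B (t + 3) * hh (t + 3)), 1:]"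
proof (rule linear_pair)
  show "centre t = - of_int (ctr t)" using centre_eq dvd_s_less[OF assms] by simp
  show "2 ^ t * C (t + 3) = of_int (2 ^ (t + 2) * B (t + 3) * hh (t + 3)) \<or>
      2 ^ t * C (t + 3) = - of_int (2 ^ (t + 2) * B (t + 3) * hh (t + 3))"
    using C_eq[of "t + 3"] assms by (auto simp: power_add)
qed

lemma pair_quadratic:
  assumes "2 ^ (t + 1) dvd s" "\<not> 2 ^ (t + 2) dvd s"
  shows "[:- (centre t - 2 ^ t * C (t + 3)), 1:] * [:- (centre t + 2 ^ t * C (t + 3)), 1:] =
    cp ([:of_int (ctr t), 1:]\<^sup>2 + [:of_int (2 ^ (2 * (t + 2)) * (B (t + 3))\<^sup>2 * hs (t + 3)):])"
proof (rule quadratic_pair)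
  show "centre t = - of_int (ctr t)" using centre_eq dvd_s_less[OF assms(1)] by simp
  have "(C (t + 3))\<^sup>2 = - of_int (16 * hs (t + 3) * (B (t + 3))\<^sup>2)"
    using C_top[of "t + 3"] assms by simp
  then show "(2 ^ t * C (t + 3))\<^sup>2 = - of_int (2 ^ (2 * (t + 2)) * (B (t + 3))\<^sup>2 * hs (t + 3))"
    by (simp add: power_mult_distrib power_add power_mult mult.commute flip: power_mult)
qed

text \<open>The periods of index 0 and of valuation \<open>m - 1\<close> are
  \<open>base (m - 1)\<close> plus and minus \<open>2 ^ (m - 2) * D m\<close>. At the top level
  \<open>D m\<close> is purely imaginary, so the two form a conjugate pair.\<close>

lemma top_quadratic:
  assumes m: "m \<ge> 4" "2 ^ (m - 2) dvd s" "\<not> 2 ^ (m - 1) dvd s"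
  shows "[:- base m, 1:] * [:- centre (m - 1), 1:] =
    cp ([:of_int (pc (m - 1)), 1:]\<^sup>2 + [:of_int (2 ^ (2 * (m - 1)) * (A m)\<^sup>2 * hs m):])"
proof -
  have b: "base m = base (m - 1) + 2 ^ (m - 2) * D m"
  proof -
    obtain m' where "m = Suc m'" using m by (cases m) auto
    then show ?thesis using m by (simp add: base_def)
  qed
  have "m - 1 - 1 = m - 2" "m - 1 + 1 = m" using m by simp_all
  moreover have "\<not> m - 1 < 2" using m by linarith
  ultimately have c: "centre (m - 1) = base (m - 1) - 2 ^ (m - 2) * D m"
    unfolding centre_def by (simp only: if_False)
  have "[:- centre (m - 1), 1:] * [:- base m, 1:] = cp ([:of_int (pc (m - 1)), 1:]\<^sup>2 + [:of_int (2 ^ (2 * (m - 1)) * (A m)\<^sup>2 * hs m):])"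
    unfolding b c
  proof (rule quadratic_pair)
    show "base (m - 1) = - of_int (pc (m - 1))" using base_eq[of "m - 1"] m(2) by (simp add: numeral_2_eq_2)
    have "(2::complex) ^ (2 * (m - 1)) = (2 ^ (m - 2))\<^sup>2 * 4"
    proof -
      have "2 * (m - 1) = (m - 2) * 2 + 2" using m by simp
      then show ?thesis by (simp only: power_add power_mult) simp
    qed
    then show "(2 ^ (m - 2) * D m)\<^sup>2 = - of_int (2 ^ (2 * (m - 1)) * (A m)\<^sup>2 * hs m)"
      using D_top[of m] m by (simp add: power_mult_distrib)
  qed
  then show ?thesis by (simp only: mult.commute)
qed

lemma Q_factor_eq:
  assumes "t \<ge> 2" "2 ^ (t + 2) dvd s"
  shows "Q_factor (real Q) A B (of_int e) t = [:of_int (ctr t + e * (2 ^ (t + 2) * B (t + 3) * hh (t + 3))), 1:]"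
proof -
  have "2 ^ (t - 1) dvd s" "2 ^ t dvd s" using dvd_s_less[OF assms(2)] by simp_all
  moreover have "real Q powr ((2 ^ (t - 1) - 1) / 2 ^ t) = of_int (hh (t + 1))"
    using powr_hh[of "t + 1"] assms \<open>2 ^ t dvd s\<close> by simp
  moreover have "real Q powr ((2 ^ (t + 1) - 1) / 2 ^ (t + 2)) = of_int (hh (t + 3))"
    using powr_hh[of "t + 3"] assms by simp
  ultimately show ?thesis
    unfolding Q_factor_def using assms(1) by (simp only: partial_const_eq ctr_def) (simp add: algebra_simps)
qed

lemma prod_Q_factors:
  assumes "\<forall>t\<in>{2..<j}. 2 ^ (t + 2) dvd s"
  shows "(\<Prod>t = 2..<j. ([:- (centre t - 2 ^ t * C (t + 3)), 1:] * [:- (centre t + 2 ^ t * C (t + 3)), 1:]) ^ 2 ^ (m - 2 - t)) =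
    (\<Prod>(f, k)\<leftarrow>concat (map (\<lambda>t. [(Q_factor (real Q) A B 1 t, 2 ^ (m - t - 2)),
        (Q_factor (real Q) A B (-1) t, 2 ^ (m - t - 2))]) [2..<j]). cp f ^ k)"
  unfolding prod_list_concat_pairs
proof (rule prod.cong)
  fix t assume t: "t \<in> {2..<j}"
  have "Q_factor (real Q) A B 1 t = [:of_int (ctr t + 2 ^ (t + 2) * B (t + 3) * hh (t + 3)), 1:]"
    "Q_factor (real Q) A B (-1) t = [:of_int (ctr t - 2 ^ (t + 2) * B (t + 3) * hh (t + 3)), 1:]"
    using Q_factor_eq[of t 1] Q_factor_eq[of t "- 1"] t bspec[OF assms t] by (simp_all only: of_int_1 of_int_minus) simp_all
  moreover have "m - 2 - t = m - t - 2" by simp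
  ultimately show "([:- (centre t - 2 ^ t * C (t + 3)), 1:] * [:- (centre t + 2 ^ t * C (t + 3)), 1:]) ^ 2 ^ (m - 2 - t)
    = (case (Q_factor (real Q) A B 1 t, 2 ^ (m - t - 2)) of (f, k) \<Rightarrow> cp f ^ k) *
      (case (Q_factor (real Q) A B (-1) t, 2 ^ (m - t - 2)) of (f, k) \<Rightarrow> cp f ^ k)"
    using pair_linear[OF bspec[OF assms t]] by (simp only: power_mult_distrib prod.case)
qed simp

lemma Q_factors_irreducible:
  assumes "\<forall>t\<in>{2..<j}. 2 ^ (t + 2) dvd s"
    and "(f, k) \<in> set (concat (map (\<lambda>t. [(Q_factor (real Q) A B 1 t, 2 ^ (m - t - 2)),
        (Q_factor (real Q) A B (-1) t, 2 ^ (m - t - 2))]) [2..<j]))"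
  shows "irreducible_over_rat f"
proof -
  obtain t where t: "t \<in> {2..<j}" "f = Q_factor (real Q) A B (of_int 1) t \<or> f = Q_factor (real Q) A B (of_int (-1)) t"
    using assms(2) by auto
  moreover have "t \<ge> 2" using t by simp
  ultimately show ?thesis using Q_factor_eq[of t] bspec[OF assms(1) t(1)] irreducible_over_rat_linear
    by (elim disjE) (simp_all only:)
qed

lemma hs_pos: "hs r > 0" using p_ge3 by (simp add: hs_def)

lemma ctr_real:
  assumes "t \<ge> 2" "2 ^ t dvd s"
  shows "partial_const (real Q) A t + 2 ^ t * of_int (A (t + 1)) * real Q powr ((2 ^ (t - 1) - 1) / 2 ^ t) = of_int (ctr t)"
proof -
  have "2 ^ (t - 1) dvd s" using assms(2) by (rule dvd_s_less) simp
  moreover have "real Q powr ((2 ^ (t - 1) - 1) / 2 ^ t) = of_int (hh (t + 1))"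
    using powr_hh[of "t + 1"] assms by simp
  ultimately show ?thesis using assms(1) by (simp add: partial_const_eq ctr_def)
qed

lemma small_factors:
  "[:- (real Q powr (1/2)) + 4 * of_int (B 3) * real Q powr (1/4), 1:] = [:of_int (ctr 0 + 2 ^ (0 + 2) * B (0 + 3) * hh (0 + 3)), 1:]"
  "[:- (real Q powr (1/2)) - 4 * of_int (B 3) * real Q powr (1/4), 1:] = [:of_int (ctr 0 - 2 ^ (0 + 2) * B (0 + 3) * hh (0 + 3)), 1:]"
  "8 dvd s \<Longrightarrow> [:- (real Q powr (1/2)) + 8 * of_int (B 4) * real Q powr (3/8), 1:] = [:of_int (ctr 1 + 2 ^ (1 + 2) * B (1 + 3) * hh (1 + 3)), 1:]"
  "8 dvd s \<Longrightarrow> [:- (real Q powr (1/2)) - 8 * of_int (B 4) * real Q powr (3/8), 1:] = [:of_int (ctr 1 - 2 ^ (1 + 2) * B (1 + 3) * hh (1 + 3)), 1:]"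
  unfolding powr_half powr_small by (simp_all add: powr_small ctr_def)

lemma prod_first_two: "j \<ge> 2 \<Longrightarrow> (\<Prod>t<j. f t) = f 0 * f 1 * (\<Prod>t = 2..<j. f t)" for f :: "nat \<Rightarrow> complex poly"
  by (simp add: lessThan_atLeast0 prod.atLeast_Suc_lessThan numeral_2_eq_2 mult.assoc)

lemma pair_linear_01:
  assumes "8 dvd s"
  shows "[:- (centre 0 - 2 ^ 0 * C (0 + 3)), 1:] * [:- (centre 0 + 2 ^ 0 * C (0 + 3)), 1:] =
      cp [:of_int (ctr 0 + 2 ^ (0 + 2) * B (0 + 3) * hh (0 + 3)), 1:] * cp [:of_int (ctr 0 - 2 ^ (0 + 2) * B (0 + 3) * hh (0 + 3)), 1:]"
    and "[:- (centre 1 - 2 ^ 1 * C (1 + 3)), 1:] * [:- (centre 1 + 2 ^ 1 * C (1 + 3)), 1:] =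
      cp [:of_int (ctr 1 + 2 ^ (1 + 2) * B (1 + 3) * hh (1 + 3)), 1:] * cp [:of_int (ctr 1 - 2 ^ (1 + 2) * B (1 + 3) * hh (1 + 3)), 1:]"
  using pair_linear[of 0] pair_linear[of 1] assms dvd_trans[of 4 8 s] by simp_all

lemma factors_append:
  assumes "F = (\<Prod>(f, k)\<leftarrow>xs. cp f ^ k) * (\<Prod>(f, k)\<leftarrow>ys. cp f ^ k)"
    and "\<And>f k. (f, k) \<in> set xs \<Longrightarrow> irreducible_over_rat f"
    and "\<And>f k. (f, k) \<in> set ys \<Longrightarrow> irreducible_over_rat f"
  shows "factors_into_irreducibles F (xs @ ys)"
  unfolding factors_into_irreducibles_def using assms by auto

text \<open>Level \<open>m\<close> is not the top level of the field, so all \<open>D\<close> and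
  \<open>C\<close> that occur are real and every factor is linear.\<close>

lemma factorization_a:
  assumes m: "m \<ge> 4" "2 ^ (m - 1) dvd s"
  shows "factors_into_irreducibles (reduced_period_poly p s \<gamma> (2 ^ m))
        ([([:- (real Q powr (1/2)) + 4 * of_int (B 3) * real Q powr (1/4), 1:], 2 ^ (m - 2)),
          ([:- (real Q powr (1/2)) - 4 * of_int (B 3) * real Q powr (1/4), 1:], 2 ^ (m - 2)),
          ([:- (real Q powr (1/2)) + 8 * of_int (B 4) * real Q powr (3/8), 1:], 2 ^ (m - 3)),
          ([:- (real Q powr (1/2)) - 8 * of_int (B 4) * real Q powr (3/8), 1:], 2 ^ (m - 3)),
          ([:partial_const (real Q) A (m - 2)
             + 2 ^ (m - 2) * of_int (A (m - 1)) * real Q powr ((2 ^ (m - 3) - 1) / 2 ^ (m - 2)), 1:], 2),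
          ([:partial_const (real Q) A (m - 1)
             + 2 ^ (m - 1) * of_int (A m) * real Q powr ((2 ^ (m - 2) - 1) / 2 ^ (m - 1)), 1:], 1),
          ([:partial_const (real Q) A m, 1:], 1)]
         @ concat (map (\<lambda>t. [(Q_factor (real Q) A B 1 t, 2 ^ (m - t - 2)),
                             (Q_factor (real Q) A B (-1) t, 2 ^ (m - t - 2))]) [2..<m - 2]))"
proof -
  have dv: "2 ^ j dvd s" if "j \<le> m - 1" for j using m(2) that by (rule dvd_s_less)
  have d8: "8 dvd s" using dv[of 3] m by simp
  have L: "2 ^ m dvd L" using dvd_L_iff[of m] dv[of "m - 2"] m by simp
  have e5: "partial_const (real Q) A (m - 2) + 2 ^ (m - 2) * of_int (A (m - 1)) * real Q powr ((2 ^ (m - 3) - 1) / 2 ^ (m - 2)) = of_int (ctr (m - 2))"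
  proof -
    have "m - 2 + 1 = m - 1" "m - 2 - 1 = m - 3" using m by simp_all
    then show ?thesis using ctr_real[of "m - 2"] dv[of "m - 2"] m by simp
  qed
  have e6: "partial_const (real Q) A (m - 1) + 2 ^ (m - 1) * of_int (A m) * real Q powr ((2 ^ (m - 2) - 1) / 2 ^ (m - 1)) = of_int (ctr (m - 1))"
  proof -
    have "m - 1 + 1 = m" "m - 1 - 1 = m - 2" using m by simp_all
    then show ?thesis using ctr_real[of "m - 1"] dv[of "m - 1"] m by simp
  qed
  have e7: "partial_const (real Q) A m = of_int (pc m)" using partial_const_eq m by simp
  have c: "[:- base m, 1:] = cp [:of_int (pc m), 1:]" "[:- centre (m - 1), 1:] = cp [:of_int (ctr (m - 1)), 1:]"
    "[:- centre (m - 2), 1:] = cp [:of_int (ctr (m - 2)), 1:]"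
    using base_eq[of m] centre_eq[of "m - 1"] centre_eq[of "m - 2"] dv m by (simp_all add: cp_linear)
  have Qd: "\<forall>t\<in>{2..<m - 2}. 2 ^ (t + 2) dvd s" by (intro ballI dv) auto
  note P01 = pair_linear_01[OF d8]
  have m23: "m - 2 - 0 = m - 2" "m - 2 - 1 = m - 3" "m - 2 \<ge> 2" using m by simp_all
  show ?thesis
    unfolding e5 e6 e7 small_factors(1,2) small_factors(3,4)[OF d8]
  proof (rule factors_append, goal_cases)
    case 1
    show ?case
      unfolding period_poly[OF m(1) L] prod_first_two[OF m23(3)] prod_Q_factors[OF Qd] c m23(1,2)
        P01
      by (simp only: list.map prod_list.Cons prod_list.Nil prod.case power_mult_distrib mult_1_left mult_1_right
          power_one_right mult_ac)
  next
    case (2 f k)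
    then show ?case unfolding list.set insert_iff empty_iff prod.inject
      by (elim disjE conjE FalseE) (simp_all only: irreducible_over_rat_linear)
  next
    case (3 f k)
    then show ?case using Q_factors_irreducible[OF Qd] by blast
  qed
qed

text \<open>Level \<open>m\<close> is the top level. Its \<open>D m\<close> merges the periods of
  index 0 and valuation \<open>m - 1\<close>, and its \<open>C m\<close> those of valuation
  \<open>m - 3\<close>, into quadratic factors; the factors \<open>Q_factor\<close> therefore end
  one step earlier.\<close>

lemma factorization_b:
  assumes m: "m \<ge> 5" "2 ^ (m - 2) dvd s" "\<not> 2 ^ (m - 1) dvd s"
  shows "factors_into_irreducibles (reduced_period_poly p s \<gamma> (2 ^ m))
        ([([:- (real Q powr (1/2)) + 4 * of_int (B 3) * real Q powr (1/4), 1:], 2 ^ (m - 2)),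
          ([:- (real Q powr (1/2)) - 4 * of_int (B 3) * real Q powr (1/4), 1:], 2 ^ (m - 2)),
          ([:- (real Q powr (1/2)) + 8 * of_int (B 4) * real Q powr (3/8), 1:], 2 ^ (m - 3)),
          ([:- (real Q powr (1/2)) - 8 * of_int (B 4) * real Q powr (3/8), 1:], 2 ^ (m - 3)),
          ([:partial_const (real Q) A (m - 2)
             + 2 ^ (m - 2) * of_int (A (m - 1)) * real Q powr ((2 ^ (m - 3) - 1) / 2 ^ (m - 2)), 1:], 2),
          ([:partial_const (real Q) A (m - 1), 1:]\<^sup>2
           + [:2 ^ (2 * (m - 1)) * (of_int (A m))\<^sup>2
               * real Q powr ((2 ^ (m - 2) - 1) / 2 ^ (m - 2)):], 1),
          ([:partial_const (real Q) A (m - 3)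
             + 2 ^ (m - 3) * of_int (A (m - 2)) * real Q powr ((2 ^ (m - 4) - 1) / 2 ^ (m - 3)), 1:]\<^sup>2
           + [:2 ^ (2 * (m - 1)) * (of_int (B m))\<^sup>2
               * real Q powr ((2 ^ (m - 2) - 1) / 2 ^ (m - 2)):], 2)]
         @ concat (map (\<lambda>t. [(Q_factor (real Q) A B 1 t, 2 ^ (m - t - 2)),
                             (Q_factor (real Q) A B (-1) t, 2 ^ (m - t - 2))]) [2..<m - 3]))"
proof -
  have m4: "m \<ge> 4" using m by simp
  have dv: "2 ^ j dvd s" if "j \<le> m - 2" for j using m(2) that by (rule dvd_s_less)
  have d8: "8 dvd s" using dv[of 3] m by simp
  have L: "2 ^ m dvd L" using dvd_L_iff[of m] dv[of "m - 2"] m by simp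
  have e5: "partial_const (real Q) A (m - 2) + 2 ^ (m - 2) * of_int (A (m - 1)) * real Q powr ((2 ^ (m - 3) - 1) / 2 ^ (m - 2)) = of_int (ctr (m - 2))"
  proof -
    have "m - 2 + 1 = m - 1" "m - 2 - 1 = m - 3" using m by simp_all
    then show ?thesis using ctr_real[of "m - 2"] dv[of "m - 2"] m by simp
  qed
  have e6: "partial_const (real Q) A (m - 1) = of_int (pc (m - 1))"
    using m by (intro partial_const_eq dv) simp
  have e7: "partial_const (real Q) A (m - 3) + 2 ^ (m - 3) * of_int (A (m - 2)) * real Q powr ((2 ^ (m - 4) - 1) / 2 ^ (m - 3)) = of_int (ctr (m - 3))"
  proof -
    have "m - 3 + 1 = m - 2" "m - 3 - 1 = m - 4" using m by simp_all
    then show ?thesis using ctr_real[of "m - 3"] dv[of "m - 3"] m by simp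
  qed
  have e8: "2 ^ (2 * (m - 1)) * (of_int c)\<^sup>2 * real Q powr ((2 ^ (m - 2) - 1) / 2 ^ (m - 2)) =
      of_int (2 ^ (2 * (m - 1)) * c\<^sup>2 * hs m)" for c
    using powr_hs[OF m(2)] by simp
  have c: "[:- centre (m - 2), 1:] = cp [:of_int (ctr (m - 2)), 1:]"
    using centre_eq[of "m - 2"] dv m by (simp add: cp_linear)
  have top: "[:- base m, 1:] * [:- centre (m - 1), 1:] =
      cp ([:of_int (pc (m - 1)), 1:]\<^sup>2 + [:of_int (2 ^ (2 * (m - 1)) * (A m)\<^sup>2 * hs m):])"
    using m4 m(2,3) by (rule top_quadratic)
  have Qd: "\<forall>t\<in>{2..<m - 3}. 2 ^ (t + 2) dvd s" by (intro ballI dv) auto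
  note P01 = pair_linear_01[OF d8]
  have ix: "m - 3 + 3 = m" "m - 3 + 2 = m - 1" "m - 3 + 1 = m - 2" "Suc (m - 3) = m - 2" using m by simp_all
  have P3: "[:- (centre (m - 3) - 2 ^ (m - 3) * C m), 1:] * [:- (centre (m - 3) + 2 ^ (m - 3) * C m), 1:] =
      cp ([:of_int (ctr (m - 3)), 1:]\<^sup>2 + [:of_int (2 ^ (2 * (m - 1)) * (B m)\<^sup>2 * hs m):])"
    using pair_quadratic[of "m - 3", unfolded ix] m by blast
  have m23: "m - 2 - 0 = m - 2" "m - 2 - 1 = m - 3" "m - 2 - (m - 3) = 1" "m - 3 \<ge> 2" using m by simp_all
  have split: "(\<Prod>t<m - 2. f t) = (\<Prod>t<m - 3. f t) * f (m - 3)" for f :: "nat \<Rightarrow> complex poly"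
    unfolding ix(4)[symmetric] by simp
  have pos: "(2::int) ^ (2 * (m - 1)) * (A m)\<^sup>2 * hs m > 0" "(2::int) ^ (2 * (m - 1)) * (B m)\<^sup>2 * hs m > 0"
    using hs_pos[of m] A_odd[of m] B_nz[of m] m by (auto intro!: mult_pos_pos)
  show ?thesis
    unfolding e5 e6 e7 e8 small_factors(1,2) small_factors(3,4)[OF d8]
  proof (rule factors_append, goal_cases)
    case 1
    show ?case
      unfolding period_poly[OF m4 L] split prod_first_two[OF m23(4)] prod_Q_factors[OF Qd] c m23(1-3)
        P01 P3 top ix(1)
      by (simp only: list.map prod_list.Cons prod_list.Nil prod.case power_mult_distrib mult_1_left mult_1_right
          power_one_right mult_ac)
  next
    case (2 f k)
    then show ?case unfolding list.set insert_iff empty_iff prod.inject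
      by (elim disjE conjE FalseE)
        (simp_all only: irreducible_over_rat_linear irreducible_over_rat_quadratic pos)
  next
    case (3 f k)
    then show ?case using Q_factors_irreducible[OF Qd] by blast
  qed
qed

text \<open>For \<open>m = 4\<close> the imaginary \<open>C m\<close> belongs to valuation 1, where
  the centre is \<open>h\<close>; hence the pair with \<open>B 4\<close> becomes quadratic and no
  \<open>Q_factor\<close> is left.\<close>

lemma factorization_c:
  assumes s: "\<not> 8 dvd s"
  shows "factors_into_irreducibles (reduced_period_poly p s \<gamma> 16)
         [([:3 * real Q powr (1/2) + 4 * of_int (A 3) * real Q powr (1/4), 1:], 2),
          ([:- (real Q powr (1/2)) + 4 * of_int (B 3) * real Q powr (1/4), 1:], 4),
          ([:- (real Q powr (1/2)) - 4 * of_int (B 3) * real Q powr (1/4), 1:], 4),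
          ([:3 * real Q powr (1/2) - 4 * of_int (A 3) * real Q powr (1/4), 1:]\<^sup>2
           + [:64 * (of_int (A 4))\<^sup>2 * real Q powr (3/4):], 1),
          ([:- (real Q powr (1/2)), 1:]\<^sup>2
           + [:64 * (of_int (B 4))\<^sup>2 * real Q powr (3/4):], 2)]"
proof -
  have L: "2 ^ 4 dvd L" using sixteen_dvd_L by simp
  have P0: "[:- (centre 0 - C 3), 1:] * [:- (centre 0 + C 3), 1:] =
      cp [:of_int (- int h + 4 * B 3 * hh 3), 1:] * cp [:of_int (- int h - 4 * B 3 * hh 3), 1:]"
    using pair_linear[of 0] four_dvd_s by (simp add: ctr_def)
  have P1: "[:- (centre 1 - 2 * C 4), 1:] * [:- (centre 1 + 2 * C 4), 1:] =
      cp ([:of_int (- int h), 1:]\<^sup>2 + [:of_int (64 * (B 4)\<^sup>2 * hs 4):])"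
    using pair_quadratic[of 1] four_dvd_s s by (simp add: ctr_def)
  have top: "[:- base 4, 1:] * [:- centre 3, 1:] =
      cp ([:of_int (3 * int h - 4 * A 3 * hh 3), 1:]\<^sup>2 + [:of_int (64 * (A 4)\<^sup>2 * hs 4):])"
    using top_quadratic[of 4] four_dvd_s s by (simp add: pc_def)
  have c: "[:- centre 2, 1:] = cp [:of_int (3 * int h + 4 * A 3 * hh 3), 1:]"
    using centre_eq[of 2] four_dvd_s by (simp add: cp_linear ctr_def pc_def)
  have P: "reduced_period_poly p s \<gamma> 16 = ([:- base 4, 1:] * [:- centre 3, 1:]) * [:- centre 2, 1:]\<^sup>2 *
    (([:- (centre 0 - C 3), 1:] * [:- (centre 0 + C 3), 1:]) ^ 4 *
     ([:- (centre 1 - 2 * C 4), 1:] * [:- (centre 1 + 2 * C 4), 1:]) ^ 2)"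
  proof -
    have two: "(\<Prod>t<(2::nat). f t) = f 0 * f 1" for f :: "nat \<Rightarrow> complex poly"
      by (simp add: numeral_2_eq_2)
    have n: "2 ^ 4 = (16::nat)" "4 - 1 = (3::nat)" "4 - 2 = (2::nat)" "0 + 3 = (3::nat)" "1 + 3 = (4::nat)"
      "2 - 0 = (2::nat)" "2 - 1 = (1::nat)" "2 ^ 2 = (4::nat)" by simp_all
    show ?thesis
      using period_poly[OF order_refl L] unfolding n two
      by (simp only: power_0 power_one_right mult_1_left)
  qed
  have e: "3 * real Q powr (1/2) + 4 * of_int (A 3) * real Q powr (1/4) = of_int (3 * int h + 4 * A 3 * hh 3)"
    "- (real Q powr (1/2)) + 4 * of_int (B 3) * real Q powr (1/4) = of_int (- int h + 4 * B 3 * hh 3)"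
    "- (real Q powr (1/2)) - 4 * of_int (B 3) * real Q powr (1/4) = of_int (- int h - 4 * B 3 * hh 3)"
    "3 * real Q powr (1/2) - 4 * of_int (A 3) * real Q powr (1/4) = of_int (3 * int h - 4 * A 3 * hh 3)"
    "- (real Q powr (1/2)) = of_int (- int h)"
    "64 * (of_int x)\<^sup>2 * real Q powr (3/4) = of_int (64 * x\<^sup>2 * hs 4)" for x
    unfolding powr_half powr_small by simp_all
  have pos: "64 * (A 4)\<^sup>2 * hs 4 > 0" "64 * (B 4)\<^sup>2 * hs 4 > 0"
    using hs_pos[of 4] A_odd[of 4] B_nz[of 4] four_dvd_s by (auto intro!: mult_pos_pos)
  show ?thesis
    unfolding e(1-4) e(6) unfolding e(5)
  proof (rule factors_append[where ys = "[]", unfolded append_Nil2], goal_cases)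
    case 1
    show ?case unfolding P P0 P1 top c
      by (simp only: list.map prod_list.Cons prod_list.Nil prod.case
        power_mult_distrib mult_1_left mult_1_right power_one_right mult_ac)
  next
    case (2 f k)
    then show ?case unfolding list.set insert_iff empty_iff prod.inject
      by (elim disjE conjE FalseE)
        (simp_all only: irreducible_over_rat_linear irreducible_over_rat_quadratic pos)
  qed simp
qed

end

theorem theorem1:
  fixes \<gamma> :: "'a::finite_field" and p s m :: nat and q :: real and A B :: "nat \<Rightarrow> int"
  assumes "prime p" and "[p = 3] (mod 8)"
    and "CARD('a) = p ^ s"
    and "generates_units \<gamma>"
    and "m \<ge> 4" and "2 ^ m dvd CARD('a) - 1"
    and "q = real CARD('a)" and "A = coeff_A p s \<gamma>" and "B = coeff_B p s \<gamma>"
  shows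
    "(2 ^ (m - 1) dvd s \<longrightarrow>
       factors_into_irreducibles (reduced_period_poly p s \<gamma> (2 ^ m))
        ([([:- (q powr (1/2)) + 4 * of_int (B 3) * q powr (1/4), 1:], 2 ^ (m - 2)),
          ([:- (q powr (1/2)) - 4 * of_int (B 3) * q powr (1/4), 1:], 2 ^ (m - 2)),
          ([:- (q powr (1/2)) + 8 * of_int (B 4) * q powr (3/8), 1:], 2 ^ (m - 3)),
          ([:- (q powr (1/2)) - 8 * of_int (B 4) * q powr (3/8), 1:], 2 ^ (m - 3)),
          ([:partial_const q A (m - 2)
             + 2 ^ (m - 2) * of_int (A (m - 1)) * q powr ((2 ^ (m - 3) - 1) / 2 ^ (m - 2)), 1:], 2),
          ([:partial_const q A (m - 1)
             + 2 ^ (m - 1) * of_int (A m) * q powr ((2 ^ (m - 2) - 1) / 2 ^ (m - 1)), 1:], 1),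
          ([:partial_const q A m, 1:], 1)]
         @ concat (map (\<lambda>t. [(Q_factor q A B 1 t, 2 ^ (m - t - 2)),
                             (Q_factor q A B (-1) t, 2 ^ (m - t - 2))]) [2..<m - 2])))
     \<and>
     (2 ^ (m - 2) dvd s \<and> \<not> 2 ^ (m - 1) dvd s \<and> m \<ge> 5 \<longrightarrow>
       factors_into_irreducibles (reduced_period_poly p s \<gamma> (2 ^ m))
        ([([:- (q powr (1/2)) + 4 * of_int (B 3) * q powr (1/4), 1:], 2 ^ (m - 2)),
          ([:- (q powr (1/2)) - 4 * of_int (B 3) * q powr (1/4), 1:], 2 ^ (m - 2)),
          ([:- (q powr (1/2)) + 8 * of_int (B 4) * q powr (3/8), 1:], 2 ^ (m - 3)),
          ([:- (q powr (1/2)) - 8 * of_int (B 4) * q powr (3/8), 1:], 2 ^ (m - 3)),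
          ([:partial_const q A (m - 2)
             + 2 ^ (m - 2) * of_int (A (m - 1)) * q powr ((2 ^ (m - 3) - 1) / 2 ^ (m - 2)), 1:], 2),
          ([:partial_const q A (m - 1), 1:]\<^sup>2
           + [:2 ^ (2 * (m - 1)) * (of_int (A m))\<^sup>2
               * q powr ((2 ^ (m - 2) - 1) / 2 ^ (m - 2)):], 1),
          ([:partial_const q A (m - 3)
             + 2 ^ (m - 3) * of_int (A (m - 2)) * q powr ((2 ^ (m - 4) - 1) / 2 ^ (m - 3)), 1:]\<^sup>2
           + [:2 ^ (2 * (m - 1)) * (of_int (B m))\<^sup>2
               * q powr ((2 ^ (m - 2) - 1) / 2 ^ (m - 2)):], 2)]
         @ concat (map (\<lambda>t. [(Q_factor q A B 1 t, 2 ^ (m - t - 2)),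
                             (Q_factor q A B (-1) t, 2 ^ (m - t - 2))]) [2..<m - 3])))
     \<and>
     (4 dvd s \<and> \<not> 8 dvd s \<and> m = 4 \<longrightarrow>
       factors_into_irreducibles (reduced_period_poly p s \<gamma> 16)
         [([:3 * q powr (1/2) + 4 * of_int (A 3) * q powr (1/4), 1:], 2),
          ([:- (q powr (1/2)) + 4 * of_int (B 3) * q powr (1/4), 1:], 4),
          ([:- (q powr (1/2)) - 4 * of_int (B 3) * q powr (1/4), 1:], 4),
          ([:3 * q powr (1/2) - 4 * of_int (A 3) * q powr (1/4), 1:]\<^sup>2
           + [:64 * (of_int (A 4))\<^sup>2 * q powr (3/4):], 1),
          ([:- (q powr (1/2)), 1:]\<^sup>2
           + [:64 * (of_int (B 4))\<^sup>2 * q powr (3/4):], 2)])"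
proof -
  have "(2::nat) ^ 4 dvd 2 ^ m" using assms(5) by (rule le_imp_power_dvd)
  then have "16 dvd p ^ s - 1" using assms(3,6) dvd_trans by fastforce
  moreover have "p mod 8 = 3" using assms(2) by (simp add: cong_def)
  ultimately interpret cyclotomic_field \<gamma> p s
    using assms(1,3,4) by unfold_locales
  interpret cyclotomic_reps \<gamma> p s A B
    unfolding assms(8,9) by unfold_locales (rule quad_rep_is_rep)
  have q: "q = real Q" using assms(3,7) by (simp add: Q_def)
  show ?thesis unfolding q
    using factorization_a[OF assms(5)] factorization_b[of m] factorization_c by blast
qed

end
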